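(* For each integer $n \ge 5$ let $r_n = \operatorname{acosh}\!\left(1 + 2\cos\left(\frac{2\pi}{n}\right)\right)$ and let $r_\infty = \lim_{n\to+\infty} r_n = \operatorname{acosh}(3)$. For $r>0$ let $G_r$ be the subgroup of $\mathrm{Isom}^+(\mathbb{H}^3)$ generated by $A_r, R_{12}, R_{23}, R_{31}$. Then $G_r$ is discrete if and only if $r \in \{r_n : n \ge 5\} \cup [r_\infty, +\infty)$. For all other values of $r>0$ the group $G_r$ is dense in $\mathrm{Isom}^+(\mathbb{H}^3)$. Furthermore, $G_{r_5}$ is cocompact, $G_{r_6}$ is not cocompact but has finite covolume, and $G_{r_n}$ has infinite covolume for all $n \ge 7$.
   Context: $\mathbb{H}^3$ is three dimensional hyperbolic space (curvature $-1$), and $\mathrm{Isom}^+(\mathbb{H}^3)$ is its group of orientation preserving isometries with its usual topology. Fix a point $x_0 \in \mathbb{H}^3$ and an orthonormal tangent frame $v_1,v_2,v_3$ at $x_0$. For $r>0$, $A_r$ is the isometry that transports (by parallel transport) this frame a distance $r$ along the geodesic with initial condition $(x_0,v_1)$, i.e. the pure hyperbolic translation by $r$ along that geodesic. $R_{12}, R_{23}, R_{31}$ are the $90^\circ$ rotations fixing $x_0$ in the planes spanned by $(v_1,v_2)$, $(v_2,v_3)$ and $(v_3,v_1)$ respectively (so $R_{ij}$ fixes the third frame vector and sends $v_i$ to $v_j$ and $v_j$ to $-v_i$). A discrete subgroup is cocompact if its quotient of $\mathbb{H}^3$ is compact, and has finite (resp. infinite) covolume if its quotient of $\mathbb{H}^3$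 has finite (resp. infinite) volume. $\operatorname{acosh}(x) = \log(x + \sqrt{x^2-1})$. *)

theory Defs
  imports "HOL-Analysis.Analysis" "HOL-Algebra.Generated_Groups"
begin

section \<open>Hyperbolic 3-space: the hyperboloid model\<close>

text \<open>The Lorentzian form has signature (3,1); the fourth coordinate is the time coordinate.\<close>

definition mink :: "real^4 \<Rightarrow> real^4 \<Rightarrow> real" where
  "mink x y = x$1 * y$1 + x$2 * y$2 + x$3 * y$3 - x$4 * y$4"

definition hyperboloid :: "(real^4) set" where
  "hyperboloid = {x. mink x x = -1 \<and> x$4 > 0}"

typedef hyp3 = hyperboloid morphisms coords of_coords
proof
  show "axis 4 1 \<in> hyperboloid"
    by (simp add: hyperboloid_def mink_def axis_def)
qed

lemma mink_sym: "mink x y = mink y x"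
  by (simp add: mink_def)

lemma mink_add_left: "mink (x + y) z = mink x z + mink y z"
  by (simp add: mink_def algebra_simps)

lemma mink_add_right: "mink z (x + y) = mink z x + mink z y"
  by (simp add: mink_def algebra_simps)

lemma mink_scaleR_left: "mink (c *\<^sub>R x) y = c * mink x y"
  by (simp add: mink_def algebra_simps)

lemma mink_scaleR_right: "mink x (c *\<^sub>R y) = c * mink x y"
  by (simp add: mink_def algebra_simps)

lemmas mink_bilinear =
  mink_add_left mink_add_right mink_scaleR_left mink_scaleR_right

lemma mink_coords_self: "mink (coords p) (coords p) = -1"
  using coords[of p] by (simp add: hyperboloid_def)

lemma coords_time_pos: "coords p $ 4 > 0"
  using coords[of p] by (simp add: hyperboloid_def)

lemma mink_orthogonal_nonneg:
  assumes "mink (coords q) u = 0"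
  shows "mink u u \<ge> 0" and "mink u u = 0 \<Longrightarrow> u = 0"
proof -
  define y where "y = coords q"
  define A where "A = (u$1)\<^sup>2 + (u$2)\<^sup>2 + (u$3)\<^sup>2"
  define B where "B = (y$1)\<^sup>2 + (y$2)\<^sup>2 + (y$3)\<^sup>2"
  have yy: "(y$4)\<^sup>2 = 1 + B"
    using mink_coords_self[of q] by (simp add: mink_def y_def B_def power2_eq_square)
  have dot: "u$1 * y$1 + u$2 * y$2 + u$3 * y$3 = u$4 * y$4"
    using assms by (simp add: mink_def y_def algebra_simps)
  have lagrange: "A * B - (u$1 * y$1 + u$2 * y$2 + u$3 * y$3)\<^sup>2 =
      (u$1 * y$2 - u$2 * y$1)\<^sup>2 + (u$1 * y$3 - u$3 * y$1)\<^sup>2 + (u$2 * y$3 - u$3 * y$2)\<^sup>2"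
    unfolding A_def B_def by (simp add: algebra_simps power2_eq_square)
  then have "(u$4 * y$4)\<^sup>2 \<le> A * B"
    unfolding dot[symmetric] by (smt (verit) zero_le_power2)
  then have le: "(u$4)\<^sup>2 * (1 + B) \<le> A * B"
    using yy by (simp add: power_mult_distrib)
  have B0: "B \<ge> 0" and A0: "A \<ge> 0" by (simp_all add: A_def B_def)
  have uu: "mink u u = A - (u$4)\<^sup>2"
    by (simp add: mink_def A_def power2_eq_square)
  have key: "A \<le> mink u u * (1 + B)"
    using le unfolding uu by (simp add: algebra_simps)
  show "mink u u \<ge> 0"
    using key A0 B0 by (smt (verit) mult_neg_pos)
  show "u = 0" if "mink u u = 0"
  proof -
    have "A = 0" using key A0 that by simp
    moreover from this have "(u$4)\<^sup>2 = 0" using uu that by simp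
    ultimately have "u$1 = 0" "u$2 = 0" "u$3 = 0" "u$4 = 0"
      unfolding A_def
      by (smt (verit) zero_le_power2 zero_eq_power2)+
    then show ?thesis by (simp add: vec_eq_iff forall_4)
  qed
qed

lemma mink_orthogonal_Cauchy_Schwarz:
  assumes "mink (coords q) u = 0" "mink (coords q) w = 0"
  shows "(mink u w)\<^sup>2 \<le> mink u u * mink w w"
proof (cases "mink w w = 0")
  case True
  then have "w = 0" using mink_orthogonal_nonneg(2)[OF assms(2)] by simp
  then show ?thesis by (simp add: mink_def)
next
  case False
  then have pos: "mink w w > 0"
    using mink_orthogonal_nonneg(1)[OF assms(2)] by simp
  define z where "z = mink w w *\<^sub>R u + (- mink u w) *\<^sub>R w"
  have "mink (coords q) z = 0"
    unfolding z_def mink_bilinear using assms by simp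
  then have "mink z z \<ge> 0" by (rule mink_orthogonal_nonneg)
  moreover have "mink z z = mink w w * (mink u u * mink w w - (mink u w)\<^sup>2)"
    unfolding z_def mink_bilinear mink_sym[of w u]
    by (simp add: algebra_simps power2_eq_square)
  ultimately show ?thesis
    using pos by (simp add: zero_le_mult_iff)
qed

lemma mink_coords_le: "- mink (coords p) (coords q) \<ge> 1"
  and mink_coords_eq_iff: "- mink (coords p) (coords q) = 1 \<longleftrightarrow> p = q"
proof -
  let ?a = "- mink (coords p) (coords q)"
  define u where "u = coords p + (- ?a) *\<^sub>R coords q"
  have orth: "mink (coords q) u = 0"
    by (simp add: u_def mink_bilinear mink_coords_self mink_sym[of "coords q"])
  have uu: "mink u u = ?a\<^sup>2 - 1"
    unfolding u_def mink_bilinear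
    by (simp add: mink_coords_self mink_sym[of "coords q" "coords p"] power2_eq_square)
  then have sq: "?a\<^sup>2 \<ge> 1"
    using mink_orthogonal_nonneg(1)[OF orth] by simp
  have gt: "?a > 0"
  proof -
    define x where "x = coords p"
    define y where "y = coords q"
    have "(x$4)\<^sup>2 = 1 + ((x$1)\<^sup>2 + (x$2)\<^sup>2 + (x$3)\<^sup>2)"
      "(y$4)\<^sup>2 = 1 + ((y$1)\<^sup>2 + (y$2)\<^sup>2 + (y$3)\<^sup>2)"
      using mink_coords_self[of p] mink_coords_self[of q]
      by (simp_all add: mink_def x_def y_def power2_eq_square)
    note sqs = this
    have "(x$1 * y$1 + x$2 * y$2 + x$3 * y$3)\<^sup>2
        \<le> ((x$1)\<^sup>2 + (x$2)\<^sup>2 + (x$3)\<^sup>2) * ((y$1)\<^sup>2 + (y$2)\<^sup>2 + (y$3)\<^sup>2)"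
    proof -
      have "((x$1)\<^sup>2 + (x$2)\<^sup>2 + (x$3)\<^sup>2) * ((y$1)\<^sup>2 + (y$2)\<^sup>2 + (y$3)\<^sup>2)
          - (x$1 * y$1 + x$2 * y$2 + x$3 * y$3)\<^sup>2 =
          (x$1 * y$2 - x$2 * y$1)\<^sup>2 + (x$1 * y$3 - x$3 * y$1)\<^sup>2 + (x$2 * y$3 - x$3 * y$2)\<^sup>2"
        by (simp add: algebra_simps power2_eq_square)
      then show ?thesis by (smt (verit) zero_le_power2)
    qed
    also have "\<dots> < (x$4)\<^sup>2 * (y$4)\<^sup>2"
      unfolding sqs by (rule mult_strict_mono') auto
    also have "\<dots> = (x$4 * y$4)\<^sup>2" by (simp add: power_mult_distrib)
    finally have "x$1 * y$1 + x$2 * y$2 + x$3 * y$3 < x$4 * y$4"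
      by (rule power2_less_imp_less)
        (simp add: x_def y_def coords_time_pos less_imp_le)
    then show ?thesis by (simp add: mink_def x_def y_def)
  qed
  show ge: "?a \<ge> 1"
    using sq gt by (metis less_imp_le one_power2 power2_le_imp_le)
  show "?a = 1 \<longleftrightarrow> p = q"
  proof
    assume a: "?a = 1"
    then have "u = 0"
      using mink_orthogonal_nonneg(2)[OF orth] uu by simp
    then have "coords p = coords q" using a by (simp add: u_def)
    then show "p = q" by (simp add: coords_inject)
  qed (simp add: mink_coords_self)
qed

instantiation hyp3 :: metric_space
begin

definition dist_hyp3 :: "hyp3 \<Rightarrow> hyp3 \<Rightarrow> real" where
  "dist_hyp3 p q = arcosh (- mink (coords p) (coords q))"

definition uniformity_hyp3 :: "(hyp3 \<times> hyp3) filter" where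
  "uniformity_hyp3 = (INF e\<in>{0 <..}. principal {(x, y). dist x y < e})"

definition open_hyp3 :: "hyp3 set \<Rightarrow> bool" where
  "open_hyp3 U \<longleftrightarrow> (\<forall>x\<in>U. eventually (\<lambda>(x', y). x' = x \<longrightarrow> y \<in> U) uniformity)"

instance
proof
  fix x y z :: hyp3
  show "dist x y = 0 \<longleftrightarrow> x = y"
    unfolding dist_hyp3_def
    using mink_coords_le[of x y] mink_coords_eq_iff[of x y] by simp
  show "dist x y \<le> dist x z + dist y z"
  proof -
    let ?a = "- mink (coords x) (coords z)" and ?b = "- mink (coords y) (coords z)"
    define u where "u = coords x + (- ?a) *\<^sub>R coords z"
    define w where "w = coords y + (- ?b) *\<^sub>R coords z"
    have orth: "mink (coords z) u = 0" "mink (coords z) w = 0"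
      by (simp_all add: u_def w_def mink_bilinear mink_coords_self mink_sym[of "coords z"])
    have uu: "mink u u = ?a\<^sup>2 - 1" and ww: "mink w w = ?b\<^sup>2 - 1"
      and uw: "mink u w = mink (coords x) (coords y) + ?a * ?b"
      unfolding u_def w_def mink_bilinear
      by (simp_all add: mink_coords_self mink_sym[of "coords z"] power2_eq_square)
    have a1: "?a \<ge> 1" and b1: "?b \<ge> 1" by (rule mink_coords_le)+
    have "(- mink u w)\<^sup>2 \<le> (?a\<^sup>2 - 1) * (?b\<^sup>2 - 1)"
      using mink_orthogonal_Cauchy_Schwarz[OF orth] uu ww by simp
    then have "- mink u w \<le> sqrt ((?a\<^sup>2 - 1) * (?b\<^sup>2 - 1))"
      by (rule real_le_rsqrt)
    then have "- mink (coords x) (coords y) \<le> ?a * ?b + sqrt (?a\<^sup>2 - 1) * sqrt (?b\<^sup>2 - 1)"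
      using uw by (simp add: real_sqrt_mult)
    also have "\<dots> = cosh (arcosh ?a + arcosh ?b)"
      using a1 b1 by (simp add: cosh_add sinh_arcosh_real del: power2_minus)
    finally have le: "- mink (coords x) (coords y) \<le> cosh (arcosh ?a + arcosh ?b)" .
    have nn: "0 \<le> arcosh ?a + arcosh ?b"
      using a1 b1 by (simp add: arcosh_nonneg_real)
    have "cosh (dist x y) \<le> cosh (arcosh ?a + arcosh ?b)"
      using le mink_coords_le[of x y] by (simp add: dist_hyp3_def)
    then show ?thesis
      using nn mink_coords_le[of x y]
      by (subst (asm) cosh_real_nonneg_le_iff) (auto simp: dist_hyp3_def)
  qed
qed (simp_all only: uniformity_hyp3_def open_hyp3_def)

end


section \<open>Orientation preserving isometries\<close>

definition tangent_space :: "hyp3 \<Rightarrow> (real^4) set" where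
  "tangent_space p = {v. mink (coords p) v = 0}"

text \<open>
  A basis \<open>w\<^sub>1, w\<^sub>2, w\<^sub>3\<close> of the tangent space at \<open>p\<close> is positively oriented when
  \<open>det (p, w\<^sub>1, w\<^sub>2, w\<^sub>3) > 0\<close>. The derivative along the hyperboloid is represented by a
  linear map on the ambient space; only its restriction to the tangent space is determined.
\<close>

definition orientation_preserving :: "(hyp3 \<Rightarrow> hyp3) \<Rightarrow> bool" where
  "orientation_preserving f \<longleftrightarrow>
    (\<forall>p. \<exists>D. ((\<lambda>x. coords (f (of_coords x))) has_derivative D) (at (coords p) within hyperboloid) \<and>
      (\<forall>w1\<in>tangent_space p. \<forall>w2\<in>tangent_space p. \<forall>w3\<in>tangent_space p.
        det (vector [coords p, w1, w2, w3] :: real^4^4) > 0 \<longrightarrow>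
        det (vector [coords (f p), D w1, D w2, D w3] :: real^4^4) > 0))"

definition Isom_plus :: "(hyp3 \<Rightarrow> hyp3) monoid" where
  "Isom_plus = \<lparr>carrier = {f. bij f \<and> (\<forall>p q. dist (f p) (f q) = dist p q) \<and> orientation_preserving f},
     mult = (\<circ>), one = id\<rparr>"

definition compact_open_topology :: "('a::topological_space \<Rightarrow> 'b::topological_space) topology" where
  "compact_open_topology = topology_generated_by {{f. f ` K \<subseteq> U} | K U. compact K \<and> open U}"

definition Isom_plus_topology :: "(hyp3 \<Rightarrow> hyp3) topology" where
  "Isom_plus_topology = subtopology compact_open_topology (carrier Isom_plus)"

definition discrete_in_Isom_plus :: "(hyp3 \<Rightarrow> hyp3) set \<Rightarrow> bool" where
  "discrete_in_Isom_plus \<Gamma> \<longleftrightarrow> subtopology Isom_plus_topology \<Gamma> = discrete_topology \<Gamma>"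

definition dense_in_Isom_plus :: "(hyp3 \<Rightarrow> hyp3) set \<Rightarrow> bool" where
  "dense_in_Isom_plus \<Gamma> \<longleftrightarrow> Abstract_Topology.closure_of Isom_plus_topology \<Gamma> = carrier Isom_plus"


section \<open>Quotients of hyperbolic space\<close>

definition orbit_map :: "(hyp3 \<Rightarrow> hyp3) set \<Rightarrow> hyp3 \<Rightarrow> hyp3 set" where
  "orbit_map \<Gamma> p = (\<lambda>g. g p) ` \<Gamma>"

definition orbit_space :: "(hyp3 \<Rightarrow> hyp3) set \<Rightarrow> hyp3 set topology" where
  "orbit_space \<Gamma> = topology (\<lambda>U. U \<subseteq> range (orbit_map \<Gamma>) \<and> open (orbit_map \<Gamma> -` U))"

lemma openin_orbit_space:
  "openin (orbit_space \<Gamma>) U \<longleftrightarrow> U \<subseteq> range (orbit_map \<Gamma>) \<and> open (orbit_map \<Gamma> -` U)"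
proof -
  have "istopology (\<lambda>U. U \<subseteq> range (orbit_map \<Gamma>) \<and> open (orbit_map \<Gamma> -` U))"
  (is "istopology ?L")
    unfolding istopology_def
  proof (intro conjI allI impI)
    fix S T assume "?L S" "?L T"
    then show "S \<inter> T \<subseteq> range (orbit_map \<Gamma>)" "open (orbit_map \<Gamma> -` (S \<inter> T))"
      unfolding vimage_Int by (blast, intro open_Int) blast+
  next
    fix \<K> assume K: "\<forall>S\<in>\<K>. ?L S"
    then show "\<Union>\<K> \<subseteq> range (orbit_map \<Gamma>)" by blast
    show "open (orbit_map \<Gamma> -` \<Union>\<K>)"
      unfolding vimage_Union by (rule open_UN) (use K in blast)
  qed
  then show ?thesis
    unfolding orbit_space_def by (rule fun_cong[OF topology_inverse'])
qed

lemma quotient_map_orbit_map: "quotient_map euclidean (orbit_space \<Gamma>) (orbit_map \<Gamma>)"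
proof -
  have "topspace (orbit_space \<Gamma>) = range (orbit_map \<Gamma>)"
  proof
    show "range (orbit_map \<Gamma>) \<subseteq> topspace (orbit_space \<Gamma>)"
      by (rule openin_subset) (simp add: openin_orbit_space vimage_def)
    show "topspace (orbit_space \<Gamma>) \<subseteq> range (orbit_map \<Gamma>)"
      using openin_topspace[of "orbit_space \<Gamma>"] unfolding openin_orbit_space by blast
  qed
  then show ?thesis
    unfolding quotient_map_def openin_orbit_space by (simp add: vimage_def)
qed

definition cocompact :: "(hyp3 \<Rightarrow> hyp3) set \<Rightarrow> bool" where
  "cocompact \<Gamma> \<longleftrightarrow> compact_space (orbit_space \<Gamma>)"

text \<open>
  The projection to the space coordinates is a global chart with inverse \<open>hyp_chart\<close>. In it the
  Riemannian metric is \<open>g = I - y y\<^sup>T / (1 + |y|\<^sup>2)\<close>, so that \<open>sqrt (det g) = 1 / sqrt (1 + |y|\<^sup>2)\<close>.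
\<close>

definition hyp_chart :: "real^3 \<Rightarrow> hyp3" where
  "hyp_chart y = of_coords (vector [y$1, y$2, y$3, sqrt (1 + (norm y)\<^sup>2)])"

definition hyp_volume :: "hyp3 measure" where
  "hyp_volume = distr (density lborel (\<lambda>y. ennreal (1 / sqrt (1 + (norm y)\<^sup>2)))) borel hyp_chart"

lemma vector_4 [simp]:
  "(vector [a, b, c, d] :: 'a::zero^4) $ 1 = a"
  "(vector [a, b, c, d] :: 'a::zero^4) $ 2 = b"
  "(vector [a, b, c, d] :: 'a::zero^4) $ 3 = c"
  "(vector [a, b, c, d] :: 'a::zero^4) $ 4 = d"
  unfolding vector_def by simp_all

lemma coords_hyp_chart:
  "coords (hyp_chart y) = vector [y$1, y$2, y$3, sqrt (1 + (norm y)\<^sup>2)]"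
proof -
  have "(norm y)\<^sup>2 = y$1 * y$1 + y$2 * y$2 + y$3 * y$3"
    by (simp add: power2_norm_eq_inner inner_vec_def sum_3)
  moreover have "0 < sqrt (1 + (norm y)\<^sup>2)"
    by (simp add: add_pos_nonneg)
  ultimately show ?thesis
    unfolding hyp_chart_def
    by (intro of_coords_inverse) (simp add: hyperboloid_def mink_def)
qed

lemma continuous_on_hyp_chart: "continuous_on UNIV hyp_chart"
  unfolding continuous_on_def
proof
  fix y :: "real^3"
  let ?m = "\<lambda>x. - mink (coords (hyp_chart x)) (coords (hyp_chart y))"
  have "continuous_on UNIV ?m"
    unfolding mink_def coords_hyp_chart vector_4 by (intro continuous_intros)
  then have "continuous_on UNIV (\<lambda>x. arcosh (?m x))"
    by (rule continuous_on_compose2[OF continuous_on_arcosh[OF order.refl]])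
      (intro image_subsetI, unfold atLeast_iff, rule mink_coords_le)
  then have "((\<lambda>x. dist (hyp_chart x) (hyp_chart y)) \<longlongrightarrow> dist (hyp_chart y) (hyp_chart y)) (at y)"
    unfolding dist_hyp3_def continuous_on_def by (rule bspec) (rule UNIV_I)
  then show "(hyp_chart \<longlongrightarrow> hyp_chart y) (at y within UNIV)"
    by (simp add: tendsto_dist_iff[of hyp_chart])
qed

lemma measurable_hyp_chart [measurable]: "hyp_chart \<in> borel_measurable borel"
  using continuous_on_hyp_chart by (rule borel_measurable_continuous_onI)

definition fundamental_domain :: "(hyp3 \<Rightarrow> hyp3) set \<Rightarrow> hyp3 set \<Rightarrow> bool" where
  "fundamental_domain \<Gamma> F \<longleftrightarrow> F \<in> sets borel \<and> (\<Union>g\<in>\<Gamma>. g ` F) = UNIV \<and>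
     (\<forall>g\<in>\<Gamma>. g \<noteq> id \<longrightarrow> emeasure hyp_volume (F \<inter> g ` F) = 0)"

text \<open>
  For a discrete group the volume of the quotient is the volume of a fundamental domain; it does
  not depend on the choice of the domain.
\<close>

definition has_covolume :: "(hyp3 \<Rightarrow> hyp3) set \<Rightarrow> ennreal \<Rightarrow> bool" where
  "has_covolume \<Gamma> c \<longleftrightarrow> (\<exists>F. fundamental_domain \<Gamma> F \<and> emeasure hyp_volume F = c)"

definition finite_covolume :: "(hyp3 \<Rightarrow> hyp3) set \<Rightarrow> bool" where
  "finite_covolume \<Gamma> \<longleftrightarrow> (\<exists>c. has_covolume \<Gamma> c \<and> c < \<infinity>)"

definition infinite_covolume :: "(hyp3 \<Rightarrow> hyp3) set \<Rightarrow> bool" where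
  "infinite_covolume \<Gamma> \<longleftrightarrow> has_covolume \<Gamma> \<infinity>"


section \<open>The groups\<close>

definition orthonormal_frame :: "hyp3 \<Rightarrow> real^4 \<Rightarrow> real^4 \<Rightarrow> real^4 \<Rightarrow> bool" where
  "orthonormal_frame p v1 v2 v3 \<longleftrightarrow>
     {v1, v2, v3} \<subseteq> tangent_space p \<and>
     mink v1 v1 = 1 \<and> mink v2 v2 = 1 \<and> mink v3 v3 = 1 \<and>
     mink v1 v2 = 0 \<and> mink v2 v3 = 0 \<and> mink v3 v1 = 0"

text \<open>
  \<open>frame_map p v1 v2 v3 q w1 w2 w3\<close> is the isometry carrying the orthonormal frame
  \<open>v1, v2, v3\<close> at \<open>p\<close> to the orthonormal frame \<open>w1, w2, w3\<close> at \<open>q\<close>. It is the restriction of the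
  linear map sending \<open>p, v1, v2, v3\<close> to \<open>q, w1, w2, w3\<close>.
\<close>

definition frame_map ::
  "hyp3 \<Rightarrow> real^4 \<Rightarrow> real^4 \<Rightarrow> real^4 \<Rightarrow> hyp3 \<Rightarrow> real^4 \<Rightarrow> real^4 \<Rightarrow> real^4 \<Rightarrow> hyp3 \<Rightarrow> hyp3" where
  "frame_map p v1 v2 v3 q w1 w2 w3 x = of_coords
     ((- mink (coords x) (coords p)) *\<^sub>R coords q + mink (coords x) v1 *\<^sub>R w1 +
      mink (coords x) v2 *\<^sub>R w2 + mink (coords x) v3 *\<^sub>R w3)"

text \<open>The unit speed geodesic with initial point \<open>p\<close> and initial velocity \<open>v\<close>, and its velocity.\<close>

definition geodesic :: "hyp3 \<Rightarrow> real^4 \<Rightarrow> real \<Rightarrow> hyp3" where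
  "geodesic p v t = of_coords (cosh t *\<^sub>R coords p + sinh t *\<^sub>R v)"

definition geodesic_velocity :: "hyp3 \<Rightarrow> real^4 \<Rightarrow> real \<Rightarrow> real^4" where
  "geodesic_velocity p v t = sinh t *\<^sub>R coords p + cosh t *\<^sub>R v"

text \<open>
  Parallel transport along \<open>geodesic p v1\<close> carries \<open>v1\<close> to the velocity vector and leaves \<open>v2\<close> and
  \<open>v3\<close> constant as vectors of the ambient space.
\<close>

definition transl :: "hyp3 \<Rightarrow> real^4 \<Rightarrow> real^4 \<Rightarrow> real^4 \<Rightarrow> real \<Rightarrow> hyp3 \<Rightarrow> hyp3" where
  "transl p v1 v2 v3 r =
     frame_map p v1 v2 v3 (geodesic p v1 r) (geodesic_velocity p v1 r) v2 v3"

definition rot12 :: "hyp3 \<Rightarrow> real^4 \<Rightarrow> real^4 \<Rightarrow> real^4 \<Rightarrow> hyp3 \<Rightarrow> hyp3" where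
  "rot12 p v1 v2 v3 = frame_map p v1 v2 v3 p v2 (- v1) v3"

definition rot23 :: "hyp3 \<Rightarrow> real^4 \<Rightarrow> real^4 \<Rightarrow> real^4 \<Rightarrow> hyp3 \<Rightarrow> hyp3" where
  "rot23 p v1 v2 v3 = frame_map p v1 v2 v3 p v1 v3 (- v2)"

definition rot31 :: "hyp3 \<Rightarrow> real^4 \<Rightarrow> real^4 \<Rightarrow> real^4 \<Rightarrow> hyp3 \<Rightarrow> hyp3" where
  "rot31 p v1 v2 v3 = frame_map p v1 v2 v3 p (- v3) v2 v1"

definition G_group :: "hyp3 \<Rightarrow> real^4 \<Rightarrow> real^4 \<Rightarrow> real^4 \<Rightarrow> real \<Rightarrow> (hyp3 \<Rightarrow> hyp3) set" where
  "G_group p v1 v2 v3 r = generate Isom_plus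
     {transl p v1 v2 v3 r, rot12 p v1 v2 v3, rot23 p v1 v2 v3, rot31 p v1 v2 v3}"

definition r_seq :: "nat \<Rightarrow> real" where
  "r_seq n = arcosh (1 + 2 * cos (2 * pi / real n))"

definition r_infty :: real where
  "r_infty = arcosh 3"

end

theory Submission
  imports Defs
begin

text \<open>
  In coordinates adapted to the frame, \<open>G\<^sub>r\<close> is the even subgroup of the group generated by four
  reflections: three generate the symmetry group of the cube, the fourth is the reflection in the
  plane orthogonal to the axis of \<open>A\<^sub>r\<close> at distance \<open>r/2\<close>. It meets one other mirror under the angle
  \<open>\<theta>\<close> with \<open>cos \<theta> = cosh (r/2) / sqrt 2\<close> and is orthogonal to the remaining two, so that
  \<open>r = r\<^sub>n\<close> means \<open>\<theta> = \<pi>/n\<close> and \<open>r \<ge> r\<^sub>\<infinity>\<close> means that the two planes do not meet.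

  In these cases Tits' theorem on the geometric representation of a Coxeter group shows that the
  chamber cut out by the four mirrors is a fundamental domain of the reflection group. In the
  direction of the vertex of the cube it is bounded, has a cusp, or contains an open cone of
  directions, according to whether \<open>sinh\<^sup>2 (r/2) = cos (2\<pi>/n)\<close> is less than, equal to or greater
  than \<open>1/2\<close>.

  For other \<open>r\<close> the angle is an irrational multiple of \<open>\<pi>\<close>, or \<open>k\<pi>/m\<close> in lowest terms with \<open>k \<ge> 2\<close>.
  In the second case the rotation by \<open>2\<pi>/m\<close> shrinks the distance between its axis and a translate of
  it; both cases contradict discreteness. The Lie algebra of the closure is then a nonzero subspace of
  \<open>so(3,1)\<close> invariant under the rotations of the cube and under \<open>A\<^sub>r\<close>, hence everything.
\<close>

section \<open>Isometries as Lorentz matrices\<close>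

text \<open>Tits' theorem is proved for the full reflection group as a group of linear maps;
  \<open>G\<^sub>r\<close> consists of the words of even length, so two adjacent chambers form its
  domain. The positivity of roots is used in two ways: a nontrivial element puts the chamber and its
  image on opposite sides of a wall, and a point of the chamber is nearest in its orbit to every
  other point of the chamber.

  Below \<open>r\<^sub>\<infinity>\<close> the angle \<theta> lies between 0 and \<pi>/4, because
  \<open>cosh (r/2)\<close> lies between 1 and \<open>sqrt 2\<close>; this is why n starts at 5.

  For a proper fraction the contraction takes place in dimension two. The reflections 1, 2 and 4 fix
  a vector w with square \<open>2 * sinh\<^sup>2 (r/2) - 1\<close>, so their triangle group acts on
  a sphere or on a hyperbolic plane according to the sign. The cosine or the hyperbolic cosine of a
  distance is in both cases a ratio of Minkowski products, and one computation serves both. The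
  Euclidean value between them gives \<theta> = \<pi>/6, which is not a proper fraction.\<close>

lemma mink_nondegenerate:
  assumes "\<And>y. mink x y = 0"
  shows "x = 0"
  using assms[of "axis 1 1"] assms[of "axis 2 1"] assms[of "axis 3 1"] assms[of "axis 4 1"]
  by (simp add: mink_def axis_def vec_eq_iff forall_4)

lemma mink_diff_left: "mink (x - y) z = mink x z - mink y z"
  and mink_diff_right: "mink z (x - y) = mink z x - mink z y"
  and mink_minus_left: "mink (- x) z = - mink x z"
  and mink_minus_right: "mink z (- x) = - mink z x"
  and mink_zero_left: "mink 0 z = 0"
  and mink_zero_right: "mink z 0 = 0"
  by (simp_all add: mink_def algebra_simps)

lemmas mink_simps = mink_bilinear mink_diff_left mink_diff_right mink_minus_left mink_minus_right
  mink_zero_left mink_zero_right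

definition mink_sign :: "4 \<Rightarrow> real" where "mink_sign i = (if i = 4 then -1 else 1)"

text \<open>The adjoint with respect to \<open>mink\<close>, that is J M^T J with J the diagonal
  matrix of signs. On Lorentz matrices it is the inverse, and it stands for the inverse
  throughout.\<close>

definition mink_adj :: "real^4^4 \<Rightarrow> real^4^4" where
  "mink_adj M = (\<chi> i j. mink_sign i * mink_sign j * M$j$i)"

lemma mink_matrix_adj: "mink (M *v x) y = mink x (mink_adj M *v y)"
  by (simp add: mink_def mink_adj_def mink_sign_def matrix_vector_mult_def sum_4 algebra_simps)

lemma mink_adj_adj: "mink_adj (mink_adj M) = M"
  by (simp add: mink_adj_def mink_sign_def vec_eq_iff)

lemma mink_adj_mult: "mink_adj (A ** B) = mink_adj B ** mink_adj A"
  by (simp add: mink_adj_def mink_sign_def vec_eq_iff forall_4 matrix_matrix_mult_def sum_4)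

lemma mink_adj_id: "mink_adj (mat 1) = mat 1"
  by (simp add: mink_adj_def mink_sign_def vec_eq_iff forall_4 mat_def)

lemma mink_adj_diff: "mink_adj (A - B) = mink_adj A - mink_adj B"
  and mink_adj_scaleR: "mink_adj (c *\<^sub>R A) = c *\<^sub>R mink_adj A"
  by (simp_all add: mink_adj_def mink_sign_def vec_eq_iff forall_4)

lemma norm_matrix_4:
  fixes M :: "real^4^4"
  shows "(norm M)\<^sup>2 = (\<Sum>i\<in>UNIV. \<Sum>j\<in>UNIV. (M$i$j)\<^sup>2)"
  unfolding power2_norm_eq_inner by (simp add: inner_vec_def power2_eq_square)

lemma norm_mink_adj: "norm (mink_adj M) = norm M"
proof -
  have "(norm (mink_adj M))\<^sup>2 = (norm M)\<^sup>2"
    unfolding norm_matrix_4 by (simp add: mink_adj_def mink_sign_def sum_4)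
  then show ?thesis by simp
qed

definition lorentz :: "real^4^4 \<Rightarrow> bool" where
  "lorentz M \<longleftrightarrow> (\<forall>x y. mink (M *v x) (M *v y) = mink x y)"

lemma lorentz_iff_adj_mult: "lorentz M \<longleftrightarrow> mink_adj M ** M = mat 1"
proof
  assume L: "lorentz M"
  have "(mink_adj M ** M) *v y = mat 1 *v y" for y
  proof -
    have "mink ((mink_adj M ** M) *v y - y) x = 0" for x
    proof -
      have "mink ((mink_adj M ** M) *v y) x = mink (mink_adj M *v (M *v y)) x"
        by (simp add: matrix_vector_mul_assoc)
      also have "\<dots> = mink (M *v y) (M *v x)"
        by (simp add: mink_matrix_adj mink_adj_adj)
      finally show ?thesis using L by (simp add: mink_simps lorentz_def)
    qed
    then have "(mink_adj M ** M) *v y - y = 0" by (rule mink_nondegenerate)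
    then show ?thesis by simp
  qed
  then show "mink_adj M ** M = mat 1" by (simp add: matrix_eq)
next
  assume "mink_adj M ** M = mat 1"
  then show "lorentz M"
    by (simp add: lorentz_def mink_matrix_adj matrix_vector_mul_assoc)
qed

lemma lorentz_mult_adj: "lorentz M \<Longrightarrow> M ** mink_adj M = mat 1"
  by (simp add: lorentz_iff_adj_mult matrix_left_right_inverse)

lemma lorentz_adj: "lorentz M \<Longrightarrow> lorentz (mink_adj M)"
  using lorentz_mult_adj by (simp add: lorentz_iff_adj_mult[of "mink_adj M"] mink_adj_adj)

lemma lorentz_mult: "lorentz A \<Longrightarrow> lorentz B \<Longrightarrow> lorentz (A ** B)"
  by (simp add: lorentz_def matrix_vector_mul_assoc[symmetric])

lemma lorentz_id: "lorentz (mat 1)"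
  by (simp add: lorentz_def)

definition mink_form :: "real^4^4" where
  "mink_form = (\<chi> i j. if i = j then mink_sign i else 0)"

lemma det_lorentz:
  assumes "lorentz M"
  shows "det M = 1 \<or> det M = -1"
proof -
  have adj: "mink_adj M = mink_form ** transpose M ** mink_form"
    by (simp add: mink_adj_def mink_form_def mink_sign_def vec_eq_iff forall_4
        matrix_matrix_mult_def transpose_def sum_4)
  have "mink_form ** mink_form = mat 1"
    by (simp add: mink_form_def mink_sign_def vec_eq_iff forall_4 matrix_matrix_mult_def mat_def sum_4)
  then have "det mink_form * det mink_form = 1"
    by (metis det_I det_mul)
  moreover have "det (mink_adj M) * det M = 1"
    using assms by (metis det_I det_mul lorentz_iff_adj_mult)
  ultimately have "(det M)\<^sup>2 = 1"
    unfolding adj det_mul det_transpose power2_eq_square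
    by (metis mult.assoc mult.commute mult.left_neutral)
  then show ?thesis by (simp add: power2_eq_1_iff)
qed

text \<open>A vector of square -1 never has time coordinate 0, so it lies on one of the two sheets.
  On the lower sheet, \<open>- x\<close> would be a point of the hyperboloid and the reversed
  Cauchy-Schwarz inequality would make the product with y positive.\<close>

lemma mink_neg_imp_same_sheet:
  assumes "mink x x = -1" "y \<in> hyperboloid" "mink x y < 0"
  shows "x \<in> hyperboloid"
proof (rule ccontr)
  assume *: "x \<notin> hyperboloid"
  have "x$4 \<noteq> 0"
  proof
    assume "x$4 = 0"
    then have "mink x x \<ge> 0" by (simp add: mink_def)
    with assms(1) show False by simp
  qed
  with * have "- x \<in> hyperboloid"
    using assms(1) by (auto simp: hyperboloid_def mink_simps)
  then obtain p q where "coords p = - x" "coords q = y"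
    using assms(2) by (metis of_coords_inverse)
  then show False
    using mink_coords_le[of p q] assms(3) by (simp add: mink_simps)
qed

text \<open>The (4,4) entry is minus the product of the time axis with its image, so its sign
  decides whether the sheets are kept. The determinant is left free: the matrix of a negatively
  oriented frame belongs here as well.\<close>

definition Lorentz_group :: "(real^4^4) set" where
  "Lorentz_group = {M. lorentz M \<and> M$4$4 > 0}"

lemma axis_4_hyperboloid: "axis 4 1 \<in> hyperboloid"
  by (simp add: hyperboloid_def mink_def axis_def)

lemma matrix_axis_nth: "((M::real^4^4) *v axis j 1) $ i = M$i$j"
  by (simp add: matrix_vector_mult_basis column_def)

lemma mink_axis_4: "mink x (axis 4 1) = - x$4"
  by (simp add: mink_def axis_def)

lemma Lorentz_group_hyperboloid:
  assumes M: "M \<in> Lorentz_group" and x: "x \<in> hyperboloid"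
  shows "M *v x \<in> hyperboloid"
proof -
  have L: "mink (M *v x) (M *v y) = mink x y" for x y
    using M by (simp add: Lorentz_group_def lorentz_def)
  have "M *v axis 4 1 \<in> hyperboloid"
    using M axis_4_hyperboloid by (simp add: hyperboloid_def L matrix_axis_nth Lorentz_group_def)
  moreover have "mink (M *v x) (M *v x) = -1"
    using x by (simp add: L hyperboloid_def)
  moreover have "mink (M *v x) (M *v axis 4 1) < 0"
    using x by (simp add: L mink_axis_4 hyperboloid_def)
  ultimately show ?thesis using mink_neg_imp_same_sheet by blast
qed

lemma Lorentz_groupI:
  assumes "lorentz M" "x \<in> hyperboloid" "M *v x \<in> hyperboloid"
  shows "M \<in> Lorentz_group"
proof -
  have L: "mink (M *v x) (M *v y) = mink x y" for x y
    using assms by (simp add: lorentz_def)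
  have "M *v axis 4 1 \<in> hyperboloid"
  proof (rule mink_neg_imp_same_sheet)
    show "mink (M *v axis 4 1) (M *v axis 4 1) = -1"
      using axis_4_hyperboloid by (simp add: L hyperboloid_def)
    show "M *v x \<in> hyperboloid" by fact
    show "mink (M *v axis 4 1) (M *v x) < 0"
      using assms(2) by (simp add: L mink_sym[of "axis 4 1"] mink_axis_4 hyperboloid_def)
  qed
  then show ?thesis
    using assms(1) by (simp add: hyperboloid_def Lorentz_group_def matrix_axis_nth)
qed

lemma Lorentz_group_mult:
  assumes "A \<in> Lorentz_group" "B \<in> Lorentz_group"
  shows "A ** B \<in> Lorentz_group"
proof (rule Lorentz_groupI)
  show "lorentz (A ** B)" using assms by (simp add: Lorentz_group_def lorentz_mult)
  show "axis 4 1 \<in> hyperboloid" by (rule axis_4_hyperboloid)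
  show "(A ** B) *v axis 4 1 \<in> hyperboloid"
    using assms axis_4_hyperboloid
    by (simp add: matrix_vector_mul_assoc[symmetric] Lorentz_group_hyperboloid)
qed

lemma Lorentz_group_adj:
  assumes "A \<in> Lorentz_group"
  shows "mink_adj A \<in> Lorentz_group"
  using assms by (simp add: Lorentz_group_def lorentz_adj) (simp add: mink_adj_def mink_sign_def)

lemma Lorentz_group_id: "mat 1 \<in> Lorentz_group"
  using lorentz_id by (simp add: Lorentz_group_def) (simp add: mat_def)

definition hyp_act :: "real^4^4 \<Rightarrow> hyp3 \<Rightarrow> hyp3" where
  "hyp_act M p = of_coords (M *v coords p)"

lemma coords_hyp_act: "M \<in> Lorentz_group \<Longrightarrow> coords (hyp_act M p) = M *v coords p"
  unfolding hyp_act_def by (intro of_coords_inverse Lorentz_group_hyperboloid coords)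

lemma hyp_act_mult:
  assumes "A \<in> Lorentz_group" "B \<in> Lorentz_group"
  shows "hyp_act (A ** B) = hyp_act A \<circ> hyp_act B"
  using assms by (auto simp: coords_inject[symmetric] coords_hyp_act Lorentz_group_mult
      matrix_vector_mul_assoc)

lemma hyp_act_id: "hyp_act (mat 1) = id"
  by (auto simp: hyp_act_def coords_inverse)

lemma hyp_act_adj:
  assumes "A \<in> Lorentz_group"
  shows "hyp_act (mink_adj A) \<circ> hyp_act A = id" "hyp_act A \<circ> hyp_act (mink_adj A) = id"
proof -
  have "lorentz A" using assms by (simp add: Lorentz_group_def)
  then show "hyp_act (mink_adj A) \<circ> hyp_act A = id" "hyp_act A \<circ> hyp_act (mink_adj A) = id"
    using assms by (simp_all add: hyp_act_mult[symmetric] Lorentz_group_adj lorentz_iff_adj_mult[symmetric]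
        lorentz_mult_adj hyp_act_id)
      (metis hyp_act_id lorentz_iff_adj_mult)
qed

lemma bij_hyp_act: "A \<in> Lorentz_group \<Longrightarrow> bij (hyp_act A)"
  using hyp_act_adj o_bij by blast

lemma mink_coords_hyp_act:
  "A \<in> Lorentz_group \<Longrightarrow> mink (coords (hyp_act A p)) (coords (hyp_act A q)) = mink (coords p) (coords q)"
  by (simp add: coords_hyp_act Lorentz_group_def lorentz_def)

lemma dist_hyp_act: "A \<in> Lorentz_group \<Longrightarrow> dist (hyp_act A p) (hyp_act A q) = dist p q"
  by (simp add: dist_hyp3_def mink_coords_hyp_act)

lemma cosh_dist_hyp3: "cosh (dist p q) = - mink (coords p) (coords q)"
  using mink_coords_le[of p q] by (simp add: dist_hyp3_def)

lemma dist_hyp3_le_iff: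
  "dist p q \<le> dist p' q' \<longleftrightarrow> mink (coords p') (coords q') \<le> mink (coords p) (coords q)"
proof -
  have "dist p q \<le> dist p' q' \<longleftrightarrow> cosh (dist p q) \<le> cosh (dist p' q')"
    by (simp add: cosh_real_nonneg_le_iff)
  then show ?thesis by (simp add: cosh_dist_hyp3)
qed

text \<open>The hyperboloid spans the space: it contains the time axis and, for every space axis,
  the vector \<open>axis i 1 + sqrt 2 *\<^sub>R axis 4 1\<close>.\<close>

lemma matrix_determined_on_hyperboloid:
  fixes A B :: "real^4^4"
  assumes "\<And>p. A *v coords p = B *v coords p"
  shows "A = B"
proof -
  have H: "A *v x = B *v x" if "x \<in> hyperboloid" for x
    using assms[of "of_coords x"] that by (simp add: of_coords_inverse)
  have 4: "A *v axis 4 1 = B *v axis 4 1"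
    by (rule H) (rule axis_4_hyperboloid)
  have i: "A *v axis i 1 = B *v axis i 1" if "i \<noteq> 4" for i :: 4
  proof -
    have "axis i 1 + sqrt 2 *\<^sub>R axis 4 1 \<in> hyperboloid"
      using that exhaust_4[of i] by (auto simp: hyperboloid_def mink_def axis_def)
    from H[OF this] 4 show ?thesis
      by (simp add: matrix_vector_right_distrib matrix_vector_mult_scaleR)
  qed
  then have "A *v axis i 1 = B *v axis i 1" for i :: 4
    using 4 by (cases "i = 4") auto
  then show ?thesis
    by (metis matrix_axis_nth vec_eq_iff)
qed

lemma inj_on_hyp_act: "inj_on hyp_act Lorentz_group"
proof (rule inj_onI)
  fix A B assume AB: "A \<in> Lorentz_group" "B \<in> Lorentz_group" "hyp_act A = hyp_act B"
  then have "A *v coords p = B *v coords p" for p by (metis coords_hyp_act)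
  then show "A = B" by (rule matrix_determined_on_hyperboloid)
qed

text \<open>Distances determine Minkowski products through \<open>cosh\<close>, so the images of
  four independent points of the hyperboloid have the right Gram matrix and define M. Every other
  point is recovered from its products with these four.\<close>

lemma isometry_is_hyp_act:
  assumes f: "\<And>p q. dist (f p) (f q) = dist p (q::hyp3)"
  shows "\<exists>M\<in>Lorentz_group. f = hyp_act M"
proof -
  have mf: "mink (coords (f p)) (coords (f q)) = mink (coords p) (coords q)" for p q
    using f[of p q] cosh_dist_hyp3[of p q] cosh_dist_hyp3[of "f p" "f q"] by simp
  \<comment> \<open>The factor \<open>sqrt 2\<close> gives Minkowski square 1 - 2 = -1, so these
    basis vectors are points of the hyperboloid.\<close>
  define b where "b i = (if i = 4 then axis 4 1 else axis i 1 + sqrt 2 *\<^sub>R axis 4 (1::real))" for i :: 4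
  have bh: "b i \<in> hyperboloid" for i
    using exhaust_4[of i] by (auto simp: b_def hyperboloid_def mink_def axis_def)
  define g where "g i = coords (f (of_coords (b i)))" for i
  have gg: "mink (g i) (g j) = mink (b i) (b j)" for i j
    by (simp add: g_def mf of_coords_inverse bh)
  define c where "c i = (if i = 4 then g 4 else g i - sqrt 2 *\<^sub>R g 4)" for i
  define M :: "real^4^4" where "M = (\<chi> i j. c j $ i)"
  have Mv: "M *v x = x$1 *\<^sub>R c 1 + x$2 *\<^sub>R c 2 + x$3 *\<^sub>R c 3 + x$4 *\<^sub>R c 4" for x
    by (simp add: M_def vec_eq_iff matrix_vector_mult_def sum_4 mult.commute)
  have cc: "mink (c i) (c j) = mink (axis i 1) (axis j 1)" for i j
    unfolding c_def using exhaust_4[of i] exhaust_4[of j]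
    by (auto simp: mink_simps gg) (auto simp: b_def mink_def axis_def algebra_simps)
  have L: "lorentz M"
    unfolding lorentz_def Mv
    by (simp add: mink_simps cc) (simp add: mink_def axis_def algebra_simps)
  have Mb: "M *v b i = g i" for i
    using exhaust_4[of i] unfolding Mv by (auto simp: b_def c_def axis_def)
  have "M *v b 4 \<in> hyperboloid" unfolding Mb by (simp add: g_def coords)
  then have M: "M \<in> Lorentz_group"
    using Lorentz_groupI[OF L bh[of 4]] by simp
  have "coords (f p) = M *v coords p" for p
  proof -
    \<comment> \<open>Difference between p and the pullback of its image; it is orthogonal to the
      basis \<open>b\<close> and therefore vanishes.\<close>
    let ?d = "mink_adj M *v coords (f p) - coords p"
    have d: "mink ?d (b i) = 0" for i
    proof -
      have "mink (mink_adj M *v coords (f p)) (b i) = mink (coords (f p)) (g i)"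
        by (simp add: mink_matrix_adj mink_adj_adj Mb)
      also have "\<dots> = mink (coords p) (b i)"
        by (simp add: g_def mf of_coords_inverse bh)
      finally show ?thesis by (simp add: mink_simps)
    qed
    have "?d = 0"
      using d[of 1] d[of 2] d[of 3] d[of 4]
      by (simp add: b_def mink_def axis_def vec_eq_iff forall_4)
    then have "mink_adj M *v coords (f p) = coords p" by simp
    then have "M *v (mink_adj M *v coords (f p)) = M *v coords p" by simp
    then show ?thesis
      using lorentz_mult_adj[OF L] by (simp add: matrix_vector_mul_assoc)
  qed
  then have "f = hyp_act M"
    using coords_hyp_act[OF M] by (auto simp: coords_inject[symmetric])
  with M show ?thesis by blast
qed


section \<open>Frobenius norm estimates and the topology of hyperbolic space\<close>

lemma norm_matrix_vector_le:
  fixes A :: "real^'n^'m"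
  shows "norm (A *v x) \<le> norm A * norm x"
proof -
  have "norm (A *v x) = L2_set (\<lambda>i. norm ((A *v x)$i)) UNIV"
    by (simp add: norm_vec_def)
  also have "\<dots> \<le> L2_set (\<lambda>i. norm (A$i) * norm x) UNIV"
  proof (rule L2_set_mono)
    fix i
    have "(A *v x)$i = inner (A$i) x"
      by (simp add: matrix_vector_mult_def inner_vec_def)
    then show "norm ((A *v x)$i) \<le> norm (A$i) * norm x"
      using Cauchy_Schwarz_ineq2[of "A$i" x] by simp
  qed simp
  also have "\<dots> = norm A * norm x"
    by (simp add: norm_vec_def[of A] L2_set_left_distrib)
  finally show ?thesis .
qed

lemma norm_matrix_mult_le:
  fixes A :: "real^'n^'m" and B :: "real^'k^'n"
  shows "norm (A ** B) \<le> norm A * norm B"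
proof -
  have row: "(A ** B) $ i = (A$i) v* B" for i
    by (simp add: vec_eq_iff matrix_matrix_mult_def vector_matrix_mult_def mult.commute)
  have "inner (transpose B) (transpose B) = inner B B"
    unfolding inner_vec_def transpose_def by (simp only: vec_lambda_beta) (rule sum.swap)
  then have tr: "norm (transpose B) = norm B"
    by (simp add: norm_eq_sqrt_inner)
  have le: "norm ((A ** B) $ i) \<le> norm (A$i) * norm B" for i
    unfolding row using norm_matrix_vector_le[of "transpose B" "A$i"]
    by (simp add: tr mult.commute)
  have "norm (A ** B) = L2_set (\<lambda>i. norm ((A ** B)$i)) UNIV"
    by (simp add: norm_vec_def)
  also have "\<dots> \<le> L2_set (\<lambda>i. norm (A$i) * norm B) UNIV"
    by (rule L2_set_mono) (use le in auto)
  also have "\<dots> = norm A * norm B"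
    by (simp add: norm_vec_def[of A] L2_set_left_distrib)
  finally show ?thesis .
qed

text \<open>The diagonal entries of \<open>mink_adj M ** M = mat 1\<close>, combined with the last
  one of \<open>M ** mink_adj M = mat 1\<close>, express the sum of all squared entries through the
  (4,4) entry alone. As that entry is the \<open>cosh\<close> of the displacement of the origin,
  bounds on norms and on displacements are interchangeable.\<close>

lemma norm_Lorentz_group:
  assumes "M \<in> Lorentz_group"
  shows "norm M = 2 * M$4$4"
proof -
  have L: "lorentz M" and pos: "M$4$4 > 0" using assms by (auto simp: Lorentz_group_def)
  have "(mink_adj M ** M)$j$j = mat 1 $ j $ j" "(M ** mink_adj M)$j$j = mat 1 $ j $ j" for j
    using L lorentz_iff_adj_mult lorentz_mult_adj by metis+
  note * = this
  have "(norm M)\<^sup>2 = (2 * M$4$4)\<^sup>2"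
    unfolding norm_matrix_4
    using *(1)[of 1] *(1)[of 2] *(1)[of 3] *(1)[of 4] *(2)[of 4]
    by (simp add: matrix_matrix_mult_def mink_adj_def mink_sign_def sum_4 mat_def power2_eq_square)
  then show ?thesis
    by (rule power2_eq_imp_eq) (use pos in auto)
qed

lemma cosh_dist_axis_4:
  "coords p $ 4 = cosh (dist p (of_coords (axis 4 1)))"
  by (simp add: cosh_dist_hyp3 of_coords_inverse axis_4_hyperboloid mink_axis_4)

lemma mink_diff_self_coords:
  "mink (coords p - coords q) (coords p - coords q) = 2 * (cosh (dist p q) - 1)"
  by (simp add: mink_simps mink_coords_self cosh_dist_hyp3 mink_sym[of "coords q"])

lemma norm_square_mink: "(norm x)\<^sup>2 = mink x x + 2 * (x$4)\<^sup>2"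
  unfolding power2_norm_eq_inner by (simp add: inner_vec_def sum_4 mink_def power2_eq_square)

lemma mink_self_le_norm: "mink x x \<le> (norm x)\<^sup>2"
  by (simp add: norm_square_mink)

lemma norm_coords_le: "norm (coords p) \<le> 2 * cosh (dist p (of_coords (axis 4 1)))"
proof -
  have "(norm (coords p))\<^sup>2 = 2 * (coords p $ 4)\<^sup>2 - 1"
    by (simp add: norm_square_mink mink_coords_self)
  moreover have "(2 * coords p $ 4)\<^sup>2 = 4 * (coords p $ 4)\<^sup>2"
    by (simp add: power_mult_distrib)
  ultimately have "(norm (coords p))\<^sup>2 \<le> (2 * coords p $ 4)\<^sup>2"
    using zero_le_power2[of "coords p $ 4"] by linarith
  then have "norm (coords p) \<le> 2 * coords p $ 4"
    by (rule power2_le_imp_le) (simp add: coords_time_pos less_imp_le)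
  then show ?thesis by (simp add: cosh_dist_axis_4)
qed

text \<open>The Euclidean square of a difference is its Minkowski square plus twice the square of
  the time difference. The first is a function of the distance, and the time coordinate is itself
  the \<open>cosh\<close> of a distance.\<close>

lemma continuous_on_coords: "continuous_on A coords"
proof -
  have "isCont coords p" for p
  proof -
    let ?d = "\<lambda>q. coords q - coords p"
    have "((\<lambda>q. 2 * (cosh (dist q p) - 1) + 2 * (cosh (dist q (of_coords (axis 4 1)))
        - cosh (dist p (of_coords (axis 4 1))))\<^sup>2) \<longlongrightarrow> 2 * (cosh (dist p p) - 1) +
        2 * (cosh (dist p (of_coords (axis 4 1))) - cosh (dist p (of_coords (axis 4 1))))\<^sup>2) (at p)"
      by (intro tendsto_intros)
    then have "((\<lambda>q. (norm (?d q))\<^sup>2) \<longlongrightarrow> 0) (at p)"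
      by (simp add: norm_square_mink mink_diff_self_coords cosh_dist_axis_4[symmetric])
    then have "((\<lambda>q. sqrt ((norm (?d q))\<^sup>2)) \<longlongrightarrow> sqrt 0) (at p)"
      by (rule tendsto_real_sqrt)
    then have "((\<lambda>q. norm (?d q)) \<longlongrightarrow> 0) (at p)" by simp
    then show ?thesis
      unfolding isCont_def by (simp add: tendsto_norm_zero_iff LIM_zero_iff)
  qed
  then show ?thesis by (simp add: continuous_at_imp_continuous_on)
qed

lemma coords_eq_hyp_chart:
  "p = hyp_chart (vector [coords p $ 1, coords p $ 2, coords p $ 3])"
proof -
  let ?y = "vector [coords p $ 1, coords p $ 2, coords p $ 3] :: real^3"
  have "(norm ?y)\<^sup>2 = (coords p $ 1)\<^sup>2 + (coords p $ 2)\<^sup>2 + (coords p $ 3)\<^sup>2"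
    unfolding power2_norm_eq_inner by (simp add: inner_vec_def sum_3 power2_eq_square)
  then have "1 + (norm ?y)\<^sup>2 = (coords p $ 4)\<^sup>2"
    using mink_coords_self[of p] by (simp add: mink_def power2_eq_square)
  then have "sqrt (1 + (norm ?y)\<^sup>2) = coords p $ 4"
    using coords_time_pos[of p] by simp
  then have "coords (hyp_chart ?y) = coords p"
    unfolding coords_hyp_chart by (simp add: vec_eq_iff forall_4)
  then show ?thesis by (simp add: coords_inject)
qed

text \<open>Dropping the time coordinate does not increase the norm, so K is a closed part of the
  continuous image of a Euclidean ball under the chart.\<close>

lemma compact_hyp3:
  fixes K :: "hyp3 set"
  assumes "closed K" and bdd: "\<And>p. p \<in> K \<Longrightarrow> norm (coords p) \<le> R"
  shows "compact K"
proof -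
  have "compact (hyp_chart ` cball 0 R)"
    by (intro compact_continuous_image continuous_on_subset[OF continuous_on_hyp_chart]) auto
  moreover have "K \<subseteq> hyp_chart ` cball 0 R"
  proof
    fix p assume "p \<in> K"
    let ?y = "vector [coords p $ 1, coords p $ 2, coords p $ 3] :: real^3"
    have "(norm ?y)\<^sup>2 \<le> (norm (coords p))\<^sup>2"
      unfolding power2_norm_eq_inner by (simp add: inner_vec_def sum_3 sum_4 power2_eq_square)
    then have "norm ?y \<le> norm (coords p)" by (rule power2_le_imp_le) simp
    with bdd[OF \<open>p \<in> K\<close>] have "?y \<in> cball 0 R" by simp
    then show "p \<in> hyp_chart ` cball 0 R"
      using coords_eq_hyp_chart by (metis imageI)
  qed
  ultimately have "compact (hyp_chart ` cball 0 R \<inter> K)" "hyp_chart ` cball 0 R \<inter> K = K"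
    using assms(1) by (auto intro: compact_Int_closed)
  then show ?thesis by simp
qed

lemma compact_cball_hyp3: "compact (cball (p::hyp3) R)"
proof (rule compact_hyp3)
  fix q assume "q \<in> cball p R"
  then have "dist q (of_coords (axis 4 1)) \<le> R + dist p (of_coords (axis 4 1))"
    using dist_triangle[of q "of_coords (axis 4 1)" p] by (simp add: dist_commute)
  moreover have "0 \<le> dist q (of_coords (axis 4 1))" by simp
  ultimately have "cosh (dist q (of_coords (axis 4 1))) \<le> cosh (R + dist p (of_coords (axis 4 1)))"
    by (subst cosh_real_nonneg_le_iff) (linarith | simp)+
  then show "norm (coords q) \<le> 2 * cosh (R + dist p (of_coords (axis 4 1)))"
    using norm_coords_le[of q] by simp
qed simp

lemma separated_finite_Int_compact:
  fixes K :: "'a::metric_space set"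
  assumes "compact K" "e > 0" "\<And>x y. x \<in> S \<Longrightarrow> y \<in> S \<Longrightarrow> dist x y < e \<Longrightarrow> x = y"
  shows "finite (S \<inter> K)"
proof (rule ccontr)
  assume "infinite (S \<inter> K)"
  then obtain x where "x islimpt (S \<inter> K)"
    using Heine_Borel_imp_Bolzano_Weierstrass[OF assms(1), of "S \<inter> K"] by blast
  then have inf: "infinite (S \<inter> K \<inter> ball x (e/2))"
    using assms(2) unfolding islimpt_eq_infinite_ball by simp
  then obtain y where y: "y \<in> S \<inter> K \<inter> ball x (e/2)" using infinite_imp_nonempty by blast
  have "S \<inter> K \<inter> ball x (e/2) \<subseteq> {y}"
  proof
    fix z assume z: "z \<in> S \<inter> K \<inter> ball x (e/2)"
    then have "dist z y < e"
      using y dist_triangle_half_r[of x z e y] by (simp add: dist_commute)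
    then show "z \<in> {y}" using assms(3)[of z y] y z by auto
  qed
  with inf show False by (meson finite.emptyI finite.insertI finite_subset)
qed

section \<open>Orientation and the sign of the determinant\<close>

lemma geodesic_in_hyperboloid:
  assumes "u \<in> tangent_space p" "mink u u = 1"
  shows "cosh t *\<^sub>R coords p + sinh t *\<^sub>R u \<in> hyperboloid"
proof (rule mink_neg_imp_same_sheet)
  have pu: "mink (coords p) u = 0" "mink u (coords p) = 0"
    using assms(1) by (auto simp: tangent_space_def mink_sym)
  show "mink (cosh t *\<^sub>R coords p + sinh t *\<^sub>R u) (cosh t *\<^sub>R coords p + sinh t *\<^sub>R u) = -1"
    using cosh_square_eq[of t]
    by (simp add: mink_simps pu assms(2) mink_coords_self power2_eq_square)
  show "coords p \<in> hyperboloid" by (rule coords)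
  show "mink (cosh t *\<^sub>R coords p + sinh t *\<^sub>R u) (coords p) < 0"
    by (simp add: mink_simps pu mink_coords_self)
qed

text \<open>The derivative in \<open>orientation_preserving\<close> is tested only along the
  hyperboloid. Unit speed geodesics stay inside it and have every unit tangent vector as initial
  velocity, so they pin down its values on the tangent space.\<close>

lemma derivative_hyp_act_unique:
  assumes M: "M \<in> Lorentz_group" and w: "w \<in> tangent_space p"
    and D: "((\<lambda>x. coords (hyp_act M (of_coords x))) has_derivative D) (at (coords p) within hyperboloid)"
  shows "D w = M *v w"
proof -
  let ?F = "\<lambda>x. coords (hyp_act M (of_coords x))"
  interpret D: bounded_linear D using D by (rule has_derivative_bounded_linear)
  have unit: "D u = M *v u" if u: "u \<in> tangent_space p" "mink u u = 1" for u
  proof -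
    define \<gamma> where "\<gamma> t = cosh t *\<^sub>R coords p + sinh t *\<^sub>R u" for t
    have \<gamma>H: "\<gamma> t \<in> hyperboloid" for t
      unfolding \<gamma>_def using u by (rule geodesic_in_hyperboloid)
    have "((\<lambda>t. \<gamma> t) has_vector_derivative (sinh 0 *\<^sub>R coords p + cosh 0 *\<^sub>R u)) (at 0)"
      unfolding \<gamma>_def by (auto intro!: derivative_eq_intros simp: has_vector_derivative_def)
    then have \<gamma>: "(\<gamma> has_vector_derivative u) (at 0)" by simp
    then have g: "(\<gamma> has_derivative (\<lambda>t. t *\<^sub>R u)) (at 0)"
      by (simp add: has_vector_derivative_def)
    have "(?F has_derivative D) (at (\<gamma> 0) within \<gamma> ` UNIV)"
    proof (rule has_derivative_subset)
      show "(?F has_derivative D) (at (\<gamma> 0) within hyperboloid)"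
        using D by (simp add: \<gamma>_def)
    qed (use \<gamma>H in auto)
    then have "((\<lambda>t. ?F (\<gamma> t)) has_derivative (\<lambda>t. D (t *\<^sub>R u))) (at 0)"
      by (rule has_derivative_in_compose[OF g])
    then have 1: "((\<lambda>t. M *v \<gamma> t) has_vector_derivative D u) (at 0)"
      using M \<gamma>H by (simp add: has_vector_derivative_def coords_hyp_act of_coords_inverse D.scaleR)
    have 2: "((\<lambda>t. M *v \<gamma> t) has_vector_derivative (M *v u)) (at 0)"
      using bounded_linear.has_vector_derivative[OF matrix_vector_mul_bounded_linear \<gamma>] .
    show ?thesis using vector_derivative_unique_at[OF 1 2] .
  qed
  show ?thesis
  proof (cases "w = 0")
    case True
    then show ?thesis by (simp add: D.zero)
  next
    case False
    have pw: "mink (coords p) w = 0" using w by (simp add: tangent_space_def)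
    then have pos: "mink w w > 0"
      using mink_orthogonal_nonneg[OF pw] False by force
    define u where "u = (1 / sqrt (mink w w)) *\<^sub>R w"
    have "D u = M *v u"
      by (rule unit) (use pos pw in \<open>simp_all add: u_def tangent_space_def mink_simps\<close>)
    then show ?thesis
      using pos by (simp add: u_def D.scaleR matrix_vector_mult_scaleR)
  qed
qed

lemma det_vector_mult:
  fixes M :: "real^4^4"
  shows "det (vector [M *v a, M *v b, M *v c, M *v d] :: real^4^4) = det M * det (vector [a, b, c, d] :: real^4^4)"
proof -
  have "(vector [M *v a, M *v b, M *v c, M *v d] :: real^4^4) = vector [a, b, c, d] ** transpose M"
    by (simp add: vec_eq_iff forall_4 matrix_matrix_mult_def matrix_vector_mult_def transpose_def mult.commute)
  then show ?thesis by (simp add: det_mul)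
qed

text \<open>The sign of \<open>det P\<close> is never computed: it is nonzero because P is
  orthogonal, and replacing the first space axis by its negative reverses it.\<close>

lemma ex_positive_frame:
  assumes "p = of_coords (axis 4 1)"
  shows "\<exists>w1\<in>tangent_space p. \<exists>w2\<in>tangent_space p. \<exists>w3\<in>tangent_space p.
     det (vector [coords p, w1, w2, w3] :: real^4^4) > 0"
proof -
  define P where "P = (vector [axis 4 1, axis 1 1, axis 2 1, axis 3 1] :: real^4^4)"
  define R where "R = ((\<chi> i j. if i = j then (if i = 1 then -1 else 1) else 0) :: real^4^4)"
  have "det R = (\<Prod>i\<in>UNIV. R$i$i)"
    by (rule det_diagonal) (simp add: R_def)
  also have "\<dots> = (\<Prod>i\<in>(UNIV :: 4 set). if i = 1 then -1 else 1 :: real)" by (rule prod.cong) (simp_all add: R_def)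
  also have "\<dots> = -1" by (simp add: prod.delta)
  finally have R: "det R = -1" .
  have Rax: "R *v axis i 1 = (if i = 1 then - axis i 1 else axis i 1)" for i
    unfolding vec_eq_iff matrix_axis_nth unfolding R_def axis_def by auto
  have neg: "det (vector [axis 4 1, - axis 1 1, axis 2 1, axis 3 1] :: real^4^4) = - det P"
    using det_vector_mult[of R "axis 4 1" "axis 1 1" "axis 2 1" "axis 3 1"]
    by (simp add: Rax R P_def)
  have "P ** transpose P = mat 1"
    by (simp add: P_def vec_eq_iff forall_4 matrix_matrix_mult_def transpose_def sum_4 axis_def mat_def)
  then have "det (P ** transpose P) = 1" by simp
  then have "det P * det P = 1" by (simp only: det_mul det_transpose)
  then have "det P \<noteq> 0" by auto
  have cp: "coords p = axis 4 1"
    by (simp add: assms of_coords_inverse axis_4_hyperboloid)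
  have T: "axis 1 1 \<in> tangent_space p" "- axis 1 1 \<in> tangent_space p"
     "axis 2 1 \<in> tangent_space p" "axis 3 1 \<in> tangent_space p"
    by (simp_all add: tangent_space_def cp) (simp_all add: mink_def axis_def)
  show ?thesis
  proof (cases "det P > 0")
    case True
    then show ?thesis unfolding cp
      by (intro bexI[OF _ T(1)] bexI[OF _ T(3)] bexI[OF _ T(4)]) (simp add: P_def)
  next
    case False
    with \<open>det P \<noteq> 0\<close> have "- det P > 0" by simp
    then show ?thesis unfolding cp
      by (intro bexI[OF _ T(2)] bexI[OF _ T(3)] bexI[OF _ T(4)]) (simp add: neg)
  qed
qed

lemma orientation_preserving_hyp_act:
  assumes M: "M \<in> Lorentz_group"
  shows "orientation_preserving (hyp_act M) \<longleftrightarrow> det M > 0"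
proof
  assume o: "orientation_preserving (hyp_act M)"
  define p where "p = of_coords (axis 4 1)"
  obtain D where D: "((\<lambda>x. coords (hyp_act M (of_coords x))) has_derivative D) (at (coords p) within hyperboloid)"
    and pos: "\<And>w1 w2 w3. w1\<in>tangent_space p \<Longrightarrow> w2\<in>tangent_space p \<Longrightarrow> w3\<in>tangent_space p \<Longrightarrow>
        det (vector [coords p, w1, w2, w3] :: real^4^4) > 0 \<Longrightarrow>
        det (vector [coords (hyp_act M p), D w1, D w2, D w3] :: real^4^4) > 0"
    using o unfolding orientation_preserving_def by meson
  obtain w1 w2 w3 where w: "w1\<in>tangent_space p" "w2\<in>tangent_space p" "w3\<in>tangent_space p"
     "det (vector [coords p, w1, w2, w3] :: real^4^4) > 0"
    using ex_positive_frame[OF p_def] by blast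
  have "det (vector [M *v coords p, M *v w1, M *v w2, M *v w3] :: real^4^4) > 0"
    using pos[OF w] derivative_hyp_act_unique[OF M _ D] w by (simp add: coords_hyp_act[OF M])
  with w(4) show "det M > 0" by (simp add: det_vector_mult zero_less_mult_iff)
next
  assume d: "det M > 0"
  show "orientation_preserving (hyp_act M)"
    unfolding orientation_preserving_def
  proof (intro allI exI[of _ "\<lambda>x. M *v x"] conjI ballI impI)
    fix p
    have "((\<lambda>x. M *v x) has_derivative (\<lambda>x. M *v x)) (at (coords p) within hyperboloid)"
      by (intro bounded_linear_imp_has_derivative matrix_vector_mul_bounded_linear)
    then show "((\<lambda>x. coords (hyp_act M (of_coords x))) has_derivative (\<lambda>x. M *v x)) (at (coords p) within hyperboloid)"
      by (rule has_derivative_transform[rotated 2])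
         (auto simp: coords coords_hyp_act[OF M] of_coords_inverse)
    fix w1 w2 w3
    assume "det (vector [coords p, w1, w2, w3] :: real^4^4) > 0"
    with d show "det (vector [coords (hyp_act M p), M *v w1, M *v w2, M *v w3] :: real^4^4) > 0"
      by (simp add: coords_hyp_act[OF M] det_vector_mult)
  qed
qed

section \<open>The group of orientation preserving isometries and its topology\<close>

definition SLorentz_group :: "(real^4^4) set" where
  "SLorentz_group = {M \<in> Lorentz_group. det M = 1}"

lemma SLorentz_group_Lorentz: "M \<in> SLorentz_group \<Longrightarrow> M \<in> Lorentz_group"
  by (simp add: SLorentz_group_def)

lemma SLorentz_group_mult: "A \<in> SLorentz_group \<Longrightarrow> B \<in> SLorentz_group \<Longrightarrow> A ** B \<in> SLorentz_group"
  unfolding SLorentz_group_def by (simp add: Lorentz_group_mult det_mul)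

lemma SLorentz_group_id: "mat 1 \<in> SLorentz_group"
  by (simp add: SLorentz_group_def Lorentz_group_id)

lemma SLorentz_group_adj: 
  assumes "A \<in> SLorentz_group" shows "mink_adj A \<in> SLorentz_group"
proof -
  have "lorentz A" "det A = 1" "A \<in> Lorentz_group" 
    using assms by (auto simp: SLorentz_group_def Lorentz_group_def)
  then have "det (mink_adj A) = 1"
    by (metis det_I det_mul lorentz_iff_adj_mult mult.right_neutral)
  with \<open>A \<in> Lorentz_group\<close> show ?thesis by (simp add: SLorentz_group_def Lorentz_group_adj)
qed

lemma carrier_Isom_plus: "carrier Isom_plus = hyp_act ` SLorentz_group"
proof
  show "carrier Isom_plus \<subseteq> hyp_act ` SLorentz_group"
  proof
    fix f assume f: "f \<in> carrier Isom_plus"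
    then obtain M where M: "M \<in> Lorentz_group" "f = hyp_act M"
      using isometry_is_hyp_act[of f] by (auto simp: Isom_plus_def)
    with f have "det M > 0"
      by (simp add: Isom_plus_def orientation_preserving_hyp_act)
    then have "det M = 1"
      using det_lorentz[of M] M(1) by (auto simp: Lorentz_group_def)
    with M show "f \<in> hyp_act ` SLorentz_group" by (auto simp: SLorentz_group_def)
  qed
  show "hyp_act ` SLorentz_group \<subseteq> carrier Isom_plus"
    by (auto simp: Isom_plus_def SLorentz_group_def orientation_preserving_hyp_act dist_hyp_act bij_hyp_act)
qed

lemma mult_Isom_plus: "f \<otimes>\<^bsub>Isom_plus\<^esub> g = f \<circ> g"
  and one_Isom_plus: "\<one>\<^bsub>Isom_plus\<^esub> = id"
  by (simp_all add: Isom_plus_def)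

lemma group_Isom_plus: "group Isom_plus"
proof (rule groupI)
  fix f assume "f \<in> carrier Isom_plus"
  then obtain A where A: "A \<in> SLorentz_group" "f = hyp_act A" by (auto simp: carrier_Isom_plus)
  then show "\<exists>g\<in>carrier Isom_plus. g \<otimes>\<^bsub>Isom_plus\<^esub> f = \<one>\<^bsub>Isom_plus\<^esub>"
    using hyp_act_adj(1)[of A] SLorentz_group_adj[of A]
    by (auto simp: carrier_Isom_plus mult_Isom_plus one_Isom_plus SLorentz_group_def)
next
  show "\<one>\<^bsub>Isom_plus\<^esub> \<in> carrier Isom_plus"
    using SLorentz_group_id hyp_act_id
    by (simp add: carrier_Isom_plus one_Isom_plus) (metis image_eqI)
next
  fix f g assume "f \<in> carrier Isom_plus" "g \<in> carrier Isom_plus"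
  then obtain A B where A: "A \<in> SLorentz_group" "f = hyp_act A" and B: "B \<in> SLorentz_group" "g = hyp_act B"
    by (auto simp: carrier_Isom_plus)
  then have "f \<otimes>\<^bsub>Isom_plus\<^esub> g = hyp_act (A ** B)"
    by (simp add: mult_Isom_plus hyp_act_mult SLorentz_group_def)
  with A B show "f \<otimes>\<^bsub>Isom_plus\<^esub> g \<in> carrier Isom_plus"
    by (simp add: carrier_Isom_plus SLorentz_group_mult)
qed (auto simp: mult_Isom_plus one_Isom_plus)

lemma inv_Isom_plus:
  assumes "A \<in> SLorentz_group"
  shows "inv\<^bsub>Isom_plus\<^esub> (hyp_act A) = hyp_act (mink_adj A)"
  using assms hyp_act_adj(1)[of A] SLorentz_group_adj[of A]
  by (intro group.inv_equality[OF group_Isom_plus])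
     (auto simp: carrier_Isom_plus mult_Isom_plus one_Isom_plus SLorentz_group_def)

lemma inv_Isom_plus_fun:
  assumes "g \<in> carrier Isom_plus"
  shows "inv\<^bsub>Isom_plus\<^esub> g \<circ> g = id" "g \<circ> inv\<^bsub>Isom_plus\<^esub> g = id"
  using group.l_inv[OF group_Isom_plus assms] group.r_inv[OF group_Isom_plus assms]
  by (simp_all add: mult_Isom_plus one_Isom_plus)

lemma topspace_Isom_plus_topology: "topspace Isom_plus_topology = carrier Isom_plus"
proof -
  have "f \<in> topspace compact_open_topology" for f :: "hyp3 \<Rightarrow> hyp3"
    unfolding compact_open_topology_def topology_generated_by_topspace
  proof (rule UnionI)
    show "{f :: hyp3 \<Rightarrow> hyp3. f ` {} \<subseteq> UNIV} \<in> {{f. f ` K \<subseteq> U} |K U. compact K \<and> open U}"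
      by (intro CollectI exI[of _ "{}"] exI[of _ UNIV]) simp
  qed simp
  then show ?thesis by (auto simp: Isom_plus_topology_def topspace_subtopology)
qed

lemma dist_hyp_act_near:
  assumes A: "A \<in> Lorentz_group" and B: "B \<in> Lorentz_group" and e: "e > 0"
    and small: "norm (A - B) * R < e" and R: "norm (coords p) \<le> R"
  shows "dist (hyp_act A p) (hyp_act B p) < e"
proof -
  let ?x = "coords (hyp_act A p) - coords (hyp_act B p)" and ?d = "dist (hyp_act A p) (hyp_act B p)"
  have "?x = (A - B) *v coords p"
    by (simp add: coords_hyp_act A B matrix_vector_mult_diff_rdistrib)
  then have "norm ?x \<le> norm (A - B) * R"
    by (simp only:) (rule order_trans[OF norm_matrix_vector_le mult_left_mono[OF R norm_ge_zero]])
  then have n: "norm ?x < e" using small by simp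
  have "2 * (cosh ?d - 1) \<le> (norm ?x)\<^sup>2"
    unfolding mink_diff_self_coords[symmetric] by (rule mink_self_le_norm)
  also have "\<dots> < e\<^sup>2" using n by (simp add: power_strict_mono)
  \<comment> \<open>By the half-angle formula the right side is four times the square of
    \<open>sinh (e/2)\<close>, and \<open>sinh\<close> dominates the identity.\<close>
  also have "e\<^sup>2 \<le> 2 * (cosh e - 1)"
  proof -
    have "cosh e = 1 + 2 * (sinh (e/2))\<^sup>2"
      using cosh_double[of "e/2"] cosh_square_eq[of "e/2"] by simp
    moreover have "(e/2)\<^sup>2 \<le> (sinh (e/2))\<^sup>2"
      using e real_le_x_sinh[of "e/2"] by (intro power_mono) (simp_all add: sinh_field_def exp_minus)
    ultimately show ?thesis by (simp add: power_divide)
  qed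
  finally have "cosh ?d < cosh e" by simp
  then show ?thesis using e by (subst (asm) cosh_real_nonneg_less_iff) auto
qed

text \<open>Induction on how the open set is built from subbasic sets. For a subbasic set, the
  compact image of K has an e-neighbourhood inside W, and matrices close to M move points of bounded
  norm by less than e. This carries approximation of matrices over to isometries, for density and
  for the failure of discreteness.\<close>

lemma openin_Isom_plus_topology_near:
  assumes U: "openin Isom_plus_topology U" and M: "M \<in> SLorentz_group" and MU: "hyp_act M \<in> U"
  shows "\<exists>\<delta>>0. \<forall>A\<in>SLorentz_group. norm (A - M) < \<delta> \<longrightarrow> hyp_act A \<in> U"
proof -
  obtain V where V: "openin compact_open_topology V" and UV: "U = V \<inter> carrier Isom_plus"
    using U by (auto simp: Isom_plus_topology_def openin_subtopology)
  have "generate_topology_on {{f. f ` K \<subseteq> W} |K W. compact K \<and> open W} V"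
    using V by (simp add: compact_open_topology_def openin_topology_generated_by_iff)
  then have "hyp_act M \<in> V \<Longrightarrow> \<exists>\<delta>>0. \<forall>A\<in>SLorentz_group. norm (A - M) < \<delta> \<longrightarrow> hyp_act A \<in> V"
  proof induction
    case Empty
    then show ?case by simp
  next
    case (Int a b)
    then obtain d1 d2 where "d1 > 0" "d2 > 0"
      "\<forall>A\<in>SLorentz_group. norm (A - M) < d1 \<longrightarrow> hyp_act A \<in> a"
      "\<forall>A\<in>SLorentz_group. norm (A - M) < d2 \<longrightarrow> hyp_act A \<in> b" by auto
    then show ?case by (intro exI[of _ "min d1 d2"]) auto
  next
    case (UN K)
    then obtain k where "k \<in> K" "hyp_act M \<in> k" by blast
    with UN show ?case by (metis UnionI)
  next
    case (Basis s)
    then obtain K W where s: "s = {f. f ` K \<subseteq> W}" and K: "compact K" and W: "open W" by blast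
    have LM: "M \<in> Lorentz_group" using M by (simp add: SLorentz_group_def)
    have "continuous_on K (hyp_act M)"
      unfolding continuous_on_iff dist_hyp_act[OF LM] by blast
    then have "compact (hyp_act M ` K)" using K by (rule compact_continuous_image)
    moreover have "hyp_act M ` K \<subseteq> W" using Basis s by auto
    ultimately obtain e where e: "e > 0" "(\<Union>x\<in>hyp_act M ` K. ball x e) \<subseteq> W"
      using compact_subset_open_imp_ball_epsilon_subset[OF _ W] by blast
    have "bounded (coords ` K)"
      using K by (intro compact_imp_bounded compact_continuous_image continuous_on_coords)
    then obtain R where R: "R > 0" "\<And>p. p \<in> K \<Longrightarrow> norm (coords p) \<le> R"
      by (auto simp: bounded_pos)
    have "hyp_act A \<in> s" if A: "A \<in> SLorentz_group" "norm (A - M) < e / R" for A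
      unfolding s
    proof (clarify)
      fix p assume p: "p \<in> K"
      have "dist (hyp_act M p) (hyp_act A p) < e"
      proof (rule dist_hyp_act_near[OF LM _ e(1)])
        show "A \<in> Lorentz_group" using A by (simp add: SLorentz_group_def)
        show "norm (M - A) * R < e"
          using A(2) R(1) by (simp add: field_simps norm_minus_commute)
        show "norm (coords p) \<le> R" using p by (rule R(2))
      qed
      then have "hyp_act A p \<in> (\<Union>x\<in>hyp_act M ` K. ball x e)" using p by auto
      then show "hyp_act A p \<in> W" using e(2) by (rule rev_subsetD)
    qed
    then show ?case using e(1) R(1) by (intro exI[of _ "e / R"]) auto
  qed
  then show ?thesis using MU M by (auto simp: UV carrier_Isom_plus)
qed

section \<open>Groups generated by linear reflections\<close>

text \<open>Chebyshev polynomials of the second kind with shifted index: the value at k is the usual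
  U_(k-1), so that c = cos \<theta> gives sin (k \<theta>) / sin \<theta>.\<close>

fun chebyshev_U :: "real \<Rightarrow> nat \<Rightarrow> real" where
  "chebyshev_U c 0 = 0"
| "chebyshev_U c (Suc 0) = 1"
| "chebyshev_U c (Suc (Suc k)) = 2 * c * chebyshev_U c (Suc k) - chebyshev_U c k"

lemma chebyshev_U_cos:
  assumes "sin \<theta> \<noteq> 0"
  shows "chebyshev_U (cos \<theta>) k = sin (real k * \<theta>) / sin \<theta>"
proof (induction k rule: induct_nat_012)
  case 0
  then show ?case by simp
next
  case 1
  then show ?case using assms by simp
next
  case (ge2 n)
  have "sin (real (Suc (Suc n)) * \<theta>) = sin (real (Suc n) * \<theta> + \<theta>)" by (simp add: algebra_simps)
  moreover have "sin (real n * \<theta>) = sin (real (Suc n) * \<theta> - \<theta>)" by (simp add: algebra_simps)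
  ultimately have "sin (real (Suc (Suc n)) * \<theta>) = 2 * cos \<theta> * sin (real (Suc n) * \<theta>) - sin (real n * \<theta>)"
    unfolding sin_add sin_diff by simp
  then show ?case using ge2 by (simp add: diff_divide_distrib)
qed

text \<open>For \<open>c \<ge> 1\<close> the recursion makes each increment at least as large as the
  one before. This replaces the sine formula when the two mirrors do not meet.\<close>

lemma chebyshev_U_mono:
  assumes "c \<ge> 1"
  shows "0 \<le> chebyshev_U c k" "chebyshev_U c k \<le> chebyshev_U c (Suc k)"
proof -
  have "0 \<le> chebyshev_U c k \<and> chebyshev_U c k \<le> chebyshev_U c (Suc k)"
  proof (induction k)
    case 0
    then show ?case by simp
  next
    case (Suc k)
    then have "chebyshev_U c (Suc k) \<ge> 0" by linarith
    then have "c * chebyshev_U c (Suc k) \<ge> 1 * chebyshev_U c (Suc k)"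
      using assms by (intro mult_right_mono) auto
    then have "2 * c * chebyshev_U c (Suc k) \<ge> 2 * chebyshev_U c (Suc k)" by simp
    with Suc show ?case by simp
  qed
  then show "0 \<le> chebyshev_U c k" "chebyshev_U c k \<le> chebyshev_U c (Suc k)" by auto
qed

text \<open>The right end is prescribed to be i: letters at the right act first, and they are the
  ones that Tits' argument splits off.\<close>

fun alternating :: "nat \<Rightarrow> 'i \<Rightarrow> 'i \<Rightarrow> 'i list" where
  "alternating 0 i j = []"
| "alternating (Suc k) i j = alternating k j i @ [i]"

lemma length_alternating [simp]: "length (alternating k i j) = k"
  by (induction k arbitrary: i j) auto

lemma set_alternating: "set (alternating k i j) \<subseteq> {i, j}"
  by (induction k arbitrary: i j) auto

lemma alternating_Suc_Cons: "alternating (Suc k) i j = (if even k then i else j) # alternating k i j"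
  by (induction k arbitrary: i j) auto

lemma rev_alternating: "rev (alternating k i j) = (if even k then alternating k j i else alternating k i j)"
proof (induction k arbitrary: i j)
  case (Suc k)
  have "rev (alternating (Suc k) i j) = i # rev (alternating k j i)" by simp
  then show ?case using Suc[of j i] alternating_Suc_Cons[of k i j] alternating_Suc_Cons[of k j i]
    by (auto simp del: alternating.simps)
qed simp

lemma alternating_add:
  "alternating (k + l) i j = (if even l then alternating k i j else alternating k j i) @ alternating l i j"
proof (induction l arbitrary: i j)
  case (Suc l)
  then show ?case by (auto simp: Suc)
qed simp

locale reflection_system =
  fixes B :: "'v::real_vector \<Rightarrow> 'v \<Rightarrow> real" and e :: "'i \<Rightarrow> 'v"
  assumes B_sym: "B x y = B y x"
    and B_add: "B (x + y) z = B x z + B y z"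
    and B_scaleR: "B (a *\<^sub>R x) z = a * B x z"
    and B_root: "B (e i) (e i) = 1"
begin

lemma B_add_right: "B z (x + y) = B z x + B z y"
  and B_scaleR_right: "B z (a *\<^sub>R x) = a * B z x"
  using B_add B_scaleR B_sym by metis+

lemma B_minus: "B (- x) z = - B x z" and B_minus_right: "B z (- x) = - B z x"
  using B_scaleR[of "-1"] B_scaleR_right[of _ "-1"] by simp_all

lemma B_diff: "B (x - y) z = B x z - B y z" and B_diff_right: "B z (x - y) = B z x - B z y"
  using B_add[of x "- y" z] B_add_right[of z x "- y"] by (simp_all add: B_minus B_minus_right)

lemmas B_simps = B_add B_add_right B_scaleR B_scaleR_right B_minus B_minus_right B_diff B_diff_right B_root

definition reflect :: "'i \<Rightarrow> 'v \<Rightarrow> 'v" where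
  "reflect i x = x - (2 * B x (e i)) *\<^sub>R e i"

lemma linear_reflect: "linear (reflect i)"
  by (rule linearI) (simp_all add: reflect_def B_simps algebra_simps)

lemma reflect_reflect [simp]: "reflect i (reflect i x) = x"
  by (simp add: reflect_def B_simps algebra_simps)

lemma B_reflect: "B (reflect i x) (reflect i y) = B x y"
  by (simp add: reflect_def B_simps B_sym[of "e i"] algebra_simps)

lemma reflect_root: "reflect i (e i) = - e i"
  by (simp add: reflect_def B_simps scaleR_2)

primrec word :: "'i list \<Rightarrow> 'v \<Rightarrow> 'v" where
  "word [] x = x"
| "word (i # w) x = reflect i (word w x)"

lemma word_append [simp]: "word (u @ w) x = word u (word w x)"
  by (induction u) auto

lemma linear_word: "linear (word w)"
proof (induction w)
  case Nil
  have "word [] = (\<lambda>x. x)" by auto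
  then show ?case by (simp add: linear_ident)
next
  case (Cons i w)
  have "word (i # w) = reflect i \<circ> word w" by auto
  then show ?case by (simp only: linear_compose[OF Cons linear_reflect])
qed

lemma word_rev_word [simp]: "word (rev w) (word w x) = x"
  by (induction w arbitrary: x) auto

lemma word_word_rev [simp]: "word w (word (rev w) x) = x"
  using word_rev_word[of "rev w"] by simp

lemma B_word: "B (word w x) (word w y) = B x y"
  by (induction w) (auto simp: B_reflect)

lemma B_word_left: "B (word w x) y = B x (word (rev w) y)"
  using B_word[of w x "word (rev w) y"] by simp

text \<open>Length is measured in the group of linear maps: two words count as equal when they act
  alike. Faithfulness of the representation is thereby built in.\<close>

definition reduced :: "'i list \<Rightarrow> bool" where
  "reduced w \<longleftrightarrow> (\<forall>u. word u = word w \<longrightarrow> length w \<le> length u)"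

lemma ex_reduced: "\<exists>u. reduced u \<and> word u = word w"
proof -
  obtain u where "word u = word w" "\<And>v. word v = word w \<Longrightarrow> length u \<le> length v"
    using ex_has_least_nat[of "\<lambda>u. word u = word w" w length] by auto
  then show ?thesis unfolding reduced_def by metis
qed

lemma word_eq_append: "word u = word u' \<Longrightarrow> word w = word w' \<Longrightarrow> word (u @ w) = word (u' @ w')"
  by (auto simp: fun_eq_iff)

lemma reduced_append:
  assumes "reduced (u @ w)"
  shows "reduced u" "reduced w"
proof -
  show "reduced u"
    unfolding reduced_def
  proof (intro allI impI)
    fix v assume "word v = word u"
    then have "word (v @ w) = word (u @ w)" by (intro word_eq_append) auto
    then show "length u \<le> length v" using assms unfolding reduced_def by (metis add_le_cancel_right length_append)
  qed
  show "reduced w"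
    unfolding reduced_def
  proof (intro allI impI)
    fix v assume "word v = word w"
    then have "word (u @ v) = word (u @ w)" by (intro word_eq_append) auto
    then show "length w \<le> length v" using assms unfolding reduced_def by (metis add_le_cancel_left length_append)
  qed
qed

lemma not_reduced_double: "\<not> reduced (u @ [i, i])"
proof
  assume "reduced (u @ [i, i])"
  moreover have "word u = word (u @ [i, i])" by auto
  ultimately have "length (u @ [i, i]) \<le> length u" unfolding reduced_def by metis
  then show False by simp
qed

lemma reduced_dihedral:
  assumes "reduced b" "set b \<subseteq> {i, j}" "b = [] \<or> last b = i"
  shows "b = alternating (length b) i j"
  using assms
proof (induction b arbitrary: i j rule: rev_induct)
  case (snoc x b)
  then have x: "x = i" by simp
  have "b = [] \<or> last b = j"
  proof (rule disjCI)
    assume "last b \<noteq> j"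
    show "b = []"
    proof (rule ccontr)
      assume "b \<noteq> []"
      then have "last b \<in> {i, j}" using snoc.prems(2) last_in_set by fastforce
      with \<open>last b \<noteq> j\<close> have "last b = i" by simp
      then have "b @ [x] = butlast b @ [i, i]" using \<open>b \<noteq> []\<close> x append_butlast_last_id[of b] by simp
      then show False using snoc.prems(1) not_reduced_double by metis
    qed
  qed
  moreover have "reduced b" using snoc.prems(1) reduced_append by blast
  ultimately have "b = alternating (length b) j i"
    using snoc by auto
  then show ?case using x by simp
qed simp

text \<open>The rightmost letter j sends \<open>e i\<close> to
  \<open>e i + (2 * c) *\<^sub>R e j\<close>, and the next letter i negates \<open>e i\<close>. The
  two summands are the two earlier words of the Chebyshev recursion.\<close>

lemma word_alternating_root:
  assumes c: "B (e i) (e j) = - c"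
  shows "word (alternating k j i) (e i) =
    (if even k then chebyshev_U c (Suc k) *\<^sub>R e i + chebyshev_U c k *\<^sub>R e j
     else chebyshev_U c (Suc k) *\<^sub>R e j + chebyshev_U c k *\<^sub>R e i)"
  using c
proof (induction k arbitrary: i j rule: induct_nat_012)
  case 0
  then show ?case by simp
next
  case 1
  then show ?case by (simp add: reflect_def)
next
  case (ge2 k)
  have c': "B (e j) (e i) = - c" using ge2.prems B_sym by metis
  interpret w: linear "word (alternating (Suc k) i j)" by (rule linear_word)
  have "word (alternating (Suc (Suc k)) j i) (e i) = word (alternating (Suc k) i j) (reflect j (e i))"
    unfolding alternating.simps(2)[of "Suc k" j i] word_append by simp
  also have "reflect j (e i) = e i + (2 * c) *\<^sub>R e j"
    using ge2.prems by (simp add: reflect_def)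
  also have "word (alternating (Suc k) i j) (e i + (2 * c) *\<^sub>R e j) =
      word (alternating (Suc k) i j) (e i) + (2 * c) *\<^sub>R word (alternating (Suc k) i j) (e j)"
    by (simp only: w.add w.scaleR)
  also have "word (alternating (Suc k) i j) (e i) = - word (alternating k j i) (e i)"
    using linear_neg[OF linear_word] by (simp add: reflect_root)
  finally show ?case
    unfolding ge2.IH(1)[OF ge2.prems] ge2.IH(2)[OF c'] by (auto simp: algebra_simps)
qed

lemma word_fixes_orthogonal:
  assumes "\<And>i. i \<in> set w \<Longrightarrow> B x (e i) = 0"
  shows "word w x = x"
  using assms by (induction w) (auto simp: reflect_def)

text \<open>The product of the two reflections rotates the plane of \<open>e i\<close> and
  \<open>e j\<close> by 2\<pi>/m, so its m-th power is trivial there, and vectors orthogonal to both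
  roots are fixed. Cutting the trivial word of length \<open>2 * m\<close> in the middle gives the
  relation.\<close>

lemma braid_relation:
  assumes m: "m \<ge> 2" and c: "B (e i) (e j) = - cos (pi / real m)"
  shows "word (alternating m i j) = word (alternating m j i)"
proof -
  define \<theta> where "\<theta> = pi / real m"
  have s: "sin \<theta> > 0"
    using m by (intro sin_gt_zero) (auto simp: \<theta>_def field_simps)
  have mth: "real m * \<theta> = pi" using m by (simp add: \<theta>_def)
  have m2: "real (2 * m) * \<theta> = 2 * pi" using mth by simp
  have U: "chebyshev_U (cos \<theta>) k = sin (real k * \<theta>) / sin \<theta>" for k
    using s by (intro chebyshev_U_cos) simp
  have U0: "chebyshev_U (cos \<theta>) (2 * m) = 0"
    unfolding U m2 by simp
  have U1: "chebyshev_U (cos \<theta>) (Suc (2 * m)) = 1"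
  proof -
    have "real (Suc (2 * m)) * \<theta> = 2 * pi + \<theta>" using m2 by (simp add: algebra_simps)
    then show ?thesis unfolding U using s by (simp add: sin_add)
  qed
  have U2: "chebyshev_U (cos \<theta>) (2 * m - 1) = - 1"
  proof -
    have "real (2 * m - 1) * \<theta> = 2 * pi - \<theta>" using m m2 by (simp add: algebra_simps of_nat_diff)
    then show ?thesis unfolding U using s by (simp add: sin_diff)
  qed
  have c1: "B (e i) (e j) = - cos \<theta>" and c2: "B (e j) (e i) = - cos \<theta>"
    using c B_sym by (auto simp: \<theta>_def)
  have ei: "word (alternating (2 * m) j i) (e i) = e i"
    unfolding word_alternating_root[OF c1] by (simp add: U0 U1 del: chebyshev_U.simps)
  have "2 * m = Suc (2 * m - 1)" "odd (2 * m - 1)" using m by simp_all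
  then have "word (alternating (2 * m) j i) (e j) = - word (alternating (2 * m - 1) i j) (e j)"
    using linear_neg[OF linear_word] by (metis alternating.simps(2) reflect_root word.simps word_append)
  also have "\<dots> = e j"
    unfolding word_alternating_root[OF c2] using \<open>2 * m = Suc (2 * m - 1)\<close> \<open>odd (2 * m - 1)\<close>
    by (simp only: if_False U2) (metis U0 U2 add.right_neutral minus_minus scaleR_minus_left scaleR_one scaleR_zero_left add_0)
  finally have ej: "word (alternating (2 * m) j i) (e j) = e j" .
  have id: "word (alternating (2 * m) j i) x = x" for x
  proof -
    define a where "a = B x (e i)"
    define b where "b = B x (e j)"
    \<comment> \<open>Solution of the Gram system of the two roots, whose determinant is 1 - cos^2
      \<theta> = sin^2 \<theta>; it makes p orthogonal to both.\<close>
    define \<alpha> where "\<alpha> = (a + cos \<theta> * b) / (sin \<theta>)\<^sup>2"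
    define \<beta> where "\<beta> = (b + cos \<theta> * a) / (sin \<theta>)\<^sup>2"
    define p where "p = x - \<alpha> *\<^sub>R e i - \<beta> *\<^sub>R e j"
    have sc: "(sin \<theta>)\<^sup>2 = 1 - (cos \<theta>)\<^sup>2" by (simp add: sin_squared_eq)
    have s2: "(sin \<theta>)\<^sup>2 \<noteq> 0" using s by simp
    have \<alpha>: "\<alpha> * (sin \<theta>)\<^sup>2 = a + cos \<theta> * b" and \<beta>: "\<beta> * (sin \<theta>)\<^sup>2 = b + cos \<theta> * a"
      using s by (simp_all add: \<alpha>_def \<beta>_def)
    have "(a - \<alpha> + \<beta> * cos \<theta>) * (sin \<theta>)\<^sup>2 = a * (sin \<theta>)\<^sup>2 - \<alpha> * (sin \<theta>)\<^sup>2 + cos \<theta> * (\<beta> * (sin \<theta>)\<^sup>2)"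
      by (simp only: algebra_simps)
    also have "\<dots> = 0" unfolding \<alpha> \<beta> unfolding sc by (simp add: algebra_simps power2_eq_square)
    finally have "a - \<alpha> + \<beta> * cos \<theta> = 0" using s2 by simp
    then have pi0: "B p (e i) = 0"
      by (simp add: p_def B_simps c2 a_def[symmetric])
    have "(b + \<alpha> * cos \<theta> - \<beta>) * (sin \<theta>)\<^sup>2 = b * (sin \<theta>)\<^sup>2 + cos \<theta> * (\<alpha> * (sin \<theta>)\<^sup>2) - \<beta> * (sin \<theta>)\<^sup>2"
      by (simp only: algebra_simps)
    also have "\<dots> = 0" unfolding \<alpha> \<beta> unfolding sc by (simp add: algebra_simps power2_eq_square)
    finally have "b + \<alpha> * cos \<theta> - \<beta> = 0" using s2 by simp
    then have pj0: "B p (e j) = 0"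
      by (simp add: p_def B_simps c1 b_def[symmetric])
    have p: "word (alternating (2 * m) j i) p = p"
      using set_alternating[of "2 * m" j i] pi0 pj0 by (intro word_fixes_orthogonal) blast
    interpret w: linear "word (alternating (2 * m) j i)" by (rule linear_word)
    have x: "x = p + \<alpha> *\<^sub>R e i + \<beta> *\<^sub>R e j" by (simp add: p_def)
    show ?thesis by (subst (1 2) x) (simp only: w.add w.scaleR p ei ej)
  qed
  define u where "u = (if even m then alternating m j i else alternating m i j)"
  have "alternating (2 * m) j i = u @ alternating m j i"
    using alternating_add[of m m j i] by (simp add: u_def mult_2)
  then have "word u (word (alternating m j i) x) = x" for x using id[of x] by simp
  then have "word (alternating m j i) x = word (rev u) x" for x by (metis word_rev_word)
  moreover have "rev u = alternating m i j" by (simp add: u_def rev_alternating)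
  ultimately show ?thesis by auto
qed

definition cone :: "'v set" where
  "cone = {p. \<forall>i. B p (e i) \<ge> 0}"

end

text \<open>The first alternative covers mirrors that do not meet: the Chebyshev coefficients are
  then nonnegative at every length. For an angle \<pi>/m they are so up to index m, and the braid
  relation takes care of longer words.\<close>

locale coxeter_system = reflection_system +
  assumes dihedral: "i \<noteq> j \<Longrightarrow> B (e i) (e j) \<le> - 1 \<or> (\<exists>m\<ge>2. B (e i) (e j) = - cos (pi / real m))"
begin

text \<open>Tits' argument: split off the longest right factor of \<open>w\<close> in the dihedral group of \<open>i\<close> and the
  last letter of \<open>w\<close>.\<close>

lemma positive_root:
  assumes "reduced w" "\<And>u. word u = word (w @ [i]) \<Longrightarrow> length w \<le> length u" "p \<in> cone"
  shows "B p (word w (e i)) \<ge> 0"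
  using assms(1,2)
proof (induction "length w" arbitrary: w i rule: less_induct)
  case less
  show ?case
  proof (cases w rule: rev_cases)
    case Nil
    then show ?thesis using assms(3) by (simp add: cone_def)
  next
    case (snoc w0 j)
    have shorter: "length w \<le> length u" if "\<And>x. word u (reflect i x) = word w x" for u
    proof (rule less.prems(2))
      show "word u = word (w @ [i])"
        using that by (auto simp: fun_eq_iff simp flip: that)
    qed
    have "j \<noteq> i"
    proof
      assume "j = i"
      then have "length w \<le> length w0" using snoc by (intro shorter) simp
      then show False using snoc by simp
    qed
    \<comment> \<open>Factorisations of w, without loss of length, into a prefix a and a word b in
      the letters i and j. The shortest such a is a minimal representative of its coset of the
      dihedral group.\<close>
    define split where "split a b \<longleftrightarrow> word (a @ b) = word w \<and> length (a @ b) = length w \<and> set b \<subseteq> {i, j}" for a b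
    have "\<exists>b. split w0 b"
      using snoc by (intro exI[of _ "[j]"]) (simp add: split_def)
    then obtain a where "\<exists>b. split a b" and amin: "\<And>a'. \<exists>b. split a' b \<Longrightarrow> length a \<le> length a'"
      using ex_has_least_nat[of "\<lambda>a. \<exists>b. split a b" w0 length] by auto
    then obtain b where ab: "word (a @ b) = word w" "length (a @ b) = length w" "set b \<subseteq> {i, j}"
      by (auto simp: split_def)
    have "length a \<le> length w0" using amin \<open>\<exists>b. split w0 b\<close> by blast
    then have alen: "length a < length w" using snoc by simp
    have "reduced (a @ b)" using less.prems(1) ab unfolding reduced_def by simp
    then have ra: "reduced a" and rb: "reduced b" using reduced_append by blast+
    \<comment> \<open>If a followed by k had a word shorter than a, moving k to the front of b would
      give a split with a shorter prefix.\<close>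
    have IH: "B p (word a (e k)) \<ge> 0" if k: "k \<in> {i, j}" for k
    proof (rule less.hyps[OF alen ra])
      fix u assume u: "word u = word (a @ [k])"
      show "length a \<le> length u"
      proof (rule ccontr)
        assume lt: "\<not> length a \<le> length u"
        have "word (u @ k # b) = word w"
          using ab(1) by (auto simp: fun_eq_iff u)
        moreover from this have "length w \<le> length (u @ k # b)"
          using less.prems(1) unfolding reduced_def by blast
        ultimately have "split u (k # b)"
          using lt ab(2,3) k by (auto simp: split_def)
        then show False using amin lt by blast
      qed
    qed
    \<comment> \<open>If b could be rewritten, without growing, to end in i, then w followed by i
      would have a word shorter than w.\<close>
    have no_i: False if "\<And>x. word b x = word (b' @ [i]) x" "length b' < length b" for b'
    proof -
      have "word (a @ b') (reflect i x) = word w x" for x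
        using ab(1) that(1) by (simp add: fun_eq_iff)
      then have "length w \<le> length (a @ b')" by (rule shorter)
      then show False using that(2) ab(2) by simp
    qed
    have "b = [] \<or> last b = j"
    proof (rule disjCI)
      assume "last b \<noteq> j"
      show "b = []"
      proof (rule ccontr)
        assume "b \<noteq> []"
        then have "last b \<in> {i, j}" using ab(3) last_in_set by blast
        with \<open>last b \<noteq> j\<close> have "b = butlast b @ [i]" using \<open>b \<noteq> []\<close> append_butlast_last_id[of b] by auto
        then show False using no_i[of "butlast b"] \<open>b \<noteq> []\<close> by simp
      qed
    qed
    then have b: "b = alternating (length b) j i"
      using rb ab(3) by (intro reduced_dihedral) auto
    define c where "c = - B (e i) (e j)"
    have U: "chebyshev_U c (length b) \<ge> 0 \<and> chebyshev_U c (Suc (length b)) \<ge> 0"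
    proof (cases "c \<ge> 1")
      case True
      then show ?thesis using chebyshev_U_mono by blast
    next
      case False
      then obtain m where m: "m \<ge> 2" and Bm: "B (e i) (e j) = - cos (pi / real m)"
        using dihedral[of i j] \<open>j \<noteq> i\<close> by (auto simp: c_def)
      \<comment> \<open>At length m the braid relation would let b end in i. So the coefficient
        indices stay at most m, where the sines are nonnegative.\<close>
      have "length b < m"
      proof (rule ccontr)
        assume "\<not> length b < m"
        then obtain f where f: "b = f @ alternating m j i"
          using b alternating_add[of "length b - m" m j i] by auto
        obtain m' where m': "m = Suc m'" using m by (cases m) auto
        have "word b x = word ((f @ alternating m' j i) @ [i]) x" for x
          using braid_relation[OF m Bm] unfolding f m' by (simp add: fun_eq_iff)
        moreover have "length (f @ alternating m' j i) < length b" unfolding f m' by simp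
        ultimately show False using no_i by blast
      qed
      have s: "sin (pi / real m) > 0"
        using m by (intro sin_gt_zero) (auto simp: field_simps)
      have "sin (real k * (pi / real m)) \<ge> 0" if "k \<le> m" for k
        using that m by (intro sin_ge_zero) (auto simp: field_simps)
      then have "chebyshev_U c k \<ge> 0" if "k \<le> m" for k
        using that s chebyshev_U_cos[of "pi / real m" k] by (simp add: c_def Bm)
      then show ?thesis using \<open>length b < m\<close> by simp
    qed
    interpret wa: linear "word a" by (rule linear_word)
    have "word w (e i) = word a (word b (e i))" using ab(1) by (metis word_append)
    also have "word b (e i) = word (alternating (length b) j i) (e i)" using b by simp
    also have "\<dots> = (if even (length b) then chebyshev_U c (Suc (length b)) *\<^sub>R e i + chebyshev_U c (length b) *\<^sub>R e j
         else chebyshev_U c (Suc (length b)) *\<^sub>R e j + chebyshev_U c (length b) *\<^sub>R e i)"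
      by (rule word_alternating_root) (simp add: c_def)
    finally show ?thesis
      using U IH[of i] IH[of j] by (auto simp: wa.add wa.scaleR B_simps simp del: chebyshev_U.simps)
  qed
qed

lemma positive_root_butlast:
  assumes "reduced (w @ [i])" "p \<in> cone"
  shows "B p (word w (e i)) \<ge> 0"
proof (rule positive_root[OF _ _ assms(2)])
  show "reduced w" using assms(1) reduced_append by blast
  fix u assume "word u = word (w @ [i])"
  then have "length (w @ [i]) \<le> length u" using assms(1) by (simp add: reduced_def)
  then show "length w \<le> length u" by simp
qed

text \<open>The last letter i of a reduced word for the same map turns a positive root into its
  negative. The cone and its image under \<open>word w\<close> therefore lie on opposite sides of
  the hyperplane orthogonal to \<open>word w (e i)\<close>.\<close>

lemma ex_negative_root:
  assumes "word w \<noteq> id"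
  shows "\<exists>i. \<forall>p\<in>cone. B p (word w (e i)) \<le> 0"
proof -
  obtain u where u: "reduced u" "word u = word w" using ex_reduced by blast
  have "u \<noteq> []" using assms u(2) by (auto simp: fun_eq_iff)
  then obtain v i where v: "u = v @ [i]" by (cases u rule: rev_cases) auto
  have "word w (e i) = - word v (e i)"
    unfolding u(2)[symmetric] v using linear_neg[OF linear_word] by (simp add: reflect_root)
  then show ?thesis
    using positive_root_butlast[of v i] u v by (intro exI[of _ i]) (simp add: B_simps)
qed

text \<open>Appending i to a reduced word subtracts twice the product of \<open>B y (e i)\<close>
  and a positive root evaluated at x. On the hyperboloid -B is the \<open>cosh\<close> of the
  distance, so among the points of its orbit y is nearest to x.\<close>

lemma B_word_le:
  assumes "x \<in> cone" "y \<in> cone"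
  shows "B x (word w y) \<le> B x y"
proof -
  have "B x (word u y) \<le> B x y" if "reduced u" for u
    using that
  proof (induction u rule: rev_induct)
    case (snoc i u)
    interpret wu: linear "word u" by (rule linear_word)
    have "word (u @ [i]) y = word u y - (2 * B y (e i)) *\<^sub>R word u (e i)"
      by (simp add: reflect_def wu.diff wu.scaleR)
    moreover have "0 \<le> B y (e i) * B x (word u (e i))"
      using positive_root_butlast[OF snoc.prems assms(1)] assms(2) by (simp add: cone_def)
    ultimately have "B x (word (u @ [i]) y) \<le> B x (word u y)" by (simp add: B_simps)
    also have "\<dots> \<le> B x y" using snoc reduced_append by blast
    finally show ?case .
  qed simp
  then show ?thesis using ex_reduced[of w] by metis
qed

end

section \<open>The groups in standard coordinates\<close>

definition boost :: "real \<Rightarrow> real^4^4" where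
  "boost r = vector [vector [cosh r, 0, 0, sinh r], vector [0, 1, 0, 0], vector [0, 0, 1, 0], vector [sinh r, 0, 0, cosh r]]"

definition quarter12 :: "real^4^4" where
  "quarter12 = vector [vector [0, -1, 0, 0], vector [1, 0, 0, 0], vector [0, 0, 1, 0], vector [0, 0, 0, 1]]"

definition quarter23 :: "real^4^4" where
  "quarter23 = vector [vector [1, 0, 0, 0], vector [0, 0, -1, 0], vector [0, 1, 0, 0], vector [0, 0, 0, 1]]"

definition quarter31 :: "real^4^4" where
  "quarter31 = vector [vector [0, 0, 1, 0], vector [0, 1, 0, 0], vector [-1, 0, 0, 0], vector [0, 0, 0, 1]]"

lemma boost_vec: "boost r *v x = vector [cosh r * x$1 + sinh r * x$4, x$2, x$3, sinh r * x$1 + cosh r * x$4]"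
  and quarter12_vec: "quarter12 *v x = vector [- x$2, x$1, x$3, x$4]"
  and quarter23_vec: "quarter23 *v x = vector [x$1, - x$3, x$2, x$4]"
  and quarter31_vec: "quarter31 *v x = vector [x$3, x$2, - x$1, x$4]"
  by (simp_all add: boost_def quarter12_def quarter23_def quarter31_def vec_eq_iff forall_4
      matrix_vector_mult_def sum_4)

text \<open>The generators are Lorentz matrices, so closure under \<open>mink_adj\<close> is closure
  under inverses.\<close>

inductive_set std_group :: "real \<Rightarrow> (real^4^4) set" for r where
  std_group_id: "mat 1 \<in> std_group r"
| std_group_mult: "A \<in> std_group r \<Longrightarrow> B \<in> std_group r \<Longrightarrow> A ** B \<in> std_group r"
| std_group_adj: "A \<in> std_group r \<Longrightarrow> mink_adj A \<in> std_group r"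
| std_group_boost: "boost r \<in> std_group r"
| std_group_quarter12: "quarter12 \<in> std_group r"
| std_group_quarter23: "quarter23 \<in> std_group r"
| std_group_quarter31: "quarter31 \<in> std_group r"

text \<open>The columns are the frame vectors and then the point: the change of basis from the
  standard frame at \<open>axis 4 1\<close> to the given one.\<close>

definition frame_matrix :: "hyp3 \<Rightarrow> real^4 \<Rightarrow> real^4 \<Rightarrow> real^4 \<Rightarrow> real^4^4" where
  "frame_matrix p v1 v2 v3 = transpose (vector [v1, v2, v3, coords p])"

lemma frame_matrix_vec:
  "frame_matrix p v1 v2 v3 *v x = x$1 *\<^sub>R v1 + x$2 *\<^sub>R v2 + x$3 *\<^sub>R v3 + x$4 *\<^sub>R coords p"
  by (simp add: frame_matrix_def vec_eq_iff forall_4 matrix_vector_mult_def sum_4 transpose_def mult.commute)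

lemma adj_frame_matrix_vec:
  "mink_adj (frame_matrix p v1 v2 v3) *v x = vector [mink x v1, mink x v2, mink x v3, - mink x (coords p)]"
  by (simp add: frame_matrix_def vec_eq_iff forall_4 matrix_vector_mult_def sum_4 transpose_def mink_adj_def
      mink_sign_def mink_def algebra_simps)

lemma frame_map_eq_hyp_act:
  "frame_map p v1 v2 v3 q w1 w2 w3 = hyp_act (frame_matrix q w1 w2 w3 ** mink_adj (frame_matrix p v1 v2 v3))"
  by (simp add: fun_eq_iff frame_map_def hyp_act_def matrix_vector_mul_assoc[symmetric] adj_frame_matrix_vec
      frame_matrix_vec algebra_simps)

lemma frame_matrix_Lorentz:
  assumes "orthonormal_frame p v1 v2 v3"
  shows "frame_matrix p v1 v2 v3 \<in> Lorentz_group"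
proof (rule Lorentz_groupI)
  have "mink (coords p) v1 = 0" "mink (coords p) v2 = 0" "mink (coords p) v3 = 0"
    "mink v1 v1 = 1" "mink v2 v2 = 1" "mink v3 v3 = 1" "mink v1 v2 = 0" "mink v2 v3 = 0" "mink v3 v1 = 0"
    using assms by (auto simp: orthonormal_frame_def tangent_space_def)
  note * = this
  have **: "mink v1 (coords p) = 0" "mink v2 (coords p) = 0" "mink v3 (coords p) = 0"
    "mink v2 v1 = 0" "mink v3 v2 = 0" "mink v1 v3 = 0"
    using * by (simp_all add: mink_sym)
  show "lorentz (frame_matrix p v1 v2 v3)"
    unfolding lorentz_def frame_matrix_vec mink_simps
    by (simp add: * ** mink_coords_self) (simp add: mink_def algebra_simps)
  show "axis 4 1 \<in> hyperboloid" by (rule axis_4_hyperboloid)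
  have "frame_matrix p v1 v2 v3 *v axis 4 1 = coords p"
    by (simp add: frame_matrix_vec axis_def)
  then show "frame_matrix p v1 v2 v3 *v axis 4 1 \<in> hyperboloid"
    by (simp add: coords)
qed

definition conj_act :: "real^4^4 \<Rightarrow> real^4^4 \<Rightarrow> hyp3 \<Rightarrow> hyp3" where
  "conj_act Q N = hyp_act (Q ** N ** mink_adj Q)"

lemma lorentz_boost: "boost r \<in> Lorentz_group"
proof -
  have "lorentz (boost r)"
    unfolding lorentz_def boost_vec
  proof (intro allI)
    fix x y :: "real^4"
    have "mink (vector [cosh r * x$1 + sinh r * x$4, x$2, x$3, sinh r * x$1 + cosh r * x$4])
        (vector [cosh r * y$1 + sinh r * y$4, y$2, y$3, sinh r * y$1 + cosh r * y$4])
      = ((cosh r)\<^sup>2 - (sinh r)\<^sup>2) * (x$1 * y$1 - x$4 * y$4) + x$2 * y$2 + x$3 * y$3"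
      by (simp add: mink_def power2_eq_square algebra_simps)
    then show "mink (vector [cosh r * x$1 + sinh r * x$4, x$2, x$3, sinh r * x$1 + cosh r * x$4])
        (vector [cosh r * y$1 + sinh r * y$4, y$2, y$3, sinh r * y$1 + cosh r * y$4]) = mink x y"
      unfolding hyperbolic_pythagoras by (simp add: mink_def)
  qed
  then show ?thesis by (simp add: Lorentz_group_def) (simp add: boost_def)
qed

lemma lorentz_quarters:
  "quarter12 \<in> Lorentz_group" "quarter23 \<in> Lorentz_group" "quarter31 \<in> Lorentz_group"
proof -
  have "lorentz quarter12" "lorentz quarter23" "lorentz quarter31"
    unfolding lorentz_def quarter12_vec quarter23_vec quarter31_vec by (simp_all add: mink_def)
  then show "quarter12 \<in> Lorentz_group" "quarter23 \<in> Lorentz_group" "quarter31 \<in> Lorentz_group"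
    by (simp_all add: Lorentz_group_def) (simp_all add: quarter12_def quarter23_def quarter31_def)
qed

text \<open>Lorentz determinants are 1 or -1, so squares have determinant 1. A translation is the
  square of the translation by half the length, a rotation that of the rotation by half the angle,
  and no 4 by 4 determinant has to be expanded.\<close>

lemma det_eq_1_of_square:
  assumes "M \<in> Lorentz_group" "A \<in> Lorentz_group" "M = A ** A"
  shows "M \<in> SLorentz_group"
  using assms det_lorentz[of A] by (auto simp: SLorentz_group_def det_mul Lorentz_group_def)

lemma SLorentz_boost: "boost r \<in> SLorentz_group"
proof (rule det_eq_1_of_square)
  have *: "cosh r = (cosh (r/2))\<^sup>2 + (sinh (r/2))\<^sup>2" "sinh r = 2 * sinh (r/2) * cosh (r/2)"
    using cosh_double[of "r/2"] sinh_double[of "r/2"] by simp_all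
  have "boost r *v x = (boost (r/2) ** boost (r/2)) *v x" for x
    unfolding matrix_vector_mul_assoc[symmetric] boost_vec
    unfolding * by (simp add: vec_eq_iff forall_4 algebra_simps power2_eq_square)
  then show "boost r = boost (r/2) ** boost (r/2)" by (simp add: matrix_eq)
qed (rule lorentz_boost)+

lemma SLorentz_quarters:
  "quarter12 \<in> SLorentz_group" "quarter23 \<in> SLorentz_group" "quarter31 \<in> SLorentz_group"
proof -
  define c where "c = sqrt 2 / 2"
  have c: "c * c = 1/2" by (simp add: c_def)
  define A1 :: "real^4^4" where "A1 = vector [vector [c, -c, 0, 0], vector [c, c, 0, 0], vector [0, 0, 1, 0], vector [0, 0, 0, 1]]"
  define A2 :: "real^4^4" where "A2 = vector [vector [1, 0, 0, 0], vector [0, c, -c, 0], vector [0, c, c, 0], vector [0, 0, 0, 1]]"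
  define A3 :: "real^4^4" where "A3 = vector [vector [c, 0, c, 0], vector [0, 1, 0, 0], vector [-c, 0, c, 0], vector [0, 0, 0, 1]]"
  have cc: "c * (c * z) = z / 2" for z using c by (metis mult.assoc mult.commute times_divide_eq_right mult_1_right)
  have sq: "quarter12 = A1 ** A1" "quarter23 = A2 ** A2" "quarter31 = A3 ** A3"
    by (simp_all add: A1_def A2_def A3_def quarter12_def quarter23_def quarter31_def vec_eq_iff forall_4
      matrix_matrix_mult_def sum_4 c)
  have "lorentz A1" "lorentz A2" "lorentz A3"
    unfolding lorentz_def
    by (simp_all add: A1_def A2_def A3_def mink_def matrix_vector_mult_def sum_4 algebra_simps cc)
  then have "A1 \<in> Lorentz_group" "A2 \<in> Lorentz_group" "A3 \<in> Lorentz_group"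
    by (simp_all add: Lorentz_group_def) (simp_all add: A1_def A2_def A3_def)
  then show "quarter12 \<in> SLorentz_group" "quarter23 \<in> SLorentz_group" "quarter31 \<in> SLorentz_group"
    using sq lorentz_quarters by (blast intro: det_eq_1_of_square)+
qed

lemma std_group_SLorentz: "A \<in> std_group r \<Longrightarrow> A \<in> SLorentz_group"
  by (induction rule: std_group.induct)
     (simp_all add: SLorentz_group_id SLorentz_group_mult SLorentz_group_adj SLorentz_boost SLorentz_quarters)

lemma std_group_Lorentz: "A \<in> std_group r \<Longrightarrow> A \<in> Lorentz_group"
  by (rule SLorentz_group_Lorentz) (rule std_group_SLorentz)

context
  fixes Q assumes Q: "Q \<in> Lorentz_group"
begin

lemma Q_inverse: "mink_adj Q ** Q = mat 1" "Q ** mink_adj Q = mat 1"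
proof -
  have "lorentz Q" using Q by (simp add: Lorentz_group_def)
  then show "mink_adj Q ** Q = mat 1" "Q ** mink_adj Q = mat 1"
    using lorentz_iff_adj_mult lorentz_mult_adj by auto
qed

lemma conj_SLorentz: "N \<in> SLorentz_group \<Longrightarrow> Q ** N ** mink_adj Q \<in> SLorentz_group"
proof -
  assume N: "N \<in> SLorentz_group"
  have "det Q * det (mink_adj Q) = 1" using Q_inverse(2) by (metis det_I det_mul)
  with N Q show ?thesis
    by (simp add: SLorentz_group_def Lorentz_group_mult Lorentz_group_adj det_mul)
qed

lemma conj_act_mult:
  assumes "A \<in> Lorentz_group" "B \<in> Lorentz_group"
  shows "conj_act Q (A ** B) = conj_act Q A \<circ> conj_act Q B"
proof -
  have "Q ** (A ** B) ** mink_adj Q = (Q ** A ** mink_adj Q) ** (Q ** B ** mink_adj Q)"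
    by (metis Q_inverse(1) matrix_mul_assoc matrix_mul_lid)
  then show ?thesis
    using assms Q by (simp add: conj_act_def hyp_act_mult Lorentz_group_mult Lorentz_group_adj)
qed

lemma conj_act_id: "conj_act Q (mat 1) = id"
  by (simp add: conj_act_def Q_inverse hyp_act_id)

lemma conj_act_adj:
  assumes "A \<in> SLorentz_group"
  shows "inv\<^bsub>Isom_plus\<^esub> (conj_act Q A) = conj_act Q (mink_adj A)"
  unfolding conj_act_def inv_Isom_plus[OF conj_SLorentz[OF assms]]
  by (simp add: mink_adj_mult mink_adj_adj matrix_mul_assoc)

lemma coords_conj_act:
  "A \<in> Lorentz_group \<Longrightarrow> mink_adj Q *v coords (conj_act Q A p) = A *v (mink_adj Q *v coords p)"
proof -
  assume A: "A \<in> Lorentz_group"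
  then have "coords (conj_act Q A p) = (Q ** A ** mink_adj Q) *v coords p"
    unfolding conj_act_def using Q by (intro coords_hyp_act Lorentz_group_mult Lorentz_group_adj)
  then show ?thesis
    by (simp add: matrix_vector_mul_assoc matrix_mul_assoc Q_inverse)
qed

lemma adj_coords_inj: "mink_adj Q *v coords p = mink_adj Q *v coords q \<longleftrightarrow> p = q"
proof
  assume "mink_adj Q *v coords p = mink_adj Q *v coords q"
  then have "Q *v (mink_adj Q *v coords p) = Q *v (mink_adj Q *v coords q)" by simp
  then show "p = q" by (simp add: matrix_vector_mul_assoc Q_inverse coords_inject)
qed simp

lemma conj_act_carrier: "A \<in> SLorentz_group \<Longrightarrow> conj_act Q A \<in> carrier Isom_plus"
  by (simp add: conj_act_def carrier_Isom_plus conj_SLorentz)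

lemma generate_conj_act:
  assumes "S = conj_act Q ` {boost r, quarter12, quarter23, quarter31}"
  shows "generate Isom_plus S = conj_act Q ` std_group r"
proof
  have S: "\<exists>A\<in>std_group r. h = conj_act Q A" if "h \<in> S" for h
    using that std_group_boost std_group_quarter12 std_group_quarter23 std_group_quarter31
    unfolding assms by auto
  show "generate Isom_plus S \<subseteq> conj_act Q ` std_group r"
  proof
    fix g assume "g \<in> generate Isom_plus S"
    then show "g \<in> conj_act Q ` std_group r"
    proof induction
      case one
      then show ?case using conj_act_id std_group_id by (metis image_eqI one_Isom_plus)
    next
      case (incl h)
      then show ?case using S by blast
    next
      case (inv h)
      then obtain A where A: "A \<in> std_group r" "h = conj_act Q A" using S by blast
      then have "inv\<^bsub>Isom_plus\<^esub> h = conj_act Q (mink_adj A)"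
        using conj_act_adj std_group_SLorentz by blast
      then show ?case using A std_group_adj by blast
    next
      case (eng h1 h2)
      then obtain A B where "A \<in> std_group r" "h1 = conj_act Q A" "B \<in> std_group r" "h2 = conj_act Q B" by blast
      then have "h1 \<otimes>\<^bsub>Isom_plus\<^esub> h2 = conj_act Q (A ** B)" "A ** B \<in> std_group r"
        by (simp_all add: mult_Isom_plus conj_act_mult std_group_Lorentz std_group_mult)
      then show ?case by blast
    qed
  qed
next
  have S: "S \<subseteq> carrier Isom_plus"
    unfolding assms using conj_act_carrier SLorentz_boost SLorentz_quarters by auto
  have "conj_act Q A \<in> generate Isom_plus S" if "A \<in> std_group r" for A
    using that
  proof induction
    case std_group_id
    then show ?case using generate.one conj_act_id one_Isom_plus by metis
  next
    case (std_group_mult A B)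
    have "conj_act Q (A ** B) = conj_act Q A \<otimes>\<^bsub>Isom_plus\<^esub> conj_act Q B"
      using std_group_Lorentz[OF std_group_mult.hyps(1)] std_group_Lorentz[OF std_group_mult.hyps(2)]
      unfolding mult_Isom_plus by (rule conj_act_mult)
    then show ?case using generate.eng[OF std_group_mult.IH] by (simp only:)
  next
    case (std_group_adj A)
    have "conj_act Q (mink_adj A) = inv\<^bsub>Isom_plus\<^esub> conj_act Q A"
      using conj_act_adj[OF std_group_SLorentz[OF std_group_adj.hyps]] by (rule sym)
    then show ?case
      using group.generate_m_inv_closed[OF group_Isom_plus S std_group_adj.IH] by (simp only:)
  qed (auto simp: assms intro!: generate.incl)
  then show "conj_act Q ` std_group r \<subseteq> generate Isom_plus S" by blast
qed

end

text \<open>Transporting or rotating the frame multiplies its matrix on the right by the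
  corresponding standard generator, so each generator is a conjugate by the same matrix.\<close>

lemma G_group_eq:
  assumes fr: "orthonormal_frame x0 v1 v2 v3"
  shows "G_group x0 v1 v2 v3 r = conj_act (frame_matrix x0 v1 v2 v3) ` std_group r"
proof -
  let ?Q = "frame_matrix x0 v1 v2 v3"
  have Q: "?Q \<in> Lorentz_group" using fr by (rule frame_matrix_Lorentz)
  have v1: "v1 \<in> tangent_space x0" "mink v1 v1 = 1"
    using fr by (auto simp: orthonormal_frame_def)
  have geo: "coords (geodesic x0 v1 r) = cosh r *\<^sub>R coords x0 + sinh r *\<^sub>R v1"
    unfolding geodesic_def by (rule of_coords_inverse) (rule geodesic_in_hyperboloid[OF v1])
  have "frame_matrix (geodesic x0 v1 r) (geodesic_velocity x0 v1 r) v2 v3 = ?Q ** boost r"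
    unfolding matrix_eq matrix_vector_mul_assoc[symmetric] frame_matrix_vec boost_vec
    by (simp add: geodesic_velocity_def geo algebra_simps)
  then have 1: "transl x0 v1 v2 v3 r = conj_act ?Q (boost r)"
    by (simp add: transl_def frame_map_eq_hyp_act conj_act_def)
  have "frame_matrix x0 v2 (- v1) v3 = ?Q ** quarter12"
    unfolding matrix_eq matrix_vector_mul_assoc[symmetric] frame_matrix_vec quarter12_vec by simp
  then have 2: "rot12 x0 v1 v2 v3 = conj_act ?Q quarter12"
    by (simp add: rot12_def frame_map_eq_hyp_act conj_act_def)
  have "frame_matrix x0 v1 v3 (- v2) = ?Q ** quarter23"
    unfolding matrix_eq matrix_vector_mul_assoc[symmetric] frame_matrix_vec quarter23_vec by simp
  then have 3: "rot23 x0 v1 v2 v3 = conj_act ?Q quarter23"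
    by (simp add: rot23_def frame_map_eq_hyp_act conj_act_def)
  have "frame_matrix x0 (- v3) v2 v1 = ?Q ** quarter31"
    unfolding matrix_eq matrix_vector_mul_assoc[symmetric] frame_matrix_vec quarter31_vec by simp
  then have 4: "rot31 x0 v1 v2 v3 = conj_act ?Q quarter31"
    by (simp add: rot31_def frame_map_eq_hyp_act conj_act_def)
  show ?thesis
    unfolding G_group_def by (rule generate_conj_act[OF Q]) (simp add: 1 2 3 4)
qed

section \<open>The reflection group\<close>

text \<open>Inward normals of the chamber \<open>x1 \<ge> x2 \<ge> x3 \<ge> 0\<close>,
  \<open>x1 \<le> tanh (r/2) * x4\<close>. The first three walls bound a chamber of the cube group;
  the fourth bisects the segment from \<open>axis 4 1\<close> to its image under
  \<open>boost r\<close>. The Coxeter diagram is the path 4 - 1 - 2 - 3 with angles \<theta>,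
  \<pi>/3, \<pi>/4.\<close>

definition wall_normal :: "real \<Rightarrow> 4 \<Rightarrow> real^4" where
  "wall_normal r i = (if i = 1 then vector [1 / sqrt 2, - 1 / sqrt 2, 0, 0]
     else if i = 2 then vector [0, 1 / sqrt 2, - 1 / sqrt 2, 0]
     else if i = 3 then vector [0, 0, 1, 0]
     else vector [- cosh (r/2), 0, 0, - sinh (r/2)])"

lemma mink_wall_normal:
  "mink x (wall_normal r 1) = (x$1 - x$2) / sqrt 2"
  "mink x (wall_normal r 2) = (x$2 - x$3) / sqrt 2"
  "mink x (wall_normal r 3) = x$3"
  "mink x (wall_normal r 4) = sinh (r/2) * x$4 - cosh (r/2) * x$1"
  by (simp_all add: mink_def wall_normal_def diff_divide_distrib algebra_simps)

lemma wall_normal_nth: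
  "wall_normal r 1 $ 1 = 1 / sqrt 2" "wall_normal r 1 $ 2 = - 1 / sqrt 2" "wall_normal r 1 $ 3 = 0" "wall_normal r 1 $ 4 = 0"
  "wall_normal r 2 $ 1 = 0" "wall_normal r 2 $ 2 = 1 / sqrt 2" "wall_normal r 2 $ 3 = - 1 / sqrt 2" "wall_normal r 2 $ 4 = 0"
  "wall_normal r 3 $ 1 = 0" "wall_normal r 3 $ 2 = 0" "wall_normal r 3 $ 3 = 1" "wall_normal r 3 $ 4 = 0"
  "wall_normal r 4 $ 1 = - cosh (r/2)" "wall_normal r 4 $ 2 = 0" "wall_normal r 4 $ 3 = 0" "wall_normal r 4 $ 4 = - sinh (r/2)"
  by (simp_all add: wall_normal_def)

global_interpretation refl: reflection_system mink "wall_normal r" for r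
proof
  show "mink (wall_normal r i) (wall_normal r i) = 1" for i
    using exhaust_4[of i] cosh_square_eq[of "r/2"]
    by (auto simp: mink_wall_normal wall_normal_nth) (simp add: power2_eq_square)
qed (simp_all add: mink_simps mink_sym)

lemma reflect_eq:
  "refl.reflect r 1 x = vector [x$2, x$1, x$3, x$4]"
  "refl.reflect r 2 x = vector [x$1, x$3, x$2, x$4]"
  "refl.reflect r 3 x = vector [x$1, x$2, - x$3, x$4]"
  "refl.reflect r 4 x = vector [sinh r * x$4 - cosh r * x$1, x$2, x$3, cosh r * x$4 - sinh r * x$1]"
proof -
  have *: "cosh r = 2 * (cosh (r/2))\<^sup>2 - 1" "cosh r = 1 + 2 * (sinh (r/2))\<^sup>2" "sinh r = 2 * sinh (r/2) * cosh (r/2)"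
    using cosh_double[of "r/2"] sinh_double[of "r/2"] cosh_square_eq[of "r/2"] by simp_all
  have sq: "sqrt 2 * (sqrt 2 * a) = 2 * a" for a :: real
    by (simp flip: mult.assoc)
  show "refl.reflect r 1 x = vector [x$2, x$1, x$3, x$4]" "refl.reflect r 2 x = vector [x$1, x$3, x$2, x$4]"
    "refl.reflect r 3 x = vector [x$1, x$2, - x$3, x$4]"
    by (simp_all add: refl.reflect_def mink_wall_normal vec_eq_iff forall_4 wall_normal_nth field_simps sq)
  show "refl.reflect r 4 x = vector [sinh r * x$4 - cosh r * x$1, x$2, x$3, cosh r * x$4 - sinh r * x$1]"
  proof -
    have "sinh r * x$4 - cosh r * x$1 = 2 * sinh (r/2) * cosh (r/2) * x$4 - (2 * (cosh (r/2))\<^sup>2 - 1) * x$1"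
      "cosh r * x$4 - sinh r * x$1 = (1 + 2 * (sinh (r/2))\<^sup>2) * x$4 - 2 * sinh (r/2) * cosh (r/2) * x$1"
      by (simp only: *(1) *(3)) (simp only: *(2) *(3))
    then show ?thesis
      unfolding vec_eq_iff forall_4 refl.reflect_def mink_wall_normal vector_minus_component
        vector_scaleR_component wall_normal_nth vector_4
      by (simp add: algebra_simps power2_eq_square)
  qed
qed

lemma std_group_eq_even_word:
  assumes "A \<in> std_group r"
  shows "\<exists>w. even (length w) \<and> (\<forall>x. A *v x = refl.word r w x)"
  using assms
proof induction
  case std_group_id
  then show ?case by (intro exI[of _ "[]"]) simp
next
  case (std_group_mult A B)
  then obtain u w where "even (length u)" "\<forall>x. A *v x = refl.word r u x" "even (length w)" "\<forall>x. B *v x = refl.word r w x"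
    by blast
  then show ?case
    by (intro exI[of _ "u @ w"]) (simp add: matrix_vector_mul_assoc[symmetric])
next
  case (std_group_adj A)
  then obtain w where w: "even (length w)" "\<And>x. A *v x = refl.word r w x" by blast
  have "mink_adj A *v x = refl.word r (rev w) x" for x
  proof -
    have "A *v refl.word r (rev w) x = x" by (simp add: w)
    then have "(mink_adj A ** A) *v refl.word r (rev w) x = mink_adj A *v x"
      by (simp add: matrix_vector_mul_assoc[symmetric])
    then show ?thesis
      using std_group_Lorentz[OF std_group_adj.hyps] by (simp add: Lorentz_group_def lorentz_iff_adj_mult)
  qed
  then show ?case using w(1) by (intro exI[of _ "rev w"]) simp
next
  case std_group_boost
  \<comment> \<open>The last five letters form the reflection in the plane x1 = 0; composed with the
    mirror at distance r/2 it gives the translation by r.\<close>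
  show ?case
    by (intro exI[of _ "[4,1,2,3,2,1]"])
       (simp add: reflect_eq boost_vec vec_eq_iff forall_4 algebra_simps)
next
  case std_group_quarter12
  show ?case
    by (intro exI[of _ "[1,2,3,2]"]) (simp add: reflect_eq quarter12_vec vec_eq_iff forall_4)
next
  case std_group_quarter23
  show ?case
    by (intro exI[of _ "[2,3]"]) (simp add: reflect_eq quarter23_vec vec_eq_iff forall_4)
next
  case std_group_quarter31
  show ?case
    by (intro exI[of _ "[1,3,2,1]"]) (simp add: reflect_eq quarter31_vec vec_eq_iff forall_4)
qed

text \<open>It is enough to realise the pairs ending in 3: \<open>[i, j]\<close> acts as
  \<open>[i, 3]\<close> followed on the right by the inverse of \<open>[j, 3]\<close>, so four
  explicit matrices suffice.\<close>

lemma even_word_in_std_group: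
  assumes "even (length w)"
  shows "\<exists>A\<in>std_group r. \<forall>x. A *v x = refl.word r w x"
proof -
  have 3: "\<exists>A\<in>std_group r. \<forall>x. A *v x = refl.word r [i, 3] x" for i
  proof -
    consider "i = 1" | "i = 2" | "i = 3" | "i = 4" using exhaust_4 by blast
    then show ?thesis
    proof cases
      case 1
      have "quarter12 ** quarter23 ** quarter23 \<in> std_group r" by (intro std_group.intros)
      then show ?thesis
        by (rule bexI[rotated]) (simp add: 1 reflect_eq quarter12_vec quarter23_vec vec_eq_iff forall_4
          matrix_vector_mul_assoc[symmetric])
    next
      case 2
      have "quarter23 \<in> std_group r" by (intro std_group.intros)
      then show ?thesis
        by (rule bexI[rotated]) (simp add: 2 reflect_eq quarter23_vec vec_eq_iff forall_4)
    next
      case 3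
      have "mat 1 \<in> std_group r" by (intro std_group.intros)
      then show ?thesis
        by (rule bexI[rotated]) (simp add: 3)
    next
      case 4
      \<comment> \<open>The half turn \<open>quarter31 ** quarter31\<close> negates x1 and x3; the
        boost turns the first sign change into the reflection 4, the second is the reflection
        3.\<close>
      have "boost r ** quarter31 ** quarter31 \<in> std_group r" by (intro std_group.intros)
      then show ?thesis
        by (rule bexI[rotated]) (simp add: 4 reflect_eq boost_vec quarter31_vec vec_eq_iff forall_4
          matrix_vector_mul_assoc[symmetric] algebra_simps)
    qed
  qed
  have ij: "\<exists>A\<in>std_group r. \<forall>x. A *v x = refl.word r [i, j] x" for i j
  proof -
    obtain A where A: "A \<in> std_group r" "\<And>x. A *v x = refl.word r [i, 3] x" using 3 by blast
    obtain B where B: "B \<in> std_group r" "\<And>x. B *v x = refl.word r [j, 3] x" using 3 by blast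
    have "mink_adj B *v x = refl.word r [3, j] x" for x
    proof -
      have "B *v refl.word r [3, j] x = x" by (simp add: B)
      then have "(mink_adj B ** B) *v refl.word r [3, j] x = mink_adj B *v x"
        by (simp only: matrix_vector_mul_assoc[symmetric])
      then show ?thesis
        using std_group_Lorentz[OF B(1)] by (simp add: Lorentz_group_def lorentz_iff_adj_mult)
    qed
    then have "(A ** mink_adj B) *v x = refl.word r [i, j] x" for x
      by (simp add: matrix_vector_mul_assoc[symmetric] A)
    moreover have "A ** mink_adj B \<in> std_group r" using A B by (intro std_group.intros)
    ultimately show ?thesis by blast
  qed
  show ?thesis
    using assms
  proof (induction w rule: induct_list012)
    case 1
    then show ?case using std_group_id by (intro bexI[of _ "mat 1"]) auto
  next
    case (3 i j w)
    then obtain B where B: "B \<in> std_group r" "\<And>x. B *v x = refl.word r w x" by auto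
    obtain A where A: "A \<in> std_group r" "\<And>x. A *v x = refl.word r [i, j] x" using ij by blast
    then have "A ** B \<in> std_group r" "\<And>x. (A ** B) *v x = refl.word r (i # j # w) x"
      using B by (simp_all add: std_group_mult matrix_vector_mul_assoc[symmetric])
    then show ?case by blast
  qed simp
qed

lemma mink_wall_normals:
  "mink (wall_normal r 1) (wall_normal r 2) = - cos (pi / 3)" "mink (wall_normal r 1) (wall_normal r 3) = - cos (pi / 2)"
  "mink (wall_normal r 2) (wall_normal r 3) = - cos (pi / 4)" "mink (wall_normal r 1) (wall_normal r 4) = - (cosh (r/2) / sqrt 2)"
  "mink (wall_normal r 2) (wall_normal r 4) = - cos (pi / 2)" "mink (wall_normal r 3) (wall_normal r 4) = - cos (pi / 2)"
  by (simp_all add: mink_wall_normal wall_normal_nth cos_60 cos_45) (simp_all add: field_simps)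

lemma coxeter_system_wall_normal:
  assumes "cosh (r/2) / sqrt 2 \<ge> 1 \<or> (\<exists>m\<ge>2. cosh (r/2) / sqrt 2 = cos (pi / real m))"
  shows "coxeter_system mink (wall_normal r)"
proof
  fix i j :: 4
  assume ij: "i \<noteq> j"
  let ?P = "\<lambda>c. c \<le> - 1 \<or> (\<exists>m\<ge>2. c = - cos (pi / real m))"
  have P: "?P (- cos (pi / real m))" if "m \<ge> 2" for m using that by blast
  have "?P (- (cosh (r/2) / sqrt 2))" using assms by auto
  then have "?P (mink (wall_normal r 1) (wall_normal r 2))" "?P (mink (wall_normal r 1) (wall_normal r 3))" "?P (mink (wall_normal r 1) (wall_normal r 4))"
    "?P (mink (wall_normal r 2) (wall_normal r 3))" "?P (mink (wall_normal r 2) (wall_normal r 4))" "?P (mink (wall_normal r 3) (wall_normal r 4))"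
    unfolding mink_wall_normals using P[of 2] P[of 3] P[of 4] by simp_all
  note up = this
  have down: "?P (mink (wall_normal r j) (wall_normal r i))" if "?P (mink (wall_normal r i) (wall_normal r j))" for i j
    using that by (subst (1 2) mink_sym)
  show "?P (mink (wall_normal r i) (wall_normal r j))"
    using ij exhaust_4[of i] exhaust_4[of j]
    by (elim disjE) (simp_all only: up down simp_thms)
qed

section \<open>The fundamental chamber\<close>

definition std_coords :: "real^4^4 \<Rightarrow> hyp3 \<Rightarrow> real^4" where
  "std_coords Q p = mink_adj Q *v coords p"

text \<open>The Coxeter condition on r together with a frame matrix Q: orbits and volumes live in
  hyperbolic space, while words act on the coordinates in the frame.\<close>

locale hyp_chamber = coxeter_system mink "wall_normal r" for r +
  fixes Q :: "real^4^4"
  assumes Q: "Q \<in> Lorentz_group" and r_pos: "r > 0"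
begin

lemma Q_std_coords: "Q *v std_coords Q p = coords p"
  by (simp add: std_coords_def matrix_vector_mul_assoc Q_inverse[OF Q])

lemma std_coords_hyperboloid: "std_coords Q p \<in> hyperboloid"
  unfolding std_coords_def by (intro Lorentz_group_hyperboloid Lorentz_group_adj Q coords)

lemma mink_std_coords: "mink (std_coords Q p) (std_coords Q q) = mink (coords p) (coords q)"
  using Q Lorentz_group_adj[OF Q] by (simp add: std_coords_def Lorentz_group_def lorentz_def)

lemma std_coords_eq_iff: "std_coords Q p = std_coords Q q \<longleftrightarrow> p = q"
  by (simp add: std_coords_def adj_coords_inj[OF Q])

lemma ex_std_coords:
  assumes "x \<in> hyperboloid"
  shows "\<exists>p. std_coords Q p = x"
proof -
  have "coords (of_coords (Q *v x)) = Q *v x"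
    using assms Q by (intro of_coords_inverse Lorentz_group_hyperboloid)
  then have "std_coords Q (of_coords (Q *v x)) = x"
    by (simp add: std_coords_def matrix_vector_mul_assoc Q_inverse[OF Q])
  then show ?thesis by blast
qed

lemma std_coords_conj_act:
  "A \<in> std_group r \<Longrightarrow> std_coords Q (conj_act Q A p) = A *v std_coords Q p"
  unfolding std_coords_def by (rule coords_conj_act[OF Q]) (rule std_group_Lorentz)

lemma dist_std_coords: "cosh (dist p q) = - mink (std_coords Q p) (std_coords Q q)"
  by (simp add: mink_std_coords cosh_dist_hyp3)

lemma dist_less_iff_std_coords:
  "dist p q < dist p' q' \<longleftrightarrow> mink (std_coords Q p') (std_coords Q q') < mink (std_coords Q p) (std_coords Q q)"
  using dist_hyp3_le_iff[of p' q' p q] by (simp add: mink_std_coords not_le[symmetric])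

lemma word_hyperboloid: "x \<in> hyperboloid \<Longrightarrow> word w x \<in> hyperboloid"
proof (induction w)
  case (Cons i w)
  then have y: "word w x \<in> hyperboloid" by simp
  have "reflect i (word w x) \<in> hyperboloid"
  proof (rule mink_neg_imp_same_sheet)
    show "mink (reflect i (word w x)) (reflect i (word w x)) = -1"
      using y by (simp only: B_reflect) (simp add: hyperboloid_def)
    have "mink (reflect i (word w x)) (word w x) = -1 - 2 * (mink (word w x) (wall_normal r i))\<^sup>2"
      using y by (simp add: reflect_def mink_simps hyperboloid_def mink_sym[of "wall_normal r i"] power2_eq_square)
    then show "mink (reflect i (word w x)) (word w x) < 0"
      using zero_le_power2[of "mink (word w x) (wall_normal r i)"] by linarith
  qed (rule y)
  then show ?case by simp
qed simp

definition base :: hyp3 where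
  "base = (SOME p. \<forall>i. mink (std_coords Q p) (wall_normal r i) > 0)"

lemma base_interior: "mink (std_coords Q base) (wall_normal r i) > 0"
proof -
  \<comment> \<open>A quarter of tanh (r/2): the largest space coordinate 3d then satisfies the
    fourth wall strictly, since the time coordinate is at least 1.\<close>
  define d where "d = sinh (r/2) / (4 * cosh (r/2))"
  have d: "d > 0" using r_pos by (simp add: d_def)
  define x :: "real^4" where "x = vector [3 * d, 2 * d, d, sqrt (1 + 14 * d\<^sup>2)]"
  have x: "x \<in> hyperboloid"
    by (simp add: x_def hyperboloid_def mink_def power2_eq_square add_pos_nonneg)
  have "mink x (wall_normal r i) > 0" for i
  proof -
    have "cosh (r/2) * (3 * d) = 3/4 * sinh (r/2)" by (simp add: d_def)
    also have "\<dots> < sinh (r/2) * 1" using r_pos by simp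
    also have "\<dots> \<le> sinh (r/2) * sqrt (1 + 14 * d\<^sup>2)"
      using r_pos by (intro mult_left_mono) auto
    finally show ?thesis
      using exhaust_4[of i] d by (auto simp: mink_wall_normal x_def)
  qed
  then have "\<exists>p. \<forall>i. mink (std_coords Q p) (wall_normal r i) > 0"
    using ex_std_coords[OF x] by metis
  then show ?thesis unfolding base_def by (rule someI2_ex) blast
qed

text \<open>A nontrivial word has a root that is nonpositive on the cone, whereas its value at the
  image of \<open>base\<close> is one of the strictly positive wall values of
  \<open>base\<close>.\<close>

lemma word_base_in_cone:
  assumes "word w (std_coords Q base) \<in> cone"
  shows "word w = id"
proof (rule ccontr)
  assume "word w \<noteq> id"
  then obtain i where "\<forall>p\<in>cone. mink p (word w (wall_normal r i)) \<le> 0"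
    using ex_negative_root by blast
  then have "mink (word w (std_coords Q base)) (word w (wall_normal r i)) \<le> 0" using assms by blast
  then show False using base_interior[of i] by (simp add: B_word)
qed

definition chamber :: "hyp3 set" where
  "chamber = {p. std_coords Q p \<in> cone}"

lemma continuous_on_std_coords: "continuous_on A (std_coords Q)"
  unfolding std_coords_def
  by (rule continuous_on_compose2[OF matrix_vector_mult_linear_continuous_on continuous_on_coords]) blast

lemma continuous_on_mink_std_coords: "continuous_on A (\<lambda>p. mink (std_coords Q p) y)"
  unfolding mink_def by (intro continuous_intros continuous_on_std_coords)

text \<open>The ball only has to stay inside the open chamber around \<open>base\<close>, so one
  radius serves all words at once.\<close>

lemma ex_base_gap: "\<exists>\<epsilon>>0. \<forall>w p. std_coords Q p = word w (std_coords Q base) \<longrightarrow> dist p base < \<epsilon> \<longrightarrow> word w = id"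
proof -
  let ?U = "\<Inter>i. {p. mink (std_coords Q p) (wall_normal r i) > 0}"
  have "open ?U"
    by (intro open_INT ballI open_Collect_less continuous_on_const continuous_on_mink_std_coords) simp
  moreover have "base \<in> ?U" using base_interior by simp
  ultimately obtain \<epsilon> where \<epsilon>: "\<epsilon> > 0" "ball base \<epsilon> \<subseteq> ?U" by (metis open_contains_ball)
  have "word w = id" if "std_coords Q p = word w (std_coords Q base)" "dist p base < \<epsilon>" for w p
  proof (rule word_base_in_cone)
    have "p \<in> ?U" using \<epsilon>(2) that(2) by (auto simp: dist_commute)
    then show "word w (std_coords Q base) \<in> cone"
      unfolding that(1)[symmetric] by (auto simp: cone_def intro: less_imp_le)
  qed
  with \<epsilon>(1) show ?thesis by blast
qed

definition gap :: real where
  "gap = (SOME \<epsilon>. \<epsilon> > 0 \<and> (\<forall>w p. std_coords Q p = word w (std_coords Q base) \<longrightarrow> dist p base < \<epsilon> \<longrightarrow> word w = id))"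

lemma gap_pos: "gap > 0"
  and gap: "std_coords Q p = word w (std_coords Q base) \<Longrightarrow> dist p base < gap \<Longrightarrow> word w = id"
proof -
  have "gap > 0 \<and> (\<forall>w p. std_coords Q p = word w (std_coords Q base) \<longrightarrow> dist p base < gap \<longrightarrow> word w = id)"
    unfolding gap_def by (rule someI_ex) (use ex_base_gap in blast)
  then show "gap > 0" "std_coords Q p = word w (std_coords Q base) \<Longrightarrow> dist p base < gap \<Longrightarrow> word w = id"
    by blast+
qed

definition G :: "(hyp3 \<Rightarrow> hyp3) set" where
  "G = conj_act Q ` std_group r"

lemma G_carrier: "G \<subseteq> carrier Isom_plus"
  using conj_act_carrier[OF Q] std_group_SLorentz by (auto simp: G_def)

lemma G_comp: "g \<in> G \<Longrightarrow> h \<in> G \<Longrightarrow> g \<circ> h \<in> G"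
proof -
  assume "g \<in> G" "h \<in> G"
  then obtain A B where A: "A \<in> std_group r" "g = conj_act Q A" and B: "B \<in> std_group r" "h = conj_act Q B"
    unfolding G_def by blast
  have "g \<circ> h = conj_act Q (A ** B)"
    unfolding A(2) B(2) by (rule conj_act_mult[OF Q std_group_Lorentz[OF A(1)] std_group_Lorentz[OF B(1)], symmetric])
  then show ?thesis unfolding G_def using std_group_mult[OF A(1) B(1)] by (rule image_eqI)
qed

lemma G_id: "id \<in> G"
  unfolding G_def conj_act_id[OF Q, symmetric] by (intro imageI std_group_id)

lemma G_inv: "g \<in> G \<Longrightarrow> \<exists>h\<in>G. h \<circ> g = id \<and> g \<circ> h = id"
proof -
  assume g: "g \<in> G"
  then obtain A where A: "A \<in> std_group r" "g = conj_act Q A" by (auto simp: G_def)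
  then have "inv\<^bsub>Isom_plus\<^esub> g \<in> G"
    using conj_act_adj[OF Q std_group_SLorentz[OF A(1)]] std_group_adj by (simp add: G_def)
  then show ?thesis using inv_Isom_plus_fun[of g] g G_carrier by blast
qed

lemma dist_G: "g \<in> G \<Longrightarrow> dist (g p) (g q) = dist p q"
  using G_carrier by (auto simp: Isom_plus_def)

lemma G_word: "g \<in> G \<Longrightarrow> \<exists>w. even (length w) \<and> (\<forall>p. std_coords Q (g p) = word w (std_coords Q p))"
proof -
  assume "g \<in> G"
  then obtain A where A: "A \<in> std_group r" "g = conj_act Q A" unfolding G_def by blast
  obtain w where "even (length w)" "\<And>x. A *v x = word w x" using std_group_eq_even_word[OF A(1)] by blast
  then show ?thesis by (intro exI[of _ w]) (simp add: A(2) std_coords_conj_act[OF A(1)])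
qed

lemma word_G:
  assumes "even (length w)"
  shows "\<exists>g\<in>G. \<forall>p. std_coords Q (g p) = word w (std_coords Q p)"
proof -
  obtain A where "A \<in> std_group r" "\<And>x. A *v x = word w x"
    using even_word_in_std_group[OF assms, of r] by blast
  then show ?thesis using std_coords_conj_act by (intro bexI[of _ "conj_act Q A"]) (auto simp: G_def)
qed

lemma G_eq_id_iff_word:
  assumes "\<And>p. std_coords Q (g p) = word w (std_coords Q p)" "word w = id"
  shows "g = id"
  using assms by (auto simp: fun_eq_iff std_coords_eq_iff)

lemma G_gap:
  assumes "g \<in> G" "h \<in> G" "dist (g base) (h base) < gap"
  shows "g = h"
proof -
  obtain k where k: "k \<in> G" "k \<circ> h = id" "h \<circ> k = id" using G_inv assms(2) by blast
  have kg: "k \<circ> g \<in> G" using k(1) assms(1) by (rule G_comp)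
  then obtain w where w: "\<And>p. std_coords Q ((k \<circ> g) p) = word w (std_coords Q p)" using G_word by blast
  have "k (h base) = base" using k(2) by (metis comp_apply id_apply)
  then have "dist ((k \<circ> g) base) base < gap"
    using dist_G[OF k(1), of "g base" "h base"] assms(3) by simp
  then have "word w = id" using gap w by blast
  then have "k \<circ> g = id" using G_eq_id_iff_word w by blast
  then have "h \<circ> (k \<circ> g) = h" by simp
  then show "g = h" using k(3) by (metis comp_assoc id_comp)
qed

text \<open>Evaluation at \<open>base\<close> separates the group: the maps sending
  \<open>base\<close> within \<open>gap\<close> of \<open>g base\<close> form a subbasic open set
  that meets G only in g.\<close>

lemma G_discrete: "discrete_in_Isom_plus G"
proof -
  have "openin (subtopology Isom_plus_topology G) {g}" if g: "g \<in> G" for g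
  proof -
    let ?V = "{f. f ` {base} \<subseteq> ball (g base) gap}"
    have "openin compact_open_topology ?V"
      unfolding compact_open_topology_def
    proof (rule topology_generated_by_Basis)
      show "?V \<in> {{f. f ` K \<subseteq> U} |K U. compact K \<and> open U}"
        by (intro CollectI exI[of _ "{base}"] exI[of _ "ball (g base) gap"]) simp
    qed
    moreover have "?V \<inter> carrier Isom_plus \<inter> G = {g}"
      using g gap_pos G_gap[OF g] G_carrier by auto
    ultimately show ?thesis
      unfolding Isom_plus_topology_def openin_subtopology by blast
  qed
  moreover have "topspace (subtopology Isom_plus_topology G) = G"
    using G_carrier by (auto simp: topspace_subtopology topspace_Isom_plus_topology)
  ultimately have "discrete_topology G = subtopology Isom_plus_topology G"
    unfolding discrete_topology_unique by blast
  then show ?thesis by (simp add: discrete_in_Isom_plus_def)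
qed

text \<open>The reflection orbit of \<open>base\<close> is separated by \<open>gap\<close>, so it
  has a point nearest to p. Pulling p back by the word of that point lands in the cone: if wall i
  were violated, the neighbouring orbit point behind that wall would be nearer.\<close>

lemma word_chamber_covers: "\<exists>w q. q \<in> chamber \<and> std_coords Q p = word w (std_coords Q q)"
proof -
  define Orb where "Orb = {q. \<exists>w. std_coords Q q = word w (std_coords Q base)}"
  have sep: "x = y" if xy: "x \<in> Orb" "y \<in> Orb" "dist x y < gap" for x y
  proof -
    obtain u v where u: "std_coords Q x = word u (std_coords Q base)" and v: "std_coords Q y = word v (std_coords Q base)"
      using xy by (auto simp: Orb_def)
    obtain z where z: "std_coords Q z = word (rev v @ u) (std_coords Q base)"
      using ex_std_coords word_hyperboloid std_coords_hyperboloid by metis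
    have "mink (std_coords Q z) (std_coords Q base) = mink (std_coords Q x) (std_coords Q y)"
      using B_word_left[of "rev v" "word u (std_coords Q base)" "std_coords Q base"] by (simp add: z u v)
    then have "cosh (dist z base) = cosh (dist x y)" by (simp add: dist_std_coords)
    then have "dist z base = dist x y" by simp
    then have "word (rev v @ u) = id" using gap[OF z] xy(3) by simp
    then have "word v (word (rev v @ u) (std_coords Q base)) = word v (std_coords Q base)" by simp
    then have "word u (std_coords Q base) = word v (std_coords Q base)" by simp
    then show "x = y" using u v std_coords_eq_iff by metis
  qed
  define N where "N = Orb \<inter> cball p (dist p base)"
  have "finite N"
    unfolding N_def using compact_cball_hyp3 gap_pos sep by (rule separated_finite_Int_compact)
  moreover have "base \<in> N" by (auto simp: N_def Orb_def intro!: exI[of _ "[]"])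
  ultimately obtain q0 where q0: "q0 \<in> N" "\<And>q. q \<in> N \<Longrightarrow> dist p q0 \<le> dist p q"
    using ex_is_arg_min_if_finite[of N "dist p"] unfolding is_arg_min_linorder by blast
  then have closest: "dist p q0 \<le> dist p q" if "q \<in> Orb" for q
    using that \<open>base \<in> N\<close> by (cases "q \<in> N") (force simp: N_def)+
  obtain w where w: "std_coords Q q0 = word w (std_coords Q base)" using q0 by (auto simp: N_def Orb_def)
  define y where "y = word (rev w) (std_coords Q p)"
  obtain q where q: "std_coords Q q = y"
    using ex_std_coords word_hyperboloid std_coords_hyperboloid unfolding y_def by metis
  have "y \<in> cone"
    unfolding cone_def
  proof (intro CollectI allI)
    fix i
    show "0 \<le> mink y (wall_normal r i)"
    proof (rule ccontr)
      assume "\<not> 0 \<le> mink y (wall_normal r i)"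
      then have neg: "mink y (wall_normal r i) < 0" by simp
      obtain q1 where q1: "std_coords Q q1 = word (w @ [i]) (std_coords Q base)"
        using ex_std_coords word_hyperboloid std_coords_hyperboloid by metis
      have "mink (std_coords Q p) (std_coords Q q0) = mink y (std_coords Q base)"
        using B_word_left[of "rev w" "std_coords Q p" "std_coords Q base"] by (simp add: w y_def)
      moreover have "mink (std_coords Q p) (std_coords Q q1) = mink y (reflect i (std_coords Q base))"
        using B_word_left[of "rev w" "std_coords Q p" "reflect i (std_coords Q base)"] by (simp add: q1 y_def)
      moreover have "mink y (reflect i (std_coords Q base)) =
          mink y (std_coords Q base) - 2 * mink (std_coords Q base) (wall_normal r i) * mink y (wall_normal r i)"
        by (simp add: reflect_def mink_simps)
      moreover have "mink (std_coords Q base) (wall_normal r i) * mink y (wall_normal r i) < 0"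
        using base_interior[of i] neg by (rule mult_pos_neg)
      ultimately have "dist p q1 < dist p q0"
        unfolding dist_less_iff_std_coords by linarith
      moreover have "q1 \<in> Orb" using q1 unfolding Orb_def by blast
      ultimately show False using closest by force
    qed
  qed
  then have "q \<in> chamber" by (simp add: chamber_def q)
  moreover have "std_coords Q p = word w (std_coords Q q)" by (simp add: q y_def)
  ultimately show ?thesis by blast
qed

section \<open>The domain of the even subgroup and compactness of the quotient\<close>

text \<open>The even words have index two in the reflection group, so the chamber is doubled across
  one wall; wall 3 is chosen because its reflection only changes a sign.\<close>

definition domain :: "hyp3 set" where
  "domain = {p. std_coords Q p \<in> cone \<or> reflect 3 (std_coords Q p) \<in> cone}"

lemma domain_covers: "\<exists>g\<in>G. \<exists>q\<in>domain. p = g q"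
proof -
  obtain w q where q: "q \<in> chamber" and w: "std_coords Q p = word w (std_coords Q q)"
    using word_chamber_covers by blast
  show ?thesis
  proof (cases "even (length w)")
    case True
    then obtain g where "g \<in> G" "\<And>p. std_coords Q (g p) = word w (std_coords Q p)" using word_G by blast
    moreover from this have "p = g q" using w std_coords_eq_iff by metis
    moreover have "q \<in> domain" using q by (simp add: domain_def chamber_def)
    ultimately show ?thesis by blast
  next
    case False
    then have "even (length (w @ [3]))" by simp
    then obtain g where g: "g \<in> G" "\<And>p. std_coords Q (g p) = word (w @ [3]) (std_coords Q p)" using word_G by blast
    obtain q' where q': "std_coords Q q' = word [3] (std_coords Q q)"
      using ex_std_coords word_hyperboloid std_coords_hyperboloid by metis
    have "q' \<in> domain" using q by (simp add: domain_def chamber_def q')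
    moreover have "p = g q'"
      using w g(2)[of q'] std_coords_eq_iff[of p "g q'"] by (simp add: q')
    ultimately show ?thesis using g(1) by blast
  qed
qed

lemma orbit_mapI: "g \<in> G \<Longrightarrow> y = g p \<Longrightarrow> y \<in> orbit_map G p"
  by (auto simp: orbit_map_def)

lemma self_in_orbit_map: "p \<in> orbit_map G p"
  using G_id by (rule orbit_mapI) simp

lemma orbit_map_G: "g \<in> G \<Longrightarrow> orbit_map G (g p) = orbit_map G p"
proof
  assume g: "g \<in> G"
  show "orbit_map G (g p) \<subseteq> orbit_map G p"
  proof
    fix y assume "y \<in> orbit_map G (g p)"
    then obtain k where "k \<in> G" "y = k (g p)" by (auto simp: orbit_map_def)
    then show "y \<in> orbit_map G p" using G_comp[OF _ g, of k] by (intro orbit_mapI[of "k \<circ> g"]) auto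
  qed
  obtain h where h: "h \<in> G" "h \<circ> g = id" using G_inv[OF g] by blast
  show "orbit_map G p \<subseteq> orbit_map G (g p)"
  proof
    fix y assume "y \<in> orbit_map G p"
    then obtain k where "k \<in> G" "y = k p" by (auto simp: orbit_map_def)
    moreover have "p = h (g p)" using h(2) by (metis comp_apply id_apply)
    ultimately have "k \<circ> h \<in> G" "y = (k \<circ> h) (g p)" using G_comp h(1) by auto
    then show "y \<in> orbit_map G (g p)" by (rule orbit_mapI)
  qed
qed

lemma closed_domain: "closed domain"
proof -
  have "domain = (\<Inter>i. {p. 0 \<le> mink (std_coords Q p) (wall_normal r i)})
      \<union> (\<Inter>i. {p. 0 \<le> mink (std_coords Q p) (reflect 3 (wall_normal r i))})"
    using B_word_left[of "[3]"] by (auto simp: domain_def cone_def)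
  then show ?thesis
    by (simp only:) (intro closed_Un closed_INT ballI closed_Collect_le continuous_on_const continuous_on_mink_std_coords)
qed

lemma norm_reflect_3: "norm (reflect 3 x) = norm x"
proof -
  have "(norm (reflect 3 x))\<^sup>2 = (norm x)\<^sup>2"
    unfolding norm_square_mink B_reflect by (simp add: reflect_eq)
  then show ?thesis by simp
qed

lemma G_cocompact:
  assumes bdd: "\<And>x. x \<in> cone \<Longrightarrow> x \<in> hyperboloid \<Longrightarrow> norm x \<le> R"
  shows "cocompact G"
proof -
  have "norm (coords p) \<le> norm Q * R" if "p \<in> domain" for p
  proof -
    have "norm (std_coords Q p) \<le> R"
      using that bdd[of "std_coords Q p"] bdd[of "reflect 3 (std_coords Q p)"]
        std_coords_hyperboloid[of p] word_hyperboloid[of "std_coords Q p" "[3]"]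
      by (auto simp: domain_def norm_reflect_3)
    then show ?thesis
      unfolding Q_std_coords[symmetric, of p]
      by (rule order_trans[OF norm_matrix_vector_le mult_left_mono[OF _ norm_ge_zero]])
  qed
  with closed_domain have K: "compact domain" by (rule compact_hyp3)
  have cont: "continuous_map euclidean (orbit_space G) (orbit_map G)"
    using quotient_map_orbit_map by (rule quotient_imp_continuous_map)
  have "compactin (orbit_space G) (orbit_map G ` domain)"
    using K cont by (intro image_compactin[of euclidean]) (simp_all add: compactin_euclidean_iff)
  moreover have "orbit_map G ` domain = topspace (orbit_space G)"
  proof -
    have "topspace (orbit_space G) = range (orbit_map G)"
      using quotient_imp_surjective_map[OF quotient_map_orbit_map[of G]] by simp
    moreover have "orbit_map G p \<in> orbit_map G ` domain" for p
      using domain_covers[of p] orbit_map_G by force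
    ultimately show ?thesis by auto
  qed
  ultimately show ?thesis by (simp add: cocompact_def compact_space_def)
qed

text \<open>If the quotient were compact, finitely many images of balls around b would cover it, and
  every orbit would meet one fixed ball. A far point x of the cone escapes: since
  \<open>axis 4 1\<close> is in the cone too, \<open>B_word_le\<close> leaves no point in the orbit
  of x nearer to b than x.\<close>

lemma G_not_cocompact:
  assumes unb: "\<And>R. \<exists>x\<in>cone. x \<in> hyperboloid \<and> x$4 > R"
  shows "\<not> cocompact G"
proof
  assume "cocompact G"
  then have comp: "compactin (orbit_space G) (topspace (orbit_space G))"
    by (simp add: cocompact_def compact_space_def)
  have top: "topspace (orbit_space G) = range (orbit_map G)"
    using quotient_imp_surjective_map[OF quotient_map_orbit_map[of G]] by simp
  obtain b where b: "std_coords Q b = axis 4 1" using ex_std_coords[OF axis_4_hyperboloid] by blast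
  have bc: "axis 4 1 \<in> cone"
    unfolding cone_def
  proof (intro CollectI allI)
    show "0 \<le> mink (axis 4 1) (wall_normal r i)" for i
      using exhaust_4[of i] r_pos by (auto simp: mink_wall_normal) (simp_all add: axis_def)
  qed
  define U where "U n = orbit_map G ` ball b (real n)" for n
  have open_U: "openin (orbit_space G) (U n)" for n
  proof -
    have "orbit_map G -` U n = (\<Union>g\<in>G. {p. dist b (g p) < real n})"
    proof
      show "orbit_map G -` U n \<subseteq> (\<Union>g\<in>G. {p. dist b (g p) < real n})"
      proof
        fix p assume "p \<in> orbit_map G -` U n"
        then obtain q where q: "dist b q < real n" "orbit_map G p = orbit_map G q" by (auto simp: U_def)
        have "q \<in> orbit_map G q" by (rule self_in_orbit_map)
        then obtain g where "g \<in> G" "q = g p" unfolding q(2)[symmetric] by (auto simp: orbit_map_def)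
        with q show "p \<in> (\<Union>g\<in>G. {p. dist b (g p) < real n})" by blast
      qed
      show "(\<Union>g\<in>G. {p. dist b (g p) < real n}) \<subseteq> orbit_map G -` U n"
      proof
        fix p assume "p \<in> (\<Union>g\<in>G. {p. dist b (g p) < real n})"
        then obtain g where g: "g \<in> G" "g p \<in> ball b (real n)" by auto
        have "orbit_map G (g p) \<in> U n" unfolding U_def using g(2) by (rule imageI)
        then show "p \<in> orbit_map G -` U n" by (simp add: orbit_map_G g(1))
      qed
    qed
    moreover have "open {p. dist b (g p) < real n}" if "g \<in> G" for g
    proof -
      have "continuous_on UNIV g" unfolding continuous_on_iff dist_G[OF that] by blast
      then show ?thesis by (intro open_Collect_less continuous_intros)
    qed
    ultimately show ?thesis by (auto simp: openin_orbit_space U_def)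
  qed
  have cover: "topspace (orbit_space G) \<subseteq> \<Union>(range U)"
  proof
    fix y assume "y \<in> topspace (orbit_space G)"
    then obtain p where "y = orbit_map G p" unfolding top by blast
    moreover obtain n where "dist b p < real n" using reals_Archimedean2 by blast
    ultimately have "y \<in> U n" by (auto simp: U_def)
    then show "y \<in> \<Union>(range U)" by blast
  qed
  obtain F where F: "finite F" "F \<subseteq> range U" "topspace (orbit_space G) \<subseteq> \<Union>F"
    using compactinD[OF comp _ cover] open_U by auto
  then obtain I where I: "finite I" "F = U ` I" by (meson finite_subset_image)
  define R where "R = real (Max (insert 0 I))"
  obtain x where x: "x \<in> cone" "x \<in> hyperboloid" "x$4 > cosh R" using unb by blast
  obtain p where p: "std_coords Q p = x" using ex_std_coords[OF x(2)] by blast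
  have "orbit_map G p \<in> \<Union>F" using F(3) top by blast
  then obtain n q where n: "n \<in> I" "dist b q < real n" "orbit_map G p = orbit_map G q"
    unfolding I(2) by (auto simp: U_def)
  have "q \<in> orbit_map G q" by (rule self_in_orbit_map)
  then obtain g where g: "g \<in> G" "q = g p" unfolding n(3)[symmetric] by (auto simp: orbit_map_def)
  obtain w where w: "std_coords Q (g p) = word w x" using G_word[OF g(1)] p by metis
  have "n \<le> Max (insert 0 I)" using n(1) I(1) by simp
  then have "dist b q < R" using n(2) by (simp add: R_def)
  then have "cosh (dist q b) < cosh R"
    by (subst cosh_real_nonneg_less_iff) (auto simp: dist_commute R_def)
  then have "- mink (word w x) (axis 4 1) < cosh R"
    by (simp add: dist_std_coords b g(2) w)
  moreover have "mink (word w x) (axis 4 1) \<le> mink x (axis 4 1)"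
    unfolding B_word_left using x(1) bc by (rule B_word_le)
  ultimately show False using x(3) by (simp add: mink_axis_4)
qed

end

section \<open>Volume\<close>

lemma emeasure_hyp_volume:
  assumes "A \<in> sets borel"
  shows "emeasure hyp_volume A =
    (\<integral>\<^sup>+ y. ennreal (1 / sqrt (1 + (norm y)\<^sup>2)) * indicator (hyp_chart -` A) y \<partial>lborel)"
proof -
  have "hyp_chart -` A \<in> sets borel"
    using measurable_sets[OF measurable_hyp_chart assms] by simp
  then show ?thesis
    unfolding hyp_volume_def using assms
    by (subst emeasure_distr) (simp_all add: emeasure_density)
qed

lemma sets_hyp_volume [simp]: "sets hyp_volume = sets borel"
  by (simp add: hyp_volume_def)

lemma hyp_chart_vimage_borel: "A \<in> sets borel \<Longrightarrow> hyp_chart -` A \<in> sets borel"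
  using measurable_sets[OF measurable_hyp_chart, of A] by simp

lemma emeasure_hyp_volume_le:
  assumes "A \<in> sets borel"
  shows "emeasure hyp_volume A \<le> emeasure lborel (hyp_chart -` A)"
proof -
  have "emeasure hyp_volume A \<le> (\<integral>\<^sup>+ y. indicator (hyp_chart -` A) y \<partial>lborel)"
    unfolding emeasure_hyp_volume[OF assms]
  proof (rule nn_integral_mono)
    fix y :: "real^3"
    have "1 \<le> sqrt (1 + (norm y)\<^sup>2)" by (rule real_le_rsqrt) simp
    then have "1 / sqrt (1 + (norm y)\<^sup>2) \<le> 1"
      by (metis divide_le_eq_1 less_le_trans zero_less_one)
    then show "ennreal (1 / sqrt (1 + (norm y)\<^sup>2)) * indicator (hyp_chart -` A) y \<le> indicator (hyp_chart -` A) y"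
      by (auto simp: indicator_def ennreal_le_1)
  qed
  also have "\<dots> = emeasure lborel (hyp_chart -` A)"
    using hyp_chart_vimage_borel[OF assms] by simp
  finally show ?thesis .
qed

text \<open>If the time coefficient vanishes the set is a linear hyperplane of the chart. Otherwise
  every ray from the origin meets it at most once, which is the criterion of
  \<open>starlike_negligible\<close>.\<close>

lemma negligible_hyp_plane:
  assumes "\<beta> \<noteq> (0 :: real^4)"
  shows "negligible {y :: real^3. \<beta>$1 * y$1 + \<beta>$2 * y$2 + \<beta>$3 * y$3 - \<beta>$4 * sqrt (1 + (norm y)\<^sup>2) = 0}"
    (is "negligible ?S")
proof (cases "\<beta>$4 = 0")
  case True
  define b :: "real^3" where "b = vector [\<beta>$1, \<beta>$2, \<beta>$3]"
  have "b \<noteq> 0" using assms True by (auto simp: b_def vec_eq_iff forall_3 forall_4)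
  moreover have "?S = {y. b \<bullet> y = 0}"
    by (auto simp: True b_def inner_vec_def sum_3)
  ultimately show ?thesis using negligible_hyperplane[of b 0] by simp
next
  case False
  show ?thesis
  proof (rule starlike_negligible[where a = 0])
    show "closed ?S" by (intro closed_Collect_eq continuous_intros)
  next
    fix c :: real and x :: "real^3"
    assume c: "0 \<le> c" and x: "0 + x \<in> ?S" and cx: "0 + c *\<^sub>R x \<in> ?S"
    define l where "l = \<beta>$1 * x$1 + \<beta>$2 * x$2 + \<beta>$3 * x$3"
    have 1: "l = \<beta>$4 * sqrt (1 + (norm x)\<^sup>2)" using x by (simp add: l_def)
    have "c * l = \<beta>$4 * sqrt (1 + (norm (c *\<^sub>R x))\<^sup>2)" using cx by (simp add: l_def algebra_simps)
    then have "\<beta>$4 * (c * sqrt (1 + (norm x)\<^sup>2)) = \<beta>$4 * sqrt (1 + (norm (c *\<^sub>R x))\<^sup>2)"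
      unfolding 1 by (simp add: mult.left_commute)
    then have "(c * sqrt (1 + (norm x)\<^sup>2))\<^sup>2 = (sqrt (1 + (norm (c *\<^sub>R x))\<^sup>2))\<^sup>2"
      using False by simp
    moreover have "0 \<le> 1 + (norm x)\<^sup>2" "0 \<le> 1 + (norm (c *\<^sub>R x))\<^sup>2" by simp_all
    ultimately have "c\<^sup>2 * (1 + (norm x)\<^sup>2) = 1 + c\<^sup>2 * (norm x)\<^sup>2"
      by (simp add: power_mult_distrib)
    then have "c\<^sup>2 = 1" by (simp add: algebra_simps)
    with c show "c = 1" by (simp add: power2_eq_1_iff)
  qed
qed

lemma hyp_plane_null:
  assumes "\<beta> \<noteq> 0"
  shows "{p. mink (coords p) \<beta> = 0} \<in> null_sets hyp_volume"
proof -
  let ?P = "{p. mink (coords p) \<beta> = 0}"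
  let ?S = "{y :: real^3. \<beta>$1 * y$1 + \<beta>$2 * y$2 + \<beta>$3 * y$3 - \<beta>$4 * sqrt (1 + (norm y)\<^sup>2) = 0}"
  have "closed ?P"
    unfolding mink_def by (intro closed_Collect_eq continuous_intros continuous_on_coords)
  then have P: "?P \<in> sets borel" by simp
  have vim: "hyp_chart -` ?P = ?S"
    by (auto simp: mink_def coords_hyp_chart mult.commute)
  have "?S \<in> null_sets lebesgue"
    using negligible_hyp_plane[OF assms] by (simp add: negligible_iff_null_sets)
  moreover have "?S \<in> sets borel" using hyp_chart_vimage_borel[OF P] vim by simp
  ultimately have "?S \<in> null_sets lborel"
    using null_sets_completion_iff[of ?S lborel] by simp
  then have "emeasure lborel ?S = 0" by (rule null_setsD1)
  then have "emeasure hyp_volume ?P = 0"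
    using emeasure_hyp_volume_le[OF P] vim by simp
  then show ?thesis using P by (simp add: null_sets_def)
qed

text \<open>In the chart the density decays only like 1/|y|, while a ball of radius proportional to
  t at distance of order t has Euclidean volume of order t^3. So A has volume at least a constant
  times t^2 for all large t.\<close>

lemma infinite_hyp_volume:
  fixes u :: "real^3"
  assumes A: "A \<in> sets borel" and \<rho>: "\<rho> > 0"
    and cone: "\<And>t y. t \<ge> T \<Longrightarrow> dist y (t *\<^sub>R u) < t * \<rho> \<Longrightarrow> hyp_chart y \<in> A"
  shows "emeasure hyp_volume A = \<infinity>"
proof -
  define K where "K = 1 + norm u + \<rho>"
  have K: "K > 0" using \<rho> by (simp add: K_def add_pos_nonneg)
  define \<omega> where "\<omega> = unit_ball_vol (real 3)"
  have \<omega>: "\<omega> > 0" by (simp add: \<omega>_def unit_ball_vol_pos)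
  define c where "c = \<omega> * \<rho>^3 / K"
  have c: "c > 0" using \<omega> \<rho> K by (simp add: c_def)
  have lower: "ennreal (c * t\<^sup>2) \<le> emeasure hyp_volume A" if t: "t \<ge> T" "t \<ge> 1" for t
  proof -
    let ?B = "ball (t *\<^sub>R u) (t * \<rho>)"
    have "ennreal (c * t\<^sup>2) = ennreal (1 / (t * K)) * ennreal (\<omega> * (t * \<rho>)^3)"
      using t K \<omega> \<rho> by (simp add: ennreal_mult[symmetric] c_def field_simps power2_eq_square power3_eq_cube)
    also have "ennreal (\<omega> * (t * \<rho>)^3) = emeasure lborel ?B"
      using t \<rho> by (subst emeasure_ball) (simp_all add: \<omega>_def)
    also have "ennreal (1 / (t * K)) * emeasure lborel ?B = (\<integral>\<^sup>+ y. ennreal (1 / (t * K)) * indicator ?B y \<partial>lborel)"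
      by (subst nn_integral_cmult_indicator) simp_all
    also have "\<dots> \<le> emeasure hyp_volume A"
      unfolding emeasure_hyp_volume[OF A]
    proof (rule nn_integral_mono)
      fix y :: "real^3"
      show "ennreal (1 / (t * K)) * indicator ?B y \<le> ennreal (1 / sqrt (1 + (norm y)\<^sup>2)) * indicator (hyp_chart -` A) y"
      proof (cases "y \<in> ?B")
        case True
        then have d: "dist y (t *\<^sub>R u) < t * \<rho>" by (simp add: dist_commute)
        then have "norm (y - t *\<^sub>R u) < t * \<rho>" by (simp add: dist_norm)
        then have "norm y \<le> t * norm u + t * \<rho>"
          using norm_triangle_sub[of y "t *\<^sub>R u"] t by simp
        then have n: "1 + norm y \<le> t * K"
          using t by (simp add: K_def algebra_simps)
        have "sqrt (1 + (norm y)\<^sup>2) \<le> 1 + norm y"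
          by (rule real_le_lsqrt) (simp_all add: power2_eq_square algebra_simps)
        with n have "sqrt (1 + (norm y)\<^sup>2) \<le> t * K" by simp
        moreover have "0 < sqrt (1 + (norm y)\<^sup>2)" by (simp add: add_pos_nonneg)
        ultimately have "1 / (t * K) \<le> 1 / sqrt (1 + (norm y)\<^sup>2)" using t K by (intro divide_left_mono mult_pos_pos) auto
        then show ?thesis
          using cone[OF t(1) d] True by (simp add: ennreal_leI)
      qed simp
    qed
    finally show ?thesis .
  qed
  show ?thesis
  proof (rule ccontr)
    assume "emeasure hyp_volume A \<noteq> \<infinity>"
    then obtain M where M: "M \<ge> 0" "emeasure hyp_volume A = ennreal M"
      by (metis ennreal_cases infinity_ennreal_def)
    define t where "t = Max {T, 1, M / c + 1}"
    have t: "t \<ge> T" "t \<ge> 1" "t \<ge> M / c + 1" by (simp_all add: t_def)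
    have "ennreal (c * t\<^sup>2) \<le> ennreal M" using lower[OF t(1,2)] M(2) by simp
    then have "c * t\<^sup>2 \<le> M" using M(1) by simp
    moreover have "M < c * t" using t(3) c by (simp add: field_simps)
    moreover have "c * t \<le> c * t\<^sup>2"
      using t(2) c by (simp add: power2_eq_square)
    ultimately show False by simp
  qed
qed

text \<open>The chart projection does not increase distances and the density is at most 1, so a
  piece of diameter d contributes at most the volume of a Euclidean ball of radius d.\<close>

lemma finite_hyp_volume:
  fixes P :: "nat \<Rightarrow> hyp3 set"
  assumes A: "A \<in> sets borel" and cover: "A \<subseteq> (\<Union>m. P m)"
    and diam: "\<And>m p q. p \<in> P m \<Longrightarrow> q \<in> P m \<Longrightarrow> norm (coords p - coords q) \<le> d m"
    and d: "\<And>m. d m \<ge> 0" "summable (\<lambda>m. d m ^ 3)"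
  shows "emeasure hyp_volume A < \<infinity>"
proof -
  \<comment> \<open>A centre taken from the piece itself; it is arbitrary when \<open>P m\<close> is
    empty, where nothing has to be covered.\<close>
  define c where "c m = (SOME y. hyp_chart y \<in> P m)" for m
  have sub: "hyp_chart -` A \<subseteq> (\<Union>m. cball (c m) (d m))"
  proof
    fix y assume "y \<in> hyp_chart -` A"
    then obtain m where m: "hyp_chart y \<in> P m" using cover by auto
    then have "hyp_chart (c m) \<in> P m" unfolding c_def by (rule someI)
    then have "norm (coords (hyp_chart (c m)) - coords (hyp_chart y)) \<le> d m" using diam m by blast
    moreover have "(norm (c m - y))\<^sup>2 \<le> (norm (coords (hyp_chart (c m)) - coords (hyp_chart y)))\<^sup>2"
      unfolding power2_norm_eq_inner by (simp add: inner_vec_def sum_3 sum_4 coords_hyp_chart)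
    ultimately have "norm (c m - y) \<le> d m"
      by (meson norm_ge_zero order_trans power2_le_imp_le)
    then show "y \<in> (\<Union>m. cball (c m) (d m))" by (auto simp: dist_norm)
  qed
  have "emeasure hyp_volume A \<le> emeasure lborel (hyp_chart -` A)" using A by (rule emeasure_hyp_volume_le)
  also have "\<dots> \<le> emeasure lborel (\<Union>m. cball (c m) (d m))"
    using sub by (rule emeasure_mono) simp
  also have "\<dots> \<le> (\<Sum>m. emeasure lborel (cball (c m) (d m)))"
    by (rule emeasure_subadditive_countably) auto
  also have "\<dots> = (\<Sum>m. ennreal (unit_ball_vol (real 3) * d m ^ 3))"
    using d(1) by (subst emeasure_cball) simp_all
  also have "\<dots> = ennreal (\<Sum>m. unit_ball_vol (real 3) * d m ^ 3)"
    using d by (intro suminf_ennreal2 summable_mult) (auto intro!: mult_nonneg_nonneg)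
  also have "\<dots> < \<infinity>" by simp
  finally show ?thesis .
qed

section \<open>Null overlaps and the shape of the chamber at infinity\<close>

context hyp_chamber
begin

lemma borel_domain: "domain \<in> sets borel"
  using closed_domain by simp

text \<open>Appending 3 to a trivial odd word would put the reflection 3, of determinant -1, into
  \<open>std_group\<close>.\<close>

lemma odd_word_neq_id:
  assumes "odd (length w)"
  shows "word w \<noteq> id"
proof
  assume id: "word w = id"
  obtain A where A: "A \<in> std_group r" "\<And>x. A *v x = word (w @ [3]) x"
    using even_word_in_std_group[of "w @ [3]" r] assms by auto
  have Ax: "A *v x = reflect 3 x" for x using A(2)[of x] by (simp add: id)
  define R :: "real^4^4" where "R = (\<chi> i j. if i = j then (if i = 3 then -1 else 1) else 0)"
  have "A = R"
    unfolding matrix_eq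
  proof
    fix x
    have "R *v x = reflect 3 x"
      by (simp add: reflect_eq R_def vec_eq_iff forall_4 matrix_vector_mult_def sum_4)
    then show "A *v x = R *v x" by (simp only: Ax)
  qed
  have "det R = (\<Prod>i\<in>UNIV. R$i$i)"
    by (rule det_diagonal) (simp add: R_def)
  also have "\<dots> = (\<Prod>i\<in>(UNIV :: 4 set). if i = 3 then -1 else 1 :: real)"
    by (rule prod.cong) (simp_all add: R_def)
  also have "\<dots> = -1" by (simp add: prod.delta)
  finally have "det A = -1" by (simp add: \<open>A = R\<close>)
  then show False using std_group_SLorentz[OF A(1)] by (simp add: SLorentz_group_def)
qed

text \<open>A common point lies in the chamber a of the domain and in the image of the chamber b,
  which differ by the word \<open>rev a @ w @ b\<close>; so it lies on the hyperplane of a negative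
  root of that word. The word is nontrivial: it is a conjugate of w if a = b and has odd length
  otherwise.\<close>

lemma domain_overlap_null:
  assumes g: "g \<in> G" "g \<noteq> id"
  shows "emeasure hyp_volume (domain \<inter> g ` domain) = 0"
proof -
  obtain w where w: "even (length w)" "\<And>p. std_coords Q (g p) = word w (std_coords Q p)"
    using G_word[OF g(1)] by blast
  have "word w \<noteq> id" using G_eq_id_iff_word[OF w(2)] g(2) by blast
  \<comment> \<open>\<open>a\<close> and \<open>rev a\<close> cancel; they are kept so that the
    vector is visibly the image under a of a root of \<open>rev a @ w @ b\<close>. Only finitely
    many vectors arise for a given w.\<close>
  define \<beta> where "\<beta> a b i = Q *v word (a @ rev a @ w @ b) (wall_normal r i)" for a b i
  have \<beta>_nonzero: "\<beta> a b i \<noteq> 0" for a b i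
  proof
    assume "\<beta> a b i = 0"
    then have "(mink_adj Q ** Q) *v word (a @ rev a @ w @ b) (wall_normal r i) = 0"
      by (simp add: \<beta>_def matrix_vector_mul_assoc[symmetric])
    then have "word (a @ rev a @ w @ b) (wall_normal r i) = 0" by (simp only: Q_inverse[OF Q]) simp
    then have "mink (wall_normal r i) (wall_normal r i) = 0"
      using B_word[of "a @ rev a @ w @ b" "wall_normal r i" "wall_normal r i"] by (simp add: mink_zero_left)
    then show False by (simp add: B_root)
  qed
  define N where "N = (\<Union>a\<in>{[], [3]}. \<Union>b\<in>{[], [3]}. \<Union>i. {p. mink (coords p) (\<beta> a b i) = 0})"
  have "N \<in> null_sets hyp_volume"
    unfolding N_def using \<beta>_nonzero by (intro null_sets_UN' hyp_plane_null) auto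
  moreover have "domain \<inter> g ` domain \<subseteq> N"
  proof
    fix p assume p: "p \<in> domain \<inter> g ` domain"
    then obtain q where q: "q \<in> domain" "p = g q" by blast
    have "\<exists>a\<in>{[], [3]}. word (rev a) (std_coords Q p) \<in> cone" using p by (auto simp: domain_def)
    then obtain a where a: "a \<in> {[], [3]}" "word (rev a) (std_coords Q p) \<in> cone" by blast
    have "\<exists>b\<in>{[], [3]}. word (rev b) (std_coords Q q) \<in> cone" using q by (auto simp: domain_def)
    then obtain b where b: "b \<in> {[], [3]}" "word (rev b) (std_coords Q q) \<in> cone" by blast
    define z where "z = word (rev b) (std_coords Q q)"
    define u where "u = rev a @ w @ b"
    have y: "word (rev a) (std_coords Q p) = word u z"
      by (simp add: u_def z_def q(2) w(2))
    have "word u \<noteq> id"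
    proof (cases "a = b")
      case True
      show ?thesis
      proof
        assume "word u = id"
        then have "word a (word u (word (rev b) x)) = x" for x by (simp add: True)
        then have "word w x = x" for x by (simp add: u_def)
        then show False using \<open>word w \<noteq> id\<close> by auto
      qed
    next
      case False
      then have "odd (length u)" using a(1) b(1) w(1) by (auto simp: u_def)
      then show ?thesis by (rule odd_word_neq_id)
    qed
    then obtain i where i: "\<forall>p\<in>cone. mink p (word u (wall_normal r i)) \<le> 0" using ex_negative_root by blast
    have "mink (word u z) (word u (wall_normal r i)) \<le> 0" using i a(2) y by simp
    moreover have "mink (word u z) (word u (wall_normal r i)) \<ge> 0"
      using b(2) by (simp add: B_word z_def cone_def)
    ultimately have "mink (word (rev a) (std_coords Q p)) (word u (wall_normal r i)) = 0" using y by simp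
    then have "mink (std_coords Q p) (word a (word u (wall_normal r i))) = 0"
      by (simp add: B_word_left)
    then have "mink (Q *v std_coords Q p) (Q *v word a (word u (wall_normal r i))) = 0"
      using Q by (simp add: Lorentz_group_def lorentz_def)
    then have "mink (coords p) (\<beta> a b i) = 0"
      by (simp add: Q_std_coords \<beta>_def u_def)
    then show "p \<in> N" using a(1) b(1) unfolding N_def by blast
  qed
  ultimately show ?thesis
    by (metis emeasure_mono le_zero_eq null_setsD1 null_setsD2)
qed

lemma fundamental_domain_domain: "fundamental_domain G domain"
proof -
  have "(\<Union>g\<in>G. g ` domain) = UNIV"
    using domain_covers by (auto simp: image_iff)
  then show ?thesis
    by (simp add: fundamental_domain_def borel_domain domain_overlap_null)
qed

lemma in_cone_iff: "x \<in> cone \<longleftrightarrow> x$1 \<ge> x$2 \<and> x$2 \<ge> x$3 \<and> x$3 \<ge> 0 \<and> cosh (r/2) * x$1 \<le> sinh (r/2) * x$4"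
  by (simp add: cone_def forall_4 mink_wall_normal zero_le_divide_iff)

lemma cone_square_le:
  assumes "x \<in> cone"
  shows "(cosh (r/2))\<^sup>2 * (x$1)\<^sup>2 \<le> (sinh (r/2))\<^sup>2 * (x$4)\<^sup>2"
proof -
  have "0 \<le> cosh (r/2) * x$1" "cosh (r/2) * x$1 \<le> sinh (r/2) * x$4" using assms by (auto simp: in_cone_iff)
  then have "(cosh (r/2) * x$1)\<^sup>2 \<le> (sinh (r/2) * x$4)\<^sup>2" by (intro power_mono)
  then show ?thesis by (simp add: power_mult_distrib)
qed

lemma cone_le_1:
  assumes "x \<in> cone"
  shows "(x$2)\<^sup>2 \<le> (x$1)\<^sup>2" "(x$3)\<^sup>2 \<le> (x$1)\<^sup>2"
  using assms by (auto simp: in_cone_iff intro!: power_mono)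

lemma hyperboloid_time: "x \<in> hyperboloid \<Longrightarrow> (x$4)\<^sup>2 = 1 + (x$1)\<^sup>2 + (x$2)\<^sup>2 + (x$3)\<^sup>2"
  by (simp add: hyperboloid_def mink_def power2_eq_square)

text \<open>On the cone the first space coordinate is the largest, so the fourth wall gives
  \<open>(1 + s) * x1^2 \<le> s * (1 + 3 * x1^2)\<close>. For s < 1/2 this bounds x1 and with it the
  whole vector.\<close>

lemma cocompact_if:
  assumes S: "(sinh (r/2))\<^sup>2 < 1/2"
  shows "cocompact G"
proof (rule G_cocompact)
  fix x assume x: "x \<in> cone" "x \<in> hyperboloid"
  define s where "s = (sinh (r/2))\<^sup>2"
  have s: "0 \<le> s" "s < 1/2" using S by (auto simp: s_def)
  have "(1 + s) * (x$1)\<^sup>2 \<le> s * (x$4)\<^sup>2"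
    using cone_square_le[OF x(1)] by (simp add: s_def cosh_square_eq add.commute)
  also have "\<dots> \<le> s * (1 + 3 * (x$1)\<^sup>2)"
    using cone_le_1[OF x(1)] hyperboloid_time[OF x(2)] s by (intro mult_left_mono) auto
  finally have "(1 - 2 * s) * (x$1)\<^sup>2 \<le> s" by (simp add: algebra_simps)
  then have 1: "(x$1)\<^sup>2 \<le> s / (1 - 2 * s)" using s by (simp add: field_simps)
  have "(norm x)\<^sup>2 = 2 * (x$4)\<^sup>2 - 1"
    using x(2) by (simp add: norm_square_mink hyperboloid_def)
  also have "\<dots> \<le> 1 + 6 * (s / (1 - 2 * s))"
    using cone_le_1[OF x(1)] hyperboloid_time[OF x(2)] 1 by linarith
  finally show "norm x \<le> sqrt (1 + 6 * (s / (1 - 2 * s)))" by (rule real_le_rsqrt)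
qed

lemma not_cocompact_if:
  assumes S: "(sinh (r/2))\<^sup>2 = 1/2"
  shows "\<not> cocompact G"
proof (rule G_not_cocompact)
  fix R :: real
  define t where "t = \<bar>R\<bar> + 1"
  \<comment> \<open>The ray towards the vertex (1, 1, 1) of the cube. At the critical value both
    sides of the squared fourth inequality grow alike, and it holds with margin 1/2 for every
    t.\<close>
  define x :: "real^4" where "x = vector [t, t, t, sqrt (1 + 3 * t\<^sup>2)]"
  have pos: "0 < 1 + 3 * t\<^sup>2" by (simp add: add_pos_nonneg)
  have "(cosh (r/2) * t)\<^sup>2 \<le> (sinh (r/2) * sqrt (1 + 3 * t\<^sup>2))\<^sup>2"
    using pos unfolding power_mult_distrib cosh_square_eq S by simp
  then have "cosh (r/2) * t \<le> sinh (r/2) * sqrt (1 + 3 * t\<^sup>2)"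
    by (rule power2_le_imp_le) (use r_pos pos in auto)
  then have "x \<in> cone" by (simp add: in_cone_iff x_def t_def)
  moreover have "x \<in> hyperboloid"
    using pos by (simp add: hyperboloid_def mink_def x_def flip: power2_eq_square)
  moreover have "x$4 > R"
  proof -
    have "R < t" by (simp add: t_def)
    also have "t \<le> sqrt (1 + 3 * t\<^sup>2)" by (rule real_le_rsqrt) simp
    finally show ?thesis by (simp add: x_def)
  qed
  ultimately show "\<exists>x\<in>cone. x \<in> hyperboloid \<and> R < x$4" by blast
qed

text \<open>A null vector a satisfies all wall inequalities strictly. Hence the chamber contains,
  far out, an open cone of directions around the light ray of a, and such a cone has infinite
  volume.\<close>

lemma infinite_covolume_if:
  assumes S: "(sinh (r/2))\<^sup>2 > 1/2"
  shows "infinite_covolume G"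
proof -
  \<comment> \<open>\<open>\<beta>\<^sup>2\<close> is the mean of 1 and
    \<open>2 * (sinh (r/2))\<^sup>2\<close>: above 1, so that the space coordinates of a strictly
    decrease, and below the latter, so that a lies strictly inside the fourth wall.\<close>
  define \<beta> where "\<beta> = sqrt (((1::real) + 2 * (sinh (r/2))\<^sup>2) / 2)"
  have \<beta>2: "\<beta>\<^sup>2 = (1 + 2 * (sinh (r/2))\<^sup>2) / 2" using S by (simp add: \<beta>_def)
  then have "\<beta>\<^sup>2 > 1\<^sup>2" using S by simp
  then have \<beta>: "\<beta> > 1" by (rule power2_less_imp_less) (use S in \<open>simp add: \<beta>_def\<close>)
  define a :: "real^4" where "a = vector [\<beta>, (1 + \<beta>) / 2, 1, sqrt (\<beta>\<^sup>2 + ((1 + \<beta>) / 2)\<^sup>2 + 1)]"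
  have "1\<^sup>2 \<le> ((1 + \<beta>) / 2)\<^sup>2" using \<beta> by (intro power_mono) auto
  then have sum: "\<beta>\<^sup>2 + 2 \<le> \<beta>\<^sup>2 + ((1 + \<beta>) / 2)\<^sup>2 + 1" by simp
  have a4: "a$4 > 0" "(a$4)\<^sup>2 = \<beta>\<^sup>2 + ((1 + \<beta>) / 2)\<^sup>2 + 1"
    by (simp_all add: a_def add_nonneg_pos)
  have null: "mink a a = 0"
    using a4(2) by (simp add: mink_def flip: power2_eq_square) (simp add: a_def)
  have inside: "mink a (wall_normal r i) > 0" for i
  proof -
    have "(cosh (r/2) * \<beta>)\<^sup>2 = (sinh (r/2))\<^sup>2 * \<beta>\<^sup>2 + \<beta>\<^sup>2"
      by (simp add: power_mult_distrib cosh_square_eq algebra_simps)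
    also have "\<dots> < (sinh (r/2))\<^sup>2 * \<beta>\<^sup>2 + 2 * (sinh (r/2))\<^sup>2" using S \<beta>2 by simp
    also have "(sinh (r/2))\<^sup>2 * \<beta>\<^sup>2 + 2 * (sinh (r/2))\<^sup>2 = (sinh (r/2))\<^sup>2 * (\<beta>\<^sup>2 + 2)" by (simp add: algebra_simps)
    also have "\<dots> \<le> (sinh (r/2))\<^sup>2 * (a$4)\<^sup>2" unfolding a4 using sum by (intro mult_left_mono) auto
    finally have "(cosh (r/2) * \<beta>)\<^sup>2 < (sinh (r/2) * a$4)\<^sup>2" by (simp add: power_mult_distrib)
    then have "cosh (r/2) * \<beta> < sinh (r/2) * a$4"
      by (rule power2_less_imp_less) (use r_pos a4(1) in auto)
    then show ?thesis
      using exhaust_4[of i] \<beta> by (auto simp: mink_wall_normal) (simp_all add: a_def)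
  qed
  define l where "l = Q *v a"
  define n where "n i = Q *v wall_normal r i" for i
  have L: "mink (Q *v x) (Q *v y) = mink x y" for x y using Q by (simp add: Lorentz_group_def lorentz_def)
  have ln: "mink l (n i) > 0" for i using inside by (simp add: l_def n_def L)
  define u :: "real^3" where "u = vector [l$1, l$2, l$3]"
  have nu: "(norm u)\<^sup>2 = (l$1)\<^sup>2 + (l$2)\<^sup>2 + (l$3)\<^sup>2"
    unfolding power2_norm_eq_inner by (simp add: u_def inner_vec_def sum_3 power2_eq_square)
  \<comment> \<open>Q preserves the future light cone: by Cauchy-Schwarz a null vector with positive
    time coordinate has a nonpositive product with every point of the hyperboloid.\<close>
  have "l$4 \<ge> 0"
  proof -
    define h where "h = mink_adj Q *v axis 4 1"
    have hH: "h \<in> hyperboloid"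
      unfolding h_def by (intro Lorentz_group_hyperboloid Lorentz_group_adj Q axis_4_hyperboloid)
    have l4: "l$4 = - mink a h"
      using mink_matrix_adj[of Q a "axis 4 1"] by (simp add: l_def h_def mink_axis_4)
    define a' :: "real^3" where "a' = vector [a$1, a$2, a$3]"
    define h' :: "real^3" where "h' = vector [h$1, h$2, h$3]"
    have "(norm a')\<^sup>2 = (a$4)\<^sup>2"
      using null unfolding power2_norm_eq_inner by (simp add: a'_def inner_vec_def sum_3 mink_def power2_eq_square)
    then have 1: "norm a' = a$4" using a4(1) by (simp add: power2_eq_iff_nonneg)
    have "(norm h')\<^sup>2 \<le> (h$4)\<^sup>2"
      using hH unfolding power2_norm_eq_inner
      by (simp add: h'_def inner_vec_def sum_3 mink_def hyperboloid_def power2_eq_square)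
    then have 2: "norm h' \<le> h$4" by (rule power2_le_imp_le) (use hH in \<open>simp add: hyperboloid_def\<close>)
    have "a' \<bullet> h' \<le> norm a' * norm h'" by (rule norm_cauchy_schwarz)
    also have "\<dots> \<le> a$4 * h$4" unfolding 1 using 2 a4(1) by (intro mult_left_mono) auto
    finally show ?thesis
      unfolding l4 by (simp add: a'_def h'_def inner_vec_def sum_3 mink_def)
  qed
  moreover have "(l$4)\<^sup>2 = (norm u)\<^sup>2"
    using null L[of a a] unfolding nu by (simp add: l_def mink_def power2_eq_square)
  ultimately have l4: "l$4 = norm u" by (simp add: power2_eq_iff_nonneg)
  \<comment> \<open>The wall functions divided by t, with 1/t as first argument. At first argument 0
    they are the wall functions on the light cone, so positivity at \<open>(0, u)\<close> extends to
    a neighbourhood by continuity.\<close>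
  define \<phi> :: "real \<times> (real^3) \<Rightarrow> 4 \<Rightarrow> real" where
    "\<phi> z i = snd z $ 1 * n i $ 1 + snd z $ 2 * n i $ 2 + snd z $ 3 * n i $ 3
      - sqrt ((fst z)\<^sup>2 + (norm (snd z))\<^sup>2) * n i $ 4" for z i
  have "open (\<Inter>i. {z. \<phi> z i > 0})"
    unfolding \<phi>_def by (intro open_INT ballI open_Collect_less continuous_intros) simp
  moreover have "(0, u) \<in> (\<Inter>i. {z. \<phi> z i > 0})"
    using ln by (simp add: \<phi>_def mink_def l4) (simp add: u_def)
  ultimately obtain \<delta> where \<delta>: "\<delta> > 0" "\<And>z. dist z (0, u) < \<delta> \<Longrightarrow> z \<in> (\<Inter>i. {z. \<phi> z i > 0})"
    by (metis open_dist)
  have vol: "emeasure hyp_volume domain = \<infinity>"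
  proof (rule infinite_hyp_volume[OF borel_domain])
    show "\<delta> / 2 > 0" using \<delta>(1) by simp
    fix t y assume t: "2 / \<delta> + 1 \<le> t" and y: "dist y (t *\<^sub>R u) < t * (\<delta> / 2)"
    have "2 / \<delta> > 0" using \<delta>(1) by simp
    then have tpos: "t > 0" using t by linarith
    have tinv: "1 / t < \<delta> / 2"
    proof -
      have "2 / \<delta> < t" using t by simp
      then show ?thesis using tpos \<delta>(1) by (simp add: field_simps)
    qed
    define z where "z = (1 / t, (1 / t) *\<^sub>R y)"
    have "dist ((1/t) *\<^sub>R y) u = dist ((1/t) *\<^sub>R y) ((1/t) *\<^sub>R (t *\<^sub>R u))" using tpos by simp
    also have "\<dots> = dist y (t *\<^sub>R u) / t" using tpos
      by (simp only: dist_norm scaleR_diff_right[symmetric] norm_scaleR) simp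
    also have "\<dots> < \<delta> / 2" using y tpos by (simp add: pos_divide_less_eq mult.commute)
    finally have "dist ((1/t) *\<^sub>R y) u < \<delta> / 2" .
    then have "dist z (0, u) < \<delta>"
      using tinv tpos unfolding z_def dist_Pair_Pair
      by (intro le_less_trans[OF sqrt_sum_squares_le_sum_abs]) (simp add: dist_real_def)
    then have "\<phi> z i > 0" for i using \<delta>(2) by blast
    moreover have "mink (coords (hyp_chart y)) (n i) = t * \<phi> z i" for i
    proof -
      have "sqrt (1 + (norm y)\<^sup>2) = t * sqrt ((1/t)\<^sup>2 + (norm ((1/t) *\<^sub>R y))\<^sup>2)"
      proof -
        have "1 + (norm y)\<^sup>2 = t\<^sup>2 * ((1/t)\<^sup>2 + (norm ((1/t) *\<^sub>R y))\<^sup>2)"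
          using tpos by (simp add: field_simps power2_eq_square)
        then show ?thesis using tpos by (simp add: real_sqrt_mult)
      qed
      then show ?thesis
        using tpos by (simp add: mink_def coords_hyp_chart \<phi>_def z_def algebra_simps)
    qed
    ultimately have "mink (coords (hyp_chart y)) (n i) > 0" for i using tpos by simp
    then have "mink (Q *v std_coords Q (hyp_chart y)) (Q *v wall_normal r i) > 0" for i
      by (simp only: n_def Q_std_coords)
    then have "mink (std_coords Q (hyp_chart y)) (wall_normal r i) > 0" for i
      by (simp only: L)
    then show "hyp_chart y \<in> domain"
      by (auto simp: domain_def cone_def intro: less_imp_le)
  qed
  then show ?thesis
    using fundamental_domain_domain by (auto simp: infinite_covolume_def has_covolume_def)
qed

text \<open>In the cusp the space coordinates nearly agree: the fourth wall gives
  \<open>2 * x1^2 \<le> 1 + x2^2 + x3^2\<close>, which confines all three to an interval of length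
  \<open>2 / s\<close> below s, the root of \<open>m + 1\<close>. The time difference is a
  difference of squares divided by the sum of the times. The constant 24 leaves a factor 2 to
  spare.\<close>

lemma cone_strip_diam:
  assumes S: "(sinh (r/2))\<^sup>2 = 1/2"
    and x: "x \<in> cone" "x \<in> hyperboloid" "real m \<le> (x$1)\<^sup>2" "(x$1)\<^sup>2 \<le> real (Suc m)"
    and y: "y \<in> cone" "y \<in> hyperboloid" "real m \<le> (y$1)\<^sup>2" "(y$1)\<^sup>2 \<le> real (Suc m)"
  shows "norm (x - y) \<le> 24 * real (Suc m) powr (-1/2)"
proof -
  define s where "s = sqrt (real (Suc m))"
  have s: "s \<ge> 1" "s\<^sup>2 = real (Suc m)" by (simp_all add: s_def)
  have strip: "s - 2 / s \<le> z$i \<and> z$i \<le> s"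
    if z: "z \<in> cone" "z \<in> hyperboloid" "real m \<le> (z$1)\<^sup>2" "(z$1)\<^sup>2 \<le> real (Suc m)" and i: "i \<noteq> 4" for z i
  proof -
    have ord: "z$1 \<ge> z$2" "z$2 \<ge> z$3" "z$3 \<ge> 0" using z(1) by (auto simp: in_cone_iff)
    have "(3/2) * (z$1)\<^sup>2 \<le> (1/2) * (z$4)\<^sup>2"
      using cone_square_le[OF z(1)] by (simp add: cosh_square_eq S)
    then have "2 * (z$1)\<^sup>2 \<le> 1 + (z$2)\<^sup>2 + (z$3)\<^sup>2" using hyperboloid_time[OF z(2)] by simp
    moreover have "(z$2)\<^sup>2 \<le> (z$1)\<^sup>2" using cone_le_1[OF z(1)] by simp
    ultimately have 3: "(z$3)\<^sup>2 \<ge> s\<^sup>2 - 2" using z(3) s(2) by simp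
    have "z$1 \<le> s" unfolding s_def using z(4) by (rule real_le_rsqrt)
    moreover have "s - 2 / s \<le> z$3"
    proof (cases "s - 2 / s \<le> 0")
      case True
      then show ?thesis using ord by linarith
    next
      case False
      have "(s - 2 / s)\<^sup>2 = s\<^sup>2 - 4 + (2 / s)\<^sup>2" using s(1) by (simp add: power2_diff)
      also have "(2 / s)\<^sup>2 \<le> 2"
      proof -
        have "2 / s < s" using False by simp
        then have "2 < s\<^sup>2" using s(1) by (simp add: field_simps power2_eq_square)
        then show ?thesis using s(1) by (simp add: power_divide divide_le_eq)
      qed
      finally have "(s - 2 / s)\<^sup>2 \<le> (z$3)\<^sup>2" using 3 by simp
      then show ?thesis using ord(3) by (rule power2_le_imp_le)
    qed
    ultimately show ?thesis using ord i exhaust_4[of i] by auto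
  qed
  have d: "\<bar>x$i - y$i\<bar> \<le> 2 / s" if "i \<noteq> 4" for i
    using strip[OF x that] strip[OF y that] by linarith
  have xs: "0 \<le> x$1" "0 \<le> x$2" "0 \<le> x$3" "0 < x$4" "0 \<le> y$1" "0 \<le> y$2" "0 \<le> y$3" "0 < y$4"
    using x(1,2) y(1,2) by (auto simp: in_cone_iff hyperboloid_def)
  have le4: "z$i \<le> z$4" if "z \<in> hyperboloid" "i \<noteq> 4" for z i
  proof (rule power2_le_imp_le)
    show "(z$i)\<^sup>2 \<le> (z$4)\<^sup>2"
      using hyperboloid_time[OF that(1)] exhaust_4[of i] that(2) by (auto simp: add_increasing add_increasing2)
    show "0 \<le> z$4" using that(1) by (simp add: hyperboloid_def)
  qed
  have d4: "\<bar>x$4 - y$4\<bar> \<le> 6 / s"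
  proof -
    let ?t = "x$4 + y$4"
    have b: "\<bar>(x$i - y$i) * (x$i + y$i)\<bar> \<le> 2 / s * ?t" if "i \<noteq> 4" for i
    proof -
      have "\<bar>x$i + y$i\<bar> \<le> ?t"
        using le4[OF x(2) that] le4[OF y(2) that] xs that exhaust_4[of i] by auto
      then show ?thesis unfolding abs_mult using d[OF that] s(1) by (intro mult_mono) auto
    qed
    have e: "(x$4 - y$4) * ?t = (x$1 - y$1) * (x$1 + y$1) + (x$2 - y$2) * (x$2 + y$2) + (x$3 - y$3) * (x$3 + y$3)"
      using hyperboloid_time[OF x(2)] hyperboloid_time[OF y(2)]
      by (simp add: algebra_simps power2_eq_square)
    have "\<bar>(x$1 - y$1) * (x$1 + y$1)\<bar> \<le> 2 / s * ?t" "\<bar>(x$2 - y$2) * (x$2 + y$2)\<bar> \<le> 2 / s * ?t"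
      "\<bar>(x$3 - y$3) * (x$3 + y$3)\<bar> \<le> 2 / s * ?t"
      by (rule b, simp)+
    then have "\<bar>(x$4 - y$4) * ?t\<bar> \<le> 3 * (2 / s * ?t)"
      unfolding e by linarith
    then have "\<bar>x$4 - y$4\<bar> * ?t \<le> (6 / s) * ?t" using xs by (simp add: abs_mult)
    then show ?thesis using xs by (metis add_pos_pos mult_le_cancel_right_pos)
  qed
  have "norm (x - y) \<le> (\<Sum>i\<in>UNIV. norm ((x - y)$i))"
    by (rule norm_le_l1_cart[of "x - y", unfolded real_norm_def[symmetric]])
  also have "\<dots> \<le> 12 / s"
    using d[of 1] d[of 2] d[of 3] d4 by (simp add: sum_4)
  also have "\<dots> \<le> 24 * (1 / s)" using s(1) by (simp add: field_simps)
  also have "1 / s = real (Suc m) powr (-1/2)"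
    by (simp add: s_def powr_half_sqrt[symmetric] powr_minus_divide)
  finally show ?thesis .
qed

text \<open>Slices by the integer part of \<open>x1^2\<close> have diameter of order m^(-1/2), and
  the cubes m^(-3/2) are summable. The factor \<open>norm Q\<close> comes from passing between frame
  coordinates and ambient coordinates.\<close>

lemma finite_covolume_if:
  assumes S: "(sinh (r/2))\<^sup>2 = 1/2"
  shows "finite_covolume G"
proof -
  define X where "X w = {p. word w (std_coords Q p) \<in> cone}" for w
  define d where "d m = norm Q * (24 * real (Suc m) powr (-1/2))" for m
  have d3: "d m ^ 3 = (norm Q * 24)^3 * real (Suc m) powr (-3/2)" for m
    unfolding d_def by (simp add: power_mult_distrib powr_power)
  have summ: "summable (\<lambda>m. d m ^ 3)"
    unfolding d3 using summable_real_powr_iff[of "-3/2"]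
    by (intro summable_mult) (subst summable_Suc_iff, simp)
  have fin: "emeasure hyp_volume (X w) < \<infinity>" and bor: "X w \<in> sets borel" if w: "w \<in> {[], [3]}" for w
  proof -
    have norm_w: "norm (word w x - word w y) = norm (x - y)" for x y
      using w norm_reflect_3[of "x - y"] linear_diff[OF linear_reflect, of 3 x y] by auto
    have "X w = (\<Inter>i. {p. 0 \<le> mink (std_coords Q p) (word (rev w) (wall_normal r i))})"
      by (auto simp: X_def cone_def B_word_left)
    then have "closed (X w)"
      by (simp only:) (intro closed_INT ballI closed_Collect_le continuous_on_const continuous_on_mink_std_coords)
    then show bor: "X w \<in> sets borel" by simp
    define P where "P m = {p \<in> X w. real m \<le> (word w (std_coords Q p) $ 1)\<^sup>2 \<and> (word w (std_coords Q p) $ 1)\<^sup>2 \<le> real (Suc m)}" for m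
    show "emeasure hyp_volume (X w) < \<infinity>"
    proof (rule finite_hyp_volume[OF bor])
      show "X w \<subseteq> (\<Union>m. P m)"
      proof
        fix p assume p: "p \<in> X w"
        let ?v = "(word w (std_coords Q p) $ 1)\<^sup>2"
        have "real (nat \<lfloor>?v\<rfloor>) \<le> ?v" "?v \<le> real (Suc (nat \<lfloor>?v\<rfloor>))" by (simp_all add: le_of_int_ceiling) linarith
        then have "p \<in> P (nat \<lfloor>?v\<rfloor>)" using p by (simp only: P_def mem_Collect_eq simp_thms)
        then show "p \<in> (\<Union>m. P m)" by blast
      qed
    next
      fix m p q assume "p \<in> P m" "q \<in> P m"
      then have "norm (word w (std_coords Q p) - word w (std_coords Q q)) \<le> 24 * real (Suc m) powr (-1/2)"
        by (intro cone_strip_diam[OF S]) (auto simp: P_def X_def word_hyperboloid std_coords_hyperboloid)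
      then have n: "norm (std_coords Q p - std_coords Q q) \<le> 24 * real (Suc m) powr (-1/2)" by (simp only: norm_w)
      have "coords p - coords q = Q *v (std_coords Q p - std_coords Q q)"
        by (simp add: matrix_vector_mult_diff_distrib Q_std_coords)
      then show "norm (coords p - coords q) \<le> d m"
        unfolding d_def
        by (simp only:) (rule order_trans[OF norm_matrix_vector_le mult_left_mono[OF n norm_ge_zero]])
    qed (use summ in \<open>simp_all add: d_def\<close>)
  qed
  have "emeasure hyp_volume domain \<le> emeasure hyp_volume (X [] \<union> X [3])"
    using bor[of "[]"] bor[of "[3]"] by (intro emeasure_mono) (auto simp: domain_def X_def)
  also have "\<dots> \<le> emeasure hyp_volume (X []) + emeasure hyp_volume (X [3])"
    using bor by (intro emeasure_subadditive) auto
  also have "\<dots> < \<infinity>" using fin[of "[]"] fin[of "[3]"] by simp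
  finally show ?thesis
    using fundamental_domain_domain by (auto simp: finite_covolume_def has_covolume_def)
qed

end

section \<open>Angles that are not submultiples of pi\<close>

text \<open>The point p is h divided by its Minkowski length. The ratio is insensitive to scaling,
  so vectors with simple entries can be used unnormalised.\<close>

lemma timelike_ratio_eq_cosh_dist:
  assumes h: "h$4 > 0" "mink h h < 0"
  shows "\<exists>p. \<forall>A\<in>Lorentz_group. mink (A *v h) h / mink h h = cosh (dist (hyp_act A p) p)"
proof -
  define k where "k = 1 / sqrt (- mink h h)"
  have k: "k > 0" "k * k * mink h h = -1" using h by (simp_all add: k_def)
  have kh: "k *\<^sub>R h \<in> hyperboloid"
    using k h by (simp add: hyperboloid_def mink_simps mult.assoc)
  define p where "p = of_coords (k *\<^sub>R h)"
  have p: "coords p = k *\<^sub>R h" using kh by (simp add: p_def of_coords_inverse)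
  have "mink (A *v h) h / mink h h = cosh (dist (hyp_act A p) p)" if "A \<in> Lorentz_group" for A
  proof -
    have "cosh (dist (hyp_act A p) p) = - (k * k * mink (A *v h) h)"
      using that by (simp add: cosh_dist_hyp3 coords_hyp_act p mink_simps matrix_vector_mult_scaleR)
    also have "\<dots> = - (k * k * mink h h) * (mink (A *v h) h / mink h h)"
      using h by simp
    also have "\<dots> = mink (A *v h) h / mink h h"
      by (simp add: k)
    finally show ?thesis ..
  qed
  then show ?thesis by blast
qed

text \<open>Discreteness as isolation of the identity in matrix norm. The locale ends with the
  conclusion that r below \<open>r_infty\<close> must be some \<open>r_seq n\<close>.\<close>

locale discrete_std_group =
  fixes r \<epsilon> :: real
  assumes eps: "\<epsilon> > 0" and isolated: "\<And>A. A \<in> std_group r \<Longrightarrow> norm (A - mat 1) < \<epsilon> \<Longrightarrow> A = mat 1"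
begin

text \<open>\<open>mink_adj A ** B - mat 1 = mink_adj A ** (B - A)\<close>, and the adjoint has the
  norm of A; so distinct elements of norm at most K are at least \<epsilon>/K apart.\<close>

lemma finite_norm_le: "finite {A \<in> std_group r. norm A \<le> C}"
proof -
  define K where "K = \<bar>C\<bar> + 1"
  have K: "K > 0" "C \<le> K" by (auto simp: K_def)
  let ?S = "{A \<in> std_group r. norm A \<le> C}"
  have "finite (?S \<inter> cball 0 C)"
  proof (rule separated_finite_Int_compact)
    show "compact (cball (0 :: real^4^4) C)" by simp
    show "\<epsilon> / K > 0" using eps K by simp
    fix A B assume A: "A \<in> ?S" and B: "B \<in> ?S" and d: "dist A B < \<epsilon> / K"
    have inv: "mink_adj A ** A = mat 1" "A ** mink_adj A = mat 1"
      using std_group_Lorentz[of A r] A Q_inverse by blast+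
    have "mink_adj A ** B - mat 1 = mink_adj A ** (B - A)"
        using matrix_add_ldistrib[of "mink_adj A" "B - A" A] by (simp add: inv algebra_simps)
    then have "norm (mink_adj A ** B - mat 1) \<le> norm A * norm (B - A)"
      using norm_matrix_mult_le[of "mink_adj A" "B - A"] by (simp add: norm_mink_adj)
    also have "\<dots> \<le> K * dist A B"
      using A K by (intro mult_mono) (auto simp: dist_norm norm_minus_commute)
    also have "\<dots> < \<epsilon>" using d K by (simp add: field_simps)
    finally have "mink_adj A ** B = mat 1"
      using A B by (intro isolated) (auto intro: std_group.intros)
    then have "A ** (mink_adj A ** B) = A" by simp
    then show "A = B" by (simp add: matrix_mul_assoc inv)
  qed
  then show ?thesis by (rule rev_finite_subset) (auto simp: dist_norm)
qed

lemma finite_dist_le: "finite {A \<in> std_group r. dist (hyp_act A p) p \<le> R}"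
proof (rule finite_subset[OF _ finite_norm_le])
  let ?o = "of_coords (axis 4 1)"
  show "{A \<in> std_group r. dist (hyp_act A p) p \<le> R} \<subseteq> {A \<in> std_group r. norm A \<le> 2 * cosh (2 * dist ?o p + R)}"
  proof (intro subsetI CollectI conjI)
    fix A assume A: "A \<in> {A \<in> std_group r. dist (hyp_act A p) p \<le> R}"
    then show "A \<in> std_group r" by simp
    then have L: "A \<in> Lorentz_group" by (rule std_group_Lorentz)
    have "A$4$4 = coords (hyp_act A ?o) $ 4"
      using L by (simp add: coords_hyp_act of_coords_inverse axis_4_hyperboloid matrix_axis_nth)
    then have n: "norm A = 2 * cosh (dist (hyp_act A ?o) ?o)"
      using L by (simp add: norm_Lorentz_group cosh_dist_axis_4)
    have "dist (hyp_act A ?o) ?o \<le> dist (hyp_act A ?o) (hyp_act A p) + dist (hyp_act A p) p + dist p ?o"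
      using dist_triangle[of "hyp_act A ?o" ?o "hyp_act A p"] dist_triangle[of "hyp_act A p" ?o p] by linarith
    also have "\<dots> \<le> 2 * dist ?o p + R" using A by (simp add: dist_hyp_act[OF L] dist_commute)
    finally have "dist (hyp_act A ?o) ?o \<le> 2 * dist ?o p + R" .
    moreover from this have "0 \<le> 2 * dist ?o p + R" by (rule order_trans[OF zero_le_dist])
    ultimately show "norm A \<le> 2 * cosh (2 * dist ?o p + R)"
      unfolding n by (simp add: cosh_real_nonneg_le_iff)
  qed
qed

lemma finite_dist_le_vector:
  assumes "h$4 > 0" "mink h h < 0"
  shows "finite {A \<in> std_group r. mink (A *v h) h / mink h h \<le> c}"
proof -
  obtain p where p: "\<And>A. A \<in> Lorentz_group \<Longrightarrow> mink (A *v h) h / mink h h = cosh (dist (hyp_act A p) p)"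
    using timelike_ratio_eq_cosh_dist[OF assms] by blast
  show ?thesis
  proof (rule finite_subset[OF _ finite_dist_le])
    show "{A \<in> std_group r. mink (A *v h) h / mink h h \<le> c} \<subseteq> {A \<in> std_group r. dist (hyp_act A p) p \<le> arcosh (max 1 c)}"
    proof (intro subsetI CollectI conjI)
      fix A assume A: "A \<in> {A \<in> std_group r. mink (A *v h) h / mink h h \<le> c}"
      then show A': "A \<in> std_group r" by simp
      have "cosh (dist (hyp_act A p) p) \<le> cosh (arcosh (max 1 c))"
        using A p[OF std_group_Lorentz[OF A']] by (simp add: le_max_iff_disj)
      then show "dist (hyp_act A p) p \<le> arcosh (max 1 c)"
        by (subst (asm) cosh_real_nonneg_le_iff) (simp_all add: arcosh_nonneg_real)
    qed
  qed
qed

end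

text \<open>The rotation by \<open>2\<theta>\<close> in the plane spanned by two unit vectors at angle \<open>\<pi> - \<theta>\<close>.\<close>

context reflection_system
begin

lemma word_even_alternating:
  assumes c: "B (e i) (e j) = - cos \<theta>" and s: "sin \<theta> \<noteq> 0" and k: "k \<ge> 1"
  defines "X \<equiv> sin (2 * real k * \<theta>) / sin \<theta>" and "Y \<equiv> cos (2 * real k * \<theta>)"
  shows "word (alternating (2 * k) j i) (e i) = (Y + cos \<theta> * X) *\<^sub>R e i + X *\<^sub>R e j"
    and "word (alternating (2 * k) j i) (e j) = (Y - cos \<theta> * X) *\<^sub>R e j - X *\<^sub>R e i"
proof -
  have c': "B (e j) (e i) = - cos \<theta>" using c B_sym by metis
  have U0: "chebyshev_U (cos \<theta>) (2 * k) = X"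
    using chebyshev_U_cos[OF s, of "2 * k"] by (simp add: X_def)
  have U1: "chebyshev_U (cos \<theta>) (Suc (2 * k)) = Y + cos \<theta> * X"
  proof -
    have "real (Suc (2 * k)) * \<theta> = 2 * real k * \<theta> + \<theta>" by (simp add: algebra_simps)
    then show ?thesis unfolding chebyshev_U_cos[OF s] using s by (simp add: sin_add X_def Y_def field_simps)
  qed
  have U2: "chebyshev_U (cos \<theta>) (2 * k - 1) = cos \<theta> * X - Y"
  proof -
    have "real (2 * k - 1) * \<theta> = 2 * real k * \<theta> - \<theta>" using k by (simp add: algebra_simps of_nat_diff)
    then have "sin (real (2 * k - 1) * \<theta>) = sin (2 * real k * \<theta>) * cos \<theta> - cos (2 * real k * \<theta>) * sin \<theta>"
      by (simp only: sin_diff)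
    then show ?thesis unfolding chebyshev_U_cos[OF s] X_def Y_def using s by (simp only:) (simp add: field_simps)
  qed
  show "word (alternating (2 * k) j i) (e i) = (Y + cos \<theta> * X) *\<^sub>R e i + X *\<^sub>R e j"
    unfolding word_alternating_root[OF c] by (simp add: U0 U1 del: chebyshev_U.simps)
  have 2: "2 * k = Suc (2 * k - 1)" "odd (2 * k - 1)" using k by simp_all
  then have "alternating (2 * k) j i = alternating (2 * k - 1) i j @ [j]" by (metis alternating.simps(2))
  then have "word (alternating (2 * k) j i) (e j) = - word (alternating (2 * k - 1) i j) (e j)"
    using linear_neg[OF linear_word] by (simp add: reflect_root)
  also have "word (alternating (2 * k - 1) i j) (e j) = X *\<^sub>R e i + (cos \<theta> * X - Y) *\<^sub>R e j"
    unfolding word_alternating_root[OF c'] if_not_P[OF 2(2)] 2(1)[symmetric] U2 U0 ..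
  finally show "word (alternating (2 * k) j i) (e j) = (Y - cos \<theta> * X) *\<^sub>R e j - X *\<^sub>R e i"
    by (simp add: algebra_simps)
qed

text \<open>For p in the plane of the rotation only the component along p survives in the product,
  as for a Euclidean rotation by 2k\<theta>.\<close>

lemma B_even_alternating:
  assumes c: "B (e i) (e j) = - cos \<theta>" and s: "sin \<theta> \<noteq> 0" and k: "k \<ge> 1"
    and p: "p = a *\<^sub>R e i + b *\<^sub>R e j"
  shows "B p (word (alternating (2 * k) j i) p) = cos (2 * real k * \<theta>) * B p p"
proof -
  interpret w: linear "word (alternating (2 * k) j i)" by (rule linear_word)
  have c': "B (e j) (e i) = - cos \<theta>" using c B_sym by metis
  define X where "X = sin (2 * real k * \<theta>) / sin \<theta>"
  define Y where "Y = cos (2 * real k * \<theta>)"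
  note e = word_even_alternating[OF c s k, folded X_def Y_def]
  show ?thesis
    unfolding p w.add w.scaleR e B_simps c c' Y_def[symmetric]
    by (simp add: algebra_simps)
qed

lemma word_alternating_add:
  "word (alternating (2 * (k + l)) i j) x = word (alternating (2 * k) i j) (word (alternating (2 * l) i j) x)"
  using alternating_add[of "2 * k" "2 * l" i j] by (simp add: add_mult_distrib2)

end

context discrete_std_group
begin

text \<open>The powers of the product of the reflections 1 and 4 fix the point of h. Only finitely
  many group elements do so, hence two powers coincide.\<close>

lemma rotation_has_finite_order:
  assumes S: "sinh (r/2) > 0" "(sinh (r/2))\<^sup>2 < 1"
  shows "\<exists>n\<ge>1. refl.word r (alternating (2 * n) 1 4) = id"
proof -
  \<comment> \<open>Orthogonal to the normals 1 and 4, of square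
    \<open>(sinh (r/2))\<^sup>2 - 1\<close>: a point where the two mirrors meet.\<close>
  define h :: "real^4" where "h = vector [sinh (r/2), sinh (r/2), 0, cosh (r/2)]"
  have hh: "mink h h < 0" "h$4 > 0"
    using S cosh_square_eq[of "r/2"] by (simp_all add: h_def mink_def power2_eq_square)
  have orth: "mink h (wall_normal r 1) = 0" "mink h (wall_normal r 4) = 0"
    by (simp_all add: mink_wall_normal h_def)
  have fix_h: "refl.word r (alternating (2 * k) 1 4) h = h" for k
    using set_alternating[of "2 * k" "1::4" 4] orth by (intro refl.word_fixes_orthogonal) blast
  have "\<exists>A. A \<in> std_group r \<and> (\<forall>x. A *v x = refl.word r (alternating (2 * k) 1 4) x)" for k
    using even_word_in_std_group[of "alternating (2 * k) 1 4" r] by auto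
  then obtain A where A: "\<And>k. A k \<in> std_group r" "\<And>k x. A k *v x = refl.word r (alternating (2 * k) 1 4) x"
    by metis
  have "range A \<subseteq> {A \<in> std_group r. mink (A *v h) h / mink h h \<le> 1}"
    using A hh by (auto simp: fix_h)
  then have "finite (range A)" using finite_dist_le_vector[OF hh(2,1)] by (rule finite_subset)
  then have "\<not> inj A" using finite_imageD infinite_UNIV_nat by blast
  then obtain i j where ij: "i < j" "A i = A j" by (metis linorder_injI)
  define n where "n = j - i"
  have "refl.word r (alternating (2 * n) 1 4) x = x" for x
  proof -
    have "refl.word r (alternating (2 * i) 1 4) (refl.word r (alternating (2 * n) 1 4) x) = refl.word r (alternating (2 * i) 1 4) x"
      using refl.word_alternating_add[of r i n 1 4 x] A(2)[of i x] A(2)[of j x] ij by (simp add: n_def)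
    then show ?thesis by (metis refl.word_rev_word)
  qed
  then show ?thesis using ij(1) by (intro exI[of _ n]) (auto simp: n_def)
qed

lemma angle_rational:
  assumes S: "sinh (r/2) > 0" "(sinh (r/2))\<^sup>2 < 1"
    and \<theta>: "cosh (r/2) / sqrt 2 = cos \<theta>" "0 < \<theta>" "\<theta> < pi / 4"
  shows "\<exists>k m :: nat. k \<ge> 1 \<and> coprime k m \<and> 4 * k < m \<and> \<theta> = pi * real k / real m"
proof -
  obtain n where n: "n \<ge> 1" "refl.word r (alternating (2 * n) 1 4) = id"
    using rotation_has_finite_order[OF S] by blast
  have s: "sin \<theta> > 0" using \<theta> by (intro sin_gt_zero) auto
  have c: "mink (wall_normal r 4) (wall_normal r 1) = - cos \<theta>"
    using mink_wall_normals(4)[of r] \<theta>(1) by (simp add: mink_sym)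
  define X where "X = sin (2 * real n * \<theta>) / sin \<theta>"
  have e: "wall_normal r 4 = (cos (2 * real n * \<theta>) + cos \<theta> * X) *\<^sub>R wall_normal r 4 + X *\<^sub>R wall_normal r 1"
    using refl.word_even_alternating(1)[OF c _ n(1)] s n(2) by (simp add: X_def)
  \<comment> \<open>The normal 4 has second coordinate 0 and the normal 1 has fourth coordinate 0,
    so the two coefficients can be read off separately.\<close>
  have "X = 0" using arg_cong[OF e, of "\<lambda>x. x$2"] by (simp add: wall_normal_nth)
  then have "cos (2 * real n * \<theta>) = 1"
    using arg_cong[OF e, of "\<lambda>x. x$4"] S by (simp add: wall_normal_nth)
  then obtain l :: int where l: "2 * real n * \<theta> = of_int l * 2 * pi"
    using cos_one_2pi_int by blast
  then have \<theta>l: "real n * \<theta> = of_int l * pi" by simp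
  have "real n * \<theta> > 0" using n(1) \<theta>(2) by simp
  then have "l > 0" unfolding \<theta>l using pi_gt_zero by (simp add: zero_less_mult_iff)
  then obtain l' :: nat where l': "l = int l'" "l' > 0" by (metis nat_0_less_mult_iff pos_int_cases)
  define g where "g = gcd l' n"
  obtain k m where km: "l' = k * g" "n = m * g" "coprime k m"
    using gcd_coprime_exists[of l' n] l'(2) unfolding g_def by auto
  have pos: "k \<ge> 1" "m \<ge> 1" "g \<ge> 1" using km l'(2) n(1) by (auto simp: Suc_le_eq intro!: gr0I)
  have th: "\<theta> = pi * real k / real m"
    using \<theta>l pos unfolding l'(1) km(1,2) by (simp add: field_simps)
  have "pi * (real k / real m) < pi * (1/4)" using \<theta>(3) unfolding th by simp
  then have "real k / real m < 1/4" using pi_gt_zero by (simp only: mult_less_cancel_left_pos)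
  then have "4 * real k < real m" using pos by (simp add: field_simps)
  then have "4 * k < m" by linarith
  with pos km(3) th show ?thesis by blast
qed

text \<open>The rotation by \<open>2\<pi>/m\<close> contracts the distance between a translate of its axis and the axis
  itself, so no translate is closest to the axis.\<close>

lemma no_proper_fraction:
  assumes S: "sinh (r/2) > 0" "(sinh (r/2))\<^sup>2 < 1"
    and \<theta>: "cosh (r/2) / sqrt 2 = cos \<theta>" "0 < \<theta>" "\<theta> < pi / 4"
    and km: "k \<ge> 2" "coprime k m" "4 * k < m" "\<theta> = pi * real k / real m"
  shows False
proof -
  define \<sigma> where "\<sigma> = sinh (r/2)"
  define \<kappa> where "\<kappa> = cosh (r/2)"
  define s where "s = \<sigma>\<^sup>2"
  have \<sigma>: "\<sigma> > 0" and \<kappa>: "\<kappa> > 0" using S by (simp_all add: \<sigma>_def \<kappa>_def)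
  have \<kappa>2: "\<kappa>\<^sup>2 = 1 + s" by (simp add: \<kappa>_def \<sigma>_def s_def cosh_square_eq)
  have s: "0 < s" "s < 1" using S \<sigma> by (auto simp: s_def \<sigma>_def)
  have sin\<theta>: "sin \<theta> > 0" using \<theta> by (intro sin_gt_zero) auto
  have cos2: "(cos \<theta>)\<^sup>2 = (1 + s) / 2"
    unfolding \<theta>(1)[symmetric] \<kappa>_def[symmetric] by (simp add: power_divide \<kappa>2)
  have sin2: "(sin \<theta>)\<^sup>2 = (1 - s) / 2" unfolding sin_squared_eq cos2 by (simp add: field_simps)
  have m: "m \<ge> 9" using km by linarith
  \<comment> \<open>At s = 1/2 the reflections 1, 2 and 4 generate a Euclidean triangle group and
    the vectors v and w below are null. But then \<theta> = \<pi>/6, and k = 1.\<close>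
  have s12: "s \<noteq> 1/2"
  proof
    assume "s = 1/2"
    then have "(cos \<theta>)\<^sup>2 = (sqrt 3 / 2)\<^sup>2" unfolding cos2 by (simp add: power_divide)
    moreover have "cos \<theta> > 0" using \<theta> by (intro cos_gt_zero) auto
    ultimately have c6: "cos \<theta> = cos (pi / 6)" by (simp add: cos_30)
    have "\<theta> = pi / 6"
      by (rule cos_inj_pi[OF _ _ _ _ c6]) (use \<theta>(2,3) pi_gt_zero in linarith)+
    then have "real m = 6 * real k" using km m pi_gt_zero by (simp add: field_simps)
    then have "m = 6 * k" by linarith
    then have "k dvd m" by simp
    then have "k = 1" using km(2) by (metis coprime_absorb_left nat_dvd_1_iff_1)
    then show False using km(1) by simp
  qed
  \<comment> \<open>The j-th power of the rotation by 2\<theta> is the rotation by 2\<pi>/m.\<close>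
  obtain j y where jy: "k * j = m * y + 1"
    using bezout_nat[of k m] km(1,2) by auto
  have j1: "j \<ge> 1" using jy by (cases j) auto
  have jy': "real k * real j = real m * real y + 1" using jy by (metis of_nat_1 of_nat_add of_nat_mult)
  have "2 * real j * \<theta> = 2 * pi * (real k * real j) / real m" by (simp add: km(4))
  also have "\<dots> = 2 * pi / real m + 2 * real y * pi"
    unfolding jy' using m by (simp add: field_simps)
  finally have cos_j: "cos (2 * real j * \<theta>) = cos (2 * pi / real m)"
    by (simp add: cos_add)
  define q where "q = 1 - cos (2 * pi / real m)"
  have q: "q = 2 * (sin (pi / real m))\<^sup>2"
    using cos_double_sin[of "pi / real m"] by (simp add: q_def)
  have sinm: "0 < sin (pi / real m)" using m by (intro sin_gt_zero) (auto simp: field_simps)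
  then have q_pos: "q > 0" unfolding q by simp
  \<comment> \<open>The reflections 1, 2 and 4 fix w and act on the two-dimensional geometry in its
    orthogonal complement: a sphere if w is timelike (s < 1/2), a hyperbolic plane if w is
    spacelike. There v represents the vertex of the mirrors 1 and 4, the centre of the
    rotation.\<close>
  define v :: "real^4" where "v = vector [\<sigma>, \<sigma>, (1 - s) / \<sigma>, \<kappa>]"
  define w :: "real^4" where "w = vector [\<sigma>, \<sigma>, \<sigma>, \<kappa>]"
  have vv: "mink v v = (2 * s - 1) * (s - 1) / s"
  proof -
    have "mink v v = 2 * \<sigma>\<^sup>2 + ((1 - s) / \<sigma>)\<^sup>2 - \<kappa>\<^sup>2"
      by (simp add: v_def mink_def power2_eq_square)
    also have "\<dots> = 2 * s + ((1 - s) / \<sigma>)\<^sup>2 - (1 + s)"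
      by (simp only: \<kappa>2 s_def[symmetric])
    also have "((1 - s) / \<sigma>)\<^sup>2 = (1 - s)\<^sup>2 / s" by (simp add: power_divide s_def)
    finally show ?thesis using s by (simp add: field_simps power2_eq_square)
  qed
  have vv0: "mink v v \<noteq> 0" unfolding vv using s s12 by simp
  have \<sigma>s: "\<sigma> * ((1 - s) / \<sigma>) = 1 - s" using \<sigma> by simp
  have vw: "mink v w = 0"
    using \<kappa>2 \<sigma> by (simp add: v_def w_def mink_def s_def power2_eq_square)
  have ww: "mink w w = 2 * s - 1"
    using \<kappa>2 by (simp add: w_def mink_def s_def power2_eq_square)
  have v_orth: "mink v (wall_normal r 1) = 0" "mink v (wall_normal r 4) = 0"
    by (simp_all add: mink_wall_normal v_def \<sigma>_def \<kappa>_def)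
  have w_orth: "mink w (wall_normal r 1) = 0" "mink w (wall_normal r 2) = 0" "mink w (wall_normal r 4) = 0"
    by (simp_all add: mink_wall_normal w_def \<sigma>_def \<kappa>_def)
  \<comment> \<open>The cosine or hyperbolic cosine of the distance from v to its translate in that
    geometry; f is zero only if this distance is, and serves both cases.\<close>
  define cf where "cf A = mink (A *v v) v / mink v v" for A
  define f where "f A = \<bar>cf A - 1\<bar>" for A
  define St where "St = {A \<in> std_group r. A *v w = w}"
  obtain R where R: "R \<in> std_group r" "\<And>x. R *v x = refl.word r (alternating (2 * j) 1 4) x"
    using even_word_in_std_group[of "alternating (2 * j) 1 4" r] by auto
  have Rw: "R *v w = w"
    unfolding R(2) using set_alternating[of "2 * j" "1::4" 4] w_orth by (intro refl.word_fixes_orthogonal) blast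
  have Rv: "R *v v = v"
    unfolding R(2) using set_alternating[of "2 * j" "1::4" 4] v_orth by (intro refl.word_fixes_orthogonal) blast
  \<comment> \<open>The half turn about the vertex of the orthogonal mirrors 2 and 4. It supplies
    one translate of v other than v, at an explicit distance.\<close>
  obtain T where T: "T \<in> std_group r" "\<And>x. T *v x = refl.word r [4, 2] x"
    using even_word_in_std_group[of "[4, 2]" r] by auto
  have TS: "T \<in> St"
    using T w_orth refl.word_fixes_orthogonal[where w = "[4, 2]" and x = w and r = r] by (auto simp: St_def)
  have cfT: "cf T = s / (1 - s)"
  proof -
    have "refl.reflect r 4 v = v" using v_orth by (simp add: refl.reflect_def)
    then have "mink (T *v v) v = mink (refl.reflect r 2 v) v"
      using refl.B_reflect[of r 4 "refl.reflect r 2 v" v] T(2)[of v] by simp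
    also have "\<dots> = 1 - 2 * s"
      using \<kappa>2 \<sigma> by (simp add: reflect_eq v_def mink_def s_def power2_eq_square field_simps)
    finally show ?thesis
      unfolding cf_def vv using s s12 by (simp add: divide_simps) (simp add: algebra_simps)
  qed
  have fT: "f T > 0"
    unfolding f_def cfT using s s12 by (simp add: divide_simps)
  \<comment> \<open>Conjugating R by A gives the rotation by 2\<pi>/m about the pulled-back centre,
    at distance d from v. The law of cosines for an isosceles triangle, 1 - cos d' = sin^2 d (1 -
    cos (2\<pi>/m)), or its hyperbolic version, gives the new distance d'.\<close>
  have step: "\<exists>A'\<in>St. cf A' - 1 = (cf A - 1) * (cf A + 1) * q" if A: "A \<in> St" for A
  proof -
    define x where "x = A *v v"
    define c where "c = cf A"
    define p where "p = x - c *\<^sub>R v"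
    have AL: "A \<in> Lorentz_group" using A std_group_Lorentz by (auto simp: St_def)
    then have L: "mink (A *v x) (A *v y) = mink x y" for x y by (simp add: Lorentz_group_def lorentz_def)
    have xw: "mink x w = 0"
      using L[of v w] A vw by (simp add: x_def St_def)
    have xv: "mink x v = c * mink v v" using vv0 by (simp add: c_def cf_def x_def)
    have xx: "mink x x = mink v v" by (simp add: x_def L)
    have pw: "mink p w = 0" by (simp add: p_def mink_simps xw vw)
    have pv: "mink p v = 0" by (simp add: p_def mink_simps xv)
    have "\<sigma> * (mink p w - mink p v) = (2 * s - 1) * p$3"
      using \<sigma> by (simp add: mink_def v_def w_def s_def power2_eq_square field_simps)
    then have p3: "p$3 = 0" using pw pv s12 by simp
    have p4: "\<sigma> * (p$1 + p$2) = \<kappa> * p$4"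
      using pw p3 by (simp add: mink_def w_def algebra_simps)
    \<comment> \<open>Orthogonal to v and w, p lies in the plane of the normals 1 and 4, where R is
      a rotation.\<close>
    have p_eq: "p = (- p$4 / \<sigma>) *\<^sub>R wall_normal r 4 + (- sqrt 2 * p$2) *\<^sub>R wall_normal r 1"
      using p3 p4 \<sigma> by (simp add: vec_eq_iff forall_4 wall_normal_nth \<sigma>_def[symmetric] \<kappa>_def[symmetric] field_simps)
    have "mink (wall_normal r 4) (wall_normal r 1) = - cos \<theta>"
      using mink_wall_normals(4)[of r] \<theta>(1) by (simp add: mink_sym)
    then have pRp: "mink p (R *v p) = (1 - q) * mink p p"
      using refl.B_even_alternating[OF _ _ j1 p_eq] sin\<theta> by (simp add: R(2) cos_j q_def)
    have vp: "mink v p = 0" using pv by (simp add: mink_sym)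
    have pp: "mink p p = (1 - c\<^sup>2) * mink v v"
      using xx xv by (simp add: p_def mink_simps mink_sym[of v x] power2_eq_square algebra_simps)
    have RL: "R \<in> Lorentz_group" using R(1) by (rule std_group_Lorentz)
    have "mink v (R *v p) = mink (R *v v) (R *v p)" by (simp only: Rv)
    also have "\<dots> = 0" using RL vp by (simp add: Lorentz_group_def lorentz_def)
    finally have vRp: "mink v (R *v p) = 0" .
    have x: "x = c *\<^sub>R v + p" by (simp add: p_def)
    have Rx: "R *v x = c *\<^sub>R v + R *v p"
      by (simp add: x matrix_vector_right_distrib matrix_vector_mult_scaleR Rv)
    have xRx: "mink x (R *v x) = c\<^sup>2 * mink v v + (1 - q) * ((1 - c\<^sup>2) * mink v v)"
      unfolding Rx unfolding x mink_simps vRp pv pRp pp by (simp add: power2_eq_square)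
    let ?A' = "mink_adj A ** R ** A"
    have "mink (?A' *v v) v = mink x (R *v x)"
      unfolding x_def by (simp add: matrix_vector_mul_assoc[symmetric] mink_matrix_adj mink_adj_adj mink_sym)
    then have cf': "cf ?A' = c\<^sup>2 + (1 - q) * (1 - c\<^sup>2)"
      unfolding cf_def xRx using vv0 by (simp add: field_simps)
    have "mink_adj A *v w = w"
    proof -
      have "(mink_adj A ** A) *v w = mink_adj A *v w"
        using A by (simp add: St_def matrix_vector_mul_assoc[symmetric])
      then show ?thesis using Q_inverse(1)[OF AL] by simp
    qed
    then have "?A' \<in> St"
      using A R(1) Rw by (auto simp: St_def matrix_vector_mul_assoc[symmetric] intro: std_group.intros)
    moreover have "cf ?A' - 1 = (cf A - 1) * (cf A + 1) * q"
      unfolding cf' c_def[symmetric] by (simp add: power2_eq_square algebra_simps)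
    ultimately show ?thesis by blast
  qed
  \<comment> \<open>For s > 1/2 the bound from T makes the factor at most sin^2 (\<pi>/m) / sin^2
    \<theta>, below 1 because k is at least 2. For s < 1/2 the first factor is below 3, and m at
    least 9 makes q less than 1/3.\<close>
  have contract: "0 < (cf A + 1) * q \<and> (cf A + 1) * q < 1" if A: "A \<in> St" "f A \<le> f T" for A
  proof (cases "s > 1/2")
    case True
    have "mink v v < 0" unfolding vv using True s by (simp add: divide_less_0_iff mult_pos_neg)
    moreover have "v$4 > 0" using \<kappa> by (simp add: v_def)
    ultimately obtain p where "\<forall>A\<in>Lorentz_group. mink (A *v v) v / mink v v = cosh (dist (hyp_act A p) p)"
      using timelike_ratio_eq_cosh_dist by blast
    moreover have "A \<in> Lorentz_group" using A(1) by (auto simp: St_def intro: std_group_Lorentz)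
    ultimately have c1: "cf A \<ge> 1" unfolding cf_def using cosh_real_ge_1 by metis
    have "s / (1 - s) \<ge> 1" using True s by (simp add: field_simps)
    then have "cf A \<le> s / (1 - s)" using A(2) c1 unfolding f_def cfT by linarith
    then have "cf A + 1 \<le> 1 / (1 - s)" using s by (simp add: field_simps)
    then have "(cf A + 1) * q \<le> 1 / (1 - s) * q" using q_pos by (intro mult_right_mono) auto
    also have "\<dots> = (sin (pi / real m))\<^sup>2 / (sin \<theta>)\<^sup>2" unfolding q sin2 by (simp add: field_simps)
    also have "\<dots> < 1"
    proof -
      have "pi / real m < \<theta>" unfolding km(4) using km(1) m pi_gt_zero by (intro divide_strict_right_mono) auto
      then have "sin (pi / real m) < sin \<theta>" using \<theta> m pi_gt_zero
        by (intro sin_monotone_2pi) (auto intro: order_trans[of _ 0])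
      then have "(sin (pi / real m))\<^sup>2 < (sin \<theta>)\<^sup>2" using sinm by (intro power_strict_mono) auto
      then show ?thesis using sin\<theta> by simp
    qed
    finally show ?thesis using c1 q_pos by simp
  next
    case False
    have "s / (1 - s) > 0" "s / (1 - s) \<le> 1" using False s by (simp_all add: field_simps)
    then have c: "cf A > 0" "cf A < 2" using A(2) unfolding f_def cfT by linarith+
    have "sin (pi / real m) \<le> pi / real m" using pi_gt_zero by (intro sin_x_le_x) simp
    also have "\<dots> \<le> 3.2 / 9" using m pi_approx by (intro frac_le) auto
    finally have "(sin (pi / real m))\<^sup>2 \<le> (3.2 / 9)\<^sup>2" using sinm by (intro power_mono) auto
    then have "q \<le> 2 * (3.2 / 9)\<^sup>2" unfolding q by simp
    then have q3: "q < 1/3" by (simp add: power2_eq_square)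
    have "(cf A + 1) * q < 3 * q" using c q_pos by (intro mult_strict_right_mono) auto
    moreover have "0 < (cf A + 1) * q" using c q_pos by simp
    ultimately show ?thesis using q3 by linarith
  qed
  \<comment> \<open>Finiteness comes from whichever vector is timelike: v, whose displacement is
    bounded, in the hyperbolic case; w, which is fixed, in the spherical one.\<close>
  define Z where "Z = {A \<in> St. 0 < f A \<and> f A \<le> f T}"
  have "finite Z"
  proof (cases "s > 1/2")
    case True
    have "mink v v < 0" unfolding vv using True s by (simp add: divide_less_0_iff mult_pos_neg)
    moreover have "v$4 > 0" using \<kappa> by (simp add: v_def)
    ultimately have "finite {A \<in> std_group r. mink (A *v v) v / mink v v \<le> f T + 1}"
      by (intro finite_dist_le_vector)
    then show ?thesis
      by (rule rev_finite_subset) (auto simp: Z_def St_def f_def cf_def abs_le_iff)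
  next
    case False
    have "mink w w < 0" unfolding ww using False s12 by simp
    moreover have "w$4 > 0" using \<kappa> by (simp add: w_def)
    ultimately have "finite {A \<in> std_group r. mink (A *v w) w / mink w w \<le> 1}"
      by (intro finite_dist_le_vector)
    then show ?thesis
      by (rule rev_finite_subset) (auto simp: Z_def St_def)
  qed
  moreover have "T \<in> Z" using TS fT by (simp add: Z_def)
  ultimately obtain A where A: "A \<in> Z" "\<And>B. B \<in> Z \<Longrightarrow> f A \<le> f B"
    using ex_is_arg_min_if_finite[of Z f] unfolding is_arg_min_linorder by blast
  then have A': "A \<in> St" "0 < f A" "f A \<le> f T" by (auto simp: Z_def)
  obtain B where B: "B \<in> St" "cf B - 1 = (cf A - 1) * (cf A + 1) * q" using step[OF A'(1)] by blast
  have "f B = f A * ((cf A + 1) * q)"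
    unfolding f_def B(2) mult.assoc abs_mult[of "cf A - 1"]
    using contract[OF A'(1,3)] by (simp only: abs_of_pos)
  then have "0 < f B" "f B < f A" using contract[OF A'(1,3)] A'(2) by simp_all
  then have "B \<in> Z" using B(1) A'(3) by (simp add: Z_def)
  then show False using A(2) \<open>f B < f A\<close> by force
qed

text \<open>\<open>cosh r < 3\<close> gives \<open>(sinh (r/2))\<^sup>2 < 1\<close>, so the mirrors
  1 and 4 meet; \<open>cosh (r/2) > 1\<close> puts their angle below \<pi>/4. Being \<pi>/m, it has
  m at least 5.\<close>

lemma discrete_imp_r_seq:
  assumes r: "r > 0" "r < r_infty"
  shows "\<exists>n\<ge>5. r = r_seq n"
proof -
  have cr: "cosh r < 3"
  proof -
    have "cosh r < cosh (arcosh 3)"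
      using r by (subst cosh_real_nonneg_less_iff) (auto simp: r_infty_def arcosh_nonneg_real)
    then show ?thesis by simp
  qed
  have cd: "cosh r = 1 + 2 * (sinh (r/2))\<^sup>2" "(cosh (r/2))\<^sup>2 = 1 + (sinh (r/2))\<^sup>2"
    using cosh_double[of "r/2"] cosh_square_eq[of "r/2"] by simp_all
  have S: "sinh (r/2) > 0" "(sinh (r/2))\<^sup>2 < 1" using r cr cd by simp_all
  define c where "c = cosh (r/2) / sqrt 2"
  have c2: "c\<^sup>2 = (1 + (sinh (r/2))\<^sup>2) / 2" by (simp add: c_def power_divide cd)
  have c0: "c > 0" by (simp add: c_def)
  have "c\<^sup>2 < 1\<^sup>2" using c2 S by simp
  then have c1: "c < 1" by (rule power2_less_imp_less) simp
  have "(sqrt 2 / 2)\<^sup>2 < c\<^sup>2" using c2 S by (simp add: power_divide)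
  then have c3: "sqrt 2 / 2 < c" by (rule power2_less_imp_less) (use c0 in simp)
  define \<theta> where "\<theta> = arccos c"
  have cos\<theta>: "cos \<theta> = c" unfolding \<theta>_def using c0 c1 by (intro cos_arccos) auto
  have \<theta>0: "0 < \<theta>" unfolding \<theta>_def using c0 c1 arccos_lt_bounded[of c] by simp
  have "cos (pi / 4) < cos \<theta>" unfolding cos\<theta> cos_45 using c3 by simp
  moreover have "\<theta> \<le> pi" unfolding \<theta>_def using c0 c1 by (intro arccos_ubound) auto
  ultimately have \<theta>1: "\<theta> < pi / 4"
    using cos_monotone_0_pi_le[of "pi / 4" \<theta>] pi_gt_zero by fastforce
  have \<theta>c: "cosh (r/2) / sqrt 2 = cos \<theta>" by (simp add: cos\<theta> c_def)
  obtain k m where km: "k \<ge> 1" "coprime k m" "4 * k < m" "\<theta> = pi * real k / real m"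
    using angle_rational[OF S \<theta>c \<theta>0 \<theta>1] by blast
  have "k = 1"
    using no_proper_fraction[OF S \<theta>c \<theta>0 \<theta>1 _ km(2-4)] km(1) by fastforce
  then have m: "m \<ge> 5" "\<theta> = pi / real m" using km by auto
  have "cosh r = 4 * c\<^sup>2 - 1" unfolding c2 cd by (simp add: field_simps)
  also have "\<dots> = 1 + 2 * cos (2 * \<theta>)" unfolding cos_double_cos cos\<theta> by simp
  finally have "cosh r = 1 + 2 * cos (2 * pi / real m)" by (simp add: m(2))
  then have "r_seq m = arcosh (cosh r)" by (simp add: r_seq_def)
  then have "r = r_seq m" using r by (simp add: arcosh_cosh_real)
  then show ?thesis using m(1) by blast
qed

end

lemma std_group_accumulates:
  assumes "r > 0" "r < r_infty" "\<And>n. n \<ge> 5 \<Longrightarrow> r \<noteq> r_seq n" "\<epsilon> > 0"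
  shows "\<exists>A\<in>std_group r. A \<noteq> mat 1 \<and> norm (A - mat 1) < \<epsilon>"
proof (rule ccontr)
  assume "\<not> ?thesis"
  then interpret discrete_std_group r \<epsilon>
    using assms(4) by unfold_locales auto
  show False using discrete_imp_r_seq assms by blast
qed

section \<open>Density\<close>

primrec matpow :: "real^4^4 \<Rightarrow> nat \<Rightarrow> real^4^4" where
  "matpow A 0 = mat 1"
| "matpow A (Suc n) = matpow A n ** A"

lemma matrix_diff_ldistrib: "A ** (B - C) = A ** B - A ** (C :: real^4^4)"
  and matrix_diff_rdistrib: "(A - B) ** C = A ** C - B ** (C :: real^4^4)"
  and matrix_add_rdistrib: "(A + B) ** C = A ** C + B ** (C :: real^4^4)"
  by (simp_all add: matrix_matrix_mult_def vec_eq_iff algebra_simps sum.distrib sum_subtractf)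

lemma matrix_mult_scaleR: "A ** (c *\<^sub>R B) = c *\<^sub>R (A ** (B :: real^4^4))" "(c *\<^sub>R A) ** B = c *\<^sub>R (A ** B)"
  by (simp_all add: matrix_matrix_mult_def vec_eq_iff sum_distrib_left mult_ac)

lemma matpow_in_std_group: "A \<in> std_group r \<Longrightarrow> matpow A n \<in> std_group r"
  by (induction n) (auto intro: std_group.intros)

lemma norm_mult_near_id:
  fixes A M :: "real^4^4"
  assumes "norm (A - mat 1) \<le> b"
  shows "norm (M ** A) \<le> (1 + b) * norm M" "norm (A ** M) \<le> (1 + b) * norm M"
proof -
  have "M ** A = M + M ** (A - mat 1)" by (simp add: matrix_diff_ldistrib)
  then have "norm (M ** A) \<le> norm M + norm (M ** (A - mat 1))" by (metis norm_triangle_ineq)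
  also have "\<dots> \<le> norm M + norm M * b"
    using norm_matrix_mult_le[of M "A - mat 1"] mult_left_mono[OF assms norm_ge_zero[of M]] by linarith
  finally show "norm (M ** A) \<le> (1 + b) * norm M" by (simp add: algebra_simps)
  have "A ** M = M + (A - mat 1) ** M" by (simp add: matrix_diff_rdistrib)
  then have "norm (A ** M) \<le> norm M + norm ((A - mat 1) ** M)" by (metis norm_triangle_ineq)
  also have "\<dots> \<le> norm M + b * norm M"
    using norm_matrix_mult_le[of "A - mat 1" M] mult_right_mono[OF assms norm_ge_zero[of M]] by linarith
  finally show "norm (A ** M) \<le> (1 + b) * norm M" by (simp add: algebra_simps)
qed

text \<open>The binomial expansion of a power cut after the linear term. As long as n steps of size
  \<open>norm (A - mat 1)\<close> stay within 1, the error is quadratic in their total length, so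
  powers of a small element follow a straight line.\<close>

lemma norm_matpow_linear_part:
  assumes "real n * norm (A - mat 1) \<le> 1"
  shows "norm (matpow A n - mat 1 - real n *\<^sub>R (A - mat 1)) \<le> (real n * norm (A - mat 1))\<^sup>2"
  using assms
proof (induction n)
  case (Suc n)
  let ?e = "norm (A - mat 1)" and ?N = "matpow A n - mat 1 - real n *\<^sub>R (A - mat 1)"
  have ne: "real n * ?e \<le> 1" using Suc.prems by (simp add: algebra_simps) (smt (verit) norm_ge_zero)
  have "?N ** A = matpow A (Suc n) - A - real n *\<^sub>R ((A - mat 1) ** A)"
    by (simp add: matrix_diff_rdistrib matrix_mult_scaleR)
  moreover have "(A - mat 1) ** (A - mat 1) = (A - mat 1) ** A - (A - mat 1)"
    by (simp add: matrix_diff_ldistrib)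
  ultimately have "matpow A (Suc n) - mat 1 - real (Suc n) *\<^sub>R (A - mat 1) =
      ?N ** A + real n *\<^sub>R ((A - mat 1) ** (A - mat 1))"
    by (simp only:) (simp add: algebra_simps)
  also have "norm \<dots> \<le> norm (?N ** A) + real n * norm ((A - mat 1) ** (A - mat 1))"
    using norm_triangle_ineq[of "?N ** A" "real n *\<^sub>R ((A - mat 1) ** (A - mat 1))"] by simp
  also have "\<dots> \<le> (1 + ?e) * (real n * ?e)\<^sup>2 + real n * (?e * ?e)"
  proof (intro add_mono mult_left_mono norm_matrix_mult_le)
    have "norm (?N ** A) \<le> (1 + ?e) * norm ?N" by (rule norm_mult_near_id) simp
    also have "\<dots> \<le> (1 + ?e) * (real n * ?e)\<^sup>2"
      using Suc.IH[OF ne] by (intro mult_left_mono) auto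
    finally show "norm (?N ** A) \<le> (1 + ?e) * (real n * ?e)\<^sup>2" .
  qed simp
  also have "\<dots> = (real n * ?e)\<^sup>2 + (real n * ?e) * (real n * (?e * ?e)) + real n * (?e * ?e)"
    by (simp add: power2_eq_square algebra_simps)
  also have "\<dots> \<le> (real n * ?e)\<^sup>2 + 1 * (real n * (?e * ?e)) + real n * (?e * ?e)"
    using ne by (intro add_mono mult_right_mono) auto
  also have "\<dots> \<le> (real (Suc n) * ?e)\<^sup>2"
    by (simp add: power2_eq_square algebra_simps)
  finally show ?case .
qed simp

lemma norm_matpow_mult:
  fixes A M :: "real^4^4"
  assumes "norm (A - mat 1) \<le> b" "b \<ge> 0"
  shows "norm (matpow A n ** M) \<le> (1 + b)^n * norm M"
proof (induction n arbitrary: M)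
  case (Suc n)
  have "norm (matpow A (Suc n) ** M) = norm (matpow A n ** (A ** M))"
    by (simp add: matrix_mul_assoc)
  also have "\<dots> \<le> (1 + b)^n * norm (A ** M)" by (rule Suc)
  also have "\<dots> \<le> (1 + b)^n * ((1 + b) * norm M)"
    by (intro mult_left_mono[OF norm_mult_near_id(2)[OF assms(1), of M]] zero_le_power) (use assms(2) in simp)
  finally show ?case by (simp add: mult_ac)
qed simp

text \<open>Telescoping: the factors B are replaced by A one at a time, each replacement costing
  \<open>norm (A - B)\<close> times the growth of the other factors.\<close>

lemma norm_matpow_diff:
  assumes A: "norm (A - mat 1) \<le> b" and B: "norm (B - mat 1) \<le> b" and b: "b \<ge> 0"
  shows "norm (matpow A n - matpow B n) \<le> real n * (1 + b)^n * norm (A - B)"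
proof (induction n)
  case (Suc n)
  have "matpow A (Suc n) - matpow B (Suc n) = matpow A n ** (A - B) + (matpow A n - matpow B n) ** B"
    by (simp add: matrix_diff_ldistrib matrix_diff_rdistrib)
  also have "norm \<dots> \<le> norm (matpow A n ** (A - B)) + norm ((matpow A n - matpow B n) ** B)"
    by (rule norm_triangle_ineq)
  also have "\<dots> \<le> (1 + b)^n * norm (A - B) + (1 + b) * (real n * (1 + b)^n * norm (A - B))"
  proof (rule add_mono)
    show "norm (matpow A n ** (A - B)) \<le> (1 + b)^n * norm (A - B)" by (rule norm_matpow_mult[OF A b])
    have "norm ((matpow A n - matpow B n) ** B) \<le> (1 + b) * norm (matpow A n - matpow B n)"
      by (rule norm_mult_near_id(1)[OF B])
    also have "\<dots> \<le> (1 + b) * (real n * (1 + b)^n * norm (A - B))" using Suc b by (intro mult_left_mono) auto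
    finally show "norm ((matpow A n - matpow B n) ** B) \<le> (1 + b) * (real n * (1 + b)^n * norm (A - B))" .
  qed
  also have "\<dots> \<le> (1 + b)^Suc n * norm (A - B) + (1 + b) * (real n * (1 + b)^n * norm (A - B))"
    using b by (intro add_mono mult_right_mono power_increasing) auto
  also have "\<dots> = real (Suc n) * (1 + b)^Suc n * norm (A - B)" by (simp add: algebra_simps)
  finally show ?case .
qed simp

text \<open>The Lie algebra of the closure, in terms of group elements only: no closed subgroup theorem is
  needed.\<close>

definition tangent :: "real \<Rightarrow> (real^4^4) set" where
  "tangent r = {X. mink_adj X = - X \<and>
     (\<forall>\<eta>>0. \<exists>\<delta>>0. \<forall>s. 0 < s \<longrightarrow> s < \<delta> \<longrightarrow> (\<exists>h\<in>std_group r. norm (h - mat 1 - s *\<^sub>R X) \<le> \<eta> * s))}"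

lemma tangentD:
  assumes "X \<in> tangent r" "\<eta> > 0"
  obtains \<delta> where "\<delta> > 0" "\<And>s. 0 < s \<Longrightarrow> s < \<delta> \<Longrightarrow> \<exists>h\<in>std_group r. norm (h - mat 1 - s *\<^sub>R X) \<le> \<eta> * s"
  using assms unfolding tangent_def by blast

lemma tangent_adj: "X \<in> tangent r \<Longrightarrow> mink_adj X = - X"
  by (simp add: tangent_def)

lemma mink_adj_add: "mink_adj (A + B) = mink_adj A + mink_adj B"
  and mink_adj_minus: "mink_adj (- A) = - mink_adj A"
  by (simp_all add: mink_adj_def vec_eq_iff algebra_simps)

lemma tangent_uminus:
  assumes X: "X \<in> tangent r"
  shows "- X \<in> tangent r"
  unfolding tangent_def
proof (intro CollectI conjI allI impI)
  show "mink_adj (- X) = - (- X)" using tangent_adj[OF X] by (simp add: mink_adj_minus)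
  fix \<eta> :: real assume "\<eta> > 0"
  then obtain \<delta> where \<delta>: "\<delta> > 0" "\<And>s. 0 < s \<Longrightarrow> s < \<delta> \<Longrightarrow> \<exists>h\<in>std_group r. norm (h - mat 1 - s *\<^sub>R X) \<le> \<eta> * s"
    using tangentD[OF X] by blast
  have "\<exists>h\<in>std_group r. norm (h - mat 1 - s *\<^sub>R (- X)) \<le> \<eta> * s" if s: "0 < s" "s < \<delta>" for s
  proof -
    obtain h where h: "h \<in> std_group r" "norm (h - mat 1 - s *\<^sub>R X) \<le> \<eta> * s" using \<delta>(2) s by blast
    have "mink_adj h - mat 1 - s *\<^sub>R (- X) = mink_adj (h - mat 1 - s *\<^sub>R X)"
      using tangent_adj[OF X] by (simp add: mink_adj_diff mink_adj_id mink_adj_scaleR)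
    then have "norm (mink_adj h - mat 1 - s *\<^sub>R (- X)) \<le> \<eta> * s" using h(2) by (simp only: norm_mink_adj)
    then show ?thesis using h(1) std_group_adj by blast
  qed
  then show "\<exists>\<delta>>0. \<forall>s. 0 < s \<longrightarrow> s < \<delta> \<longrightarrow> (\<exists>h\<in>std_group r. norm (h - mat 1 - s *\<^sub>R (- X)) \<le> \<eta> * s)"
    using \<delta>(1) by blast
qed

lemma tangent_scaleR_pos:
  assumes X: "X \<in> tangent r" and c: "c > 0"
  shows "c *\<^sub>R X \<in> tangent r"
  unfolding tangent_def
proof (intro CollectI conjI allI impI)
  show "mink_adj (c *\<^sub>R X) = - (c *\<^sub>R X)" using tangent_adj[OF X] by (simp add: mink_adj_scaleR)
  fix \<eta> :: real assume "\<eta> > 0"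
  then have "\<eta> / c > 0" using c by simp
  then obtain \<delta> where \<delta>: "\<delta> > 0" "\<And>s. 0 < s \<Longrightarrow> s < \<delta> \<Longrightarrow> \<exists>h\<in>std_group r. norm (h - mat 1 - s *\<^sub>R X) \<le> \<eta> / c * s"
    using tangentD[OF X] by blast
  have "\<exists>h\<in>std_group r. norm (h - mat 1 - s *\<^sub>R (c *\<^sub>R X)) \<le> \<eta> * s" if "0 < s" "s < \<delta> / c" for s
    using \<delta>(2)[of "s * c"] that c by (simp add: field_simps)
  then show "\<exists>\<delta>>0. \<forall>s. 0 < s \<longrightarrow> s < \<delta> \<longrightarrow> (\<exists>h\<in>std_group r. norm (h - mat 1 - s *\<^sub>R (c *\<^sub>R X)) \<le> \<eta> * s)"
    using \<delta>(1) c by (intro exI[of _ "\<delta> / c"]) auto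
qed

lemma tangent_zero: "0 \<in> tangent r"
proof -
  have "\<exists>h\<in>std_group r. norm (h - mat 1 - s *\<^sub>R 0) \<le> \<eta> * s" if "\<eta> > 0" "s > 0" for \<eta> s :: real
    using that std_group_id by (intro bexI[of _ "mat 1"]) auto
  then show ?thesis
    unfolding tangent_def by (auto simp: mink_adj_def vec_eq_iff intro: exI[of _ 1])
qed

lemma tangent_scaleR: "X \<in> tangent r \<Longrightarrow> c *\<^sub>R X \<in> tangent r"
  using tangent_scaleR_pos[of X r c] tangent_uminus[OF tangent_scaleR_pos[of X r "- c"]] tangent_zero[of r]
  by (cases "c > 0"; cases "c = 0") auto

text \<open>\<open>g ** h - mat 1\<close> differs from the sum of \<open>g - mat 1\<close> and
  \<open>h - mat 1\<close> by their product, which is of second order in s.\<close>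

lemma tangent_add:
  assumes X: "X \<in> tangent r" and Y: "Y \<in> tangent r"
  shows "X + Y \<in> tangent r"
  unfolding tangent_def
proof (intro CollectI conjI allI impI)
  show "mink_adj (X + Y) = - (X + Y)" using tangent_adj[OF X] tangent_adj[OF Y] by (simp add: mink_adj_add)
  fix \<eta> :: real assume \<eta>: "\<eta> > 0"
  define K where "K = (norm X + 1) * (norm Y + 1)"
  have K: "K > 0" by (simp add: K_def add_nonneg_pos)
  \<comment> \<open>A quarter of the error for each factor leaves half of it for the product, which
    the choice of \<delta> secures; the cap 1 bounds the factors themselves.\<close>
  define \<eta>' where "\<eta>' = min 1 (\<eta> / 4)"
  have \<eta>': "\<eta>' > 0" "\<eta>' \<le> 1" "\<eta>' \<le> \<eta> / 4" using \<eta> by (auto simp: \<eta>'_def)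
  obtain \<delta>1 where \<delta>1: "\<delta>1 > 0" "\<And>s. 0 < s \<Longrightarrow> s < \<delta>1 \<Longrightarrow> \<exists>h\<in>std_group r. norm (h - mat 1 - s *\<^sub>R X) \<le> \<eta>' * s"
    using tangentD[OF X \<eta>'(1)] by blast
  obtain \<delta>2 where \<delta>2: "\<delta>2 > 0" "\<And>s. 0 < s \<Longrightarrow> s < \<delta>2 \<Longrightarrow> \<exists>h\<in>std_group r. norm (h - mat 1 - s *\<^sub>R Y) \<le> \<eta>' * s"
    using tangentD[OF Y \<eta>'(1)] by blast
  define \<delta> where "\<delta> = min (min \<delta>1 \<delta>2) (\<eta> / (2 * K))"
  have "\<exists>h\<in>std_group r. norm (h - mat 1 - s *\<^sub>R (X + Y)) \<le> \<eta> * s" if s: "0 < s" "s < \<delta>" for s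
  proof -
    have sd: "s < \<delta>1" "s < \<delta>2" "s * K < \<eta> / 2" using s K by (auto simp: \<delta>_def field_simps)
    obtain g where g: "g \<in> std_group r" "norm (g - mat 1 - s *\<^sub>R X) \<le> \<eta>' * s" using \<delta>1(2) s sd by blast
    obtain h where h: "h \<in> std_group r" "norm (h - mat 1 - s *\<^sub>R Y) \<le> \<eta>' * s" using \<delta>2(2) s sd by blast
    have near: "norm (f - mat 1) \<le> s * (norm Z + 1)" if "norm (f - mat 1 - s *\<^sub>R Z) \<le> \<eta>' * s" for f Z :: "real^4^4"
    proof -
      have "norm (f - mat 1) \<le> norm (f - mat 1 - s *\<^sub>R Z) + norm (s *\<^sub>R Z)"
        by (metis diff_add_cancel norm_triangle_ineq)
      also have "\<dots> \<le> 1 * s + s * norm Z"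
      proof (rule add_mono)
        have "\<eta>' * s \<le> 1 * s" using \<eta>' s by (intro mult_right_mono) auto
        then show "norm (f - mat 1 - s *\<^sub>R Z) \<le> 1 * s" using that by linarith
      qed (use s in simp)
      finally show ?thesis by (simp add: algebra_simps)
    qed
    have eq: "g ** h - mat 1 - s *\<^sub>R (X + Y) =
        (g - mat 1 - s *\<^sub>R X) + (h - mat 1 - s *\<^sub>R Y) + (g - mat 1) ** (h - mat 1)"
      by (simp add: matrix_diff_ldistrib matrix_diff_rdistrib algebra_simps)
    have "norm ((g - mat 1) ** (h - mat 1)) \<le> (s * (norm X + 1)) * (s * (norm Y + 1))"
      using near[OF g(2)] near[OF h(2)] s
      by (intro order_trans[OF norm_matrix_mult_le] mult_mono) auto
    also have "\<dots> = (s * K) * s" by (simp add: K_def)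
    also have "\<dots> \<le> \<eta> / 2 * s" using sd s by (intro mult_right_mono) auto
    finally have "norm ((g - mat 1) ** (h - mat 1)) \<le> \<eta> / 2 * s" .
    moreover have "\<eta>' * s \<le> \<eta> / 4 * s" using \<eta>' s by (intro mult_right_mono) auto
    ultimately have "norm (g - mat 1 - s *\<^sub>R X) + norm (h - mat 1 - s *\<^sub>R Y) + norm ((g - mat 1) ** (h - mat 1)) \<le> \<eta> * s"
      using g(2) h(2) by linarith
    then have "norm (g ** h - mat 1 - s *\<^sub>R (X + Y)) \<le> \<eta> * s"
      unfolding eq by (rule order_trans[OF order_trans[OF norm_triangle_ineq add_right_mono[OF norm_triangle_ineq]]])
    then show ?thesis using std_group_mult[OF g(1) h(1)] by blast
  qed
  moreover have "\<delta> > 0" using \<delta>1 \<delta>2 \<eta> K by (simp add: \<delta>_def)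
  ultimately show "\<exists>\<delta>>0. \<forall>s. 0 < s \<longrightarrow> s < \<delta> \<longrightarrow> (\<exists>h\<in>std_group r. norm (h - mat 1 - s *\<^sub>R (X + Y)) \<le> \<eta> * s)"
    by blast
qed

lemma tangent_conj:
  assumes X: "X \<in> tangent r" and A: "A \<in> std_group r"
  shows "A ** X ** mink_adj A \<in> tangent r"
  unfolding tangent_def
proof (intro CollectI conjI allI impI)
  show "mink_adj (A ** X ** mink_adj A) = - (A ** X ** mink_adj A)"
  proof -
    have "mink_adj (A ** X ** mink_adj A) = A ** (- X) ** mink_adj A"
      using tangent_adj[OF X] by (simp add: mink_adj_mult mink_adj_adj matrix_mul_assoc)
    also have "A ** (- X) = - (A ** X)" using matrix_diff_ldistrib[of A 0 X] by simp
    also have "(- (A ** X)) ** mink_adj A = - (A ** X ** mink_adj A)"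
      using matrix_diff_rdistrib[of 0 "A ** X" "mink_adj A"] by simp
    finally show ?thesis .
  qed
  have inv: "A ** mink_adj A = mat 1" using Q_inverse(2) std_group_Lorentz[OF A] .
  fix \<eta> :: real assume \<eta>: "\<eta> > 0"
  define K where "K = (norm A)\<^sup>2 + 1"
  have K: "K > 0" "(norm A)\<^sup>2 \<le> K" by (simp_all add: K_def add_nonneg_pos)
  have "\<eta> / K > 0" using \<eta> K by simp
  then obtain \<delta> where \<delta>: "\<delta> > 0" "\<And>s. 0 < s \<Longrightarrow> s < \<delta> \<Longrightarrow> \<exists>h\<in>std_group r. norm (h - mat 1 - s *\<^sub>R X) \<le> \<eta> / K * s"
    using tangentD[OF X] by blast
  have "\<exists>h\<in>std_group r. norm (h - mat 1 - s *\<^sub>R (A ** X ** mink_adj A)) \<le> \<eta> * s" if s: "0 < s" "s < \<delta>" for s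
  proof -
    obtain h where h: "h \<in> std_group r" "norm (h - mat 1 - s *\<^sub>R X) \<le> \<eta> / K * s" using \<delta>(2) s by blast
    have "A ** h ** mink_adj A - mat 1 - s *\<^sub>R (A ** X ** mink_adj A) = A ** (h - mat 1 - s *\<^sub>R X) ** mink_adj A"
      by (simp add: matrix_diff_ldistrib matrix_diff_rdistrib matrix_mult_scaleR inv)
    then have "norm (A ** h ** mink_adj A - mat 1 - s *\<^sub>R (A ** X ** mink_adj A)) \<le> norm (A ** (h - mat 1 - s *\<^sub>R X)) * norm A"
      using norm_matrix_mult_le[of "A ** (h - mat 1 - s *\<^sub>R X)" "mink_adj A"] by (simp add: norm_mink_adj)
    also have "\<dots> \<le> norm A * norm (h - mat 1 - s *\<^sub>R X) * norm A"
      by (intro mult_right_mono norm_matrix_mult_le) simp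
    also have "\<dots> = (norm A)\<^sup>2 * norm (h - mat 1 - s *\<^sub>R X)" by (simp add: power2_eq_square)
    also have "\<dots> \<le> K * (\<eta> / K * s)" using h(2) K by (intro mult_mono) auto
    finally have "norm (A ** h ** mink_adj A - mat 1 - s *\<^sub>R (A ** X ** mink_adj A)) \<le> \<eta> * s" using K by simp
    moreover have "A ** h ** mink_adj A \<in> std_group r" using A h(1) by (intro std_group.intros)
    ultimately show ?thesis by blast
  qed
  then show "\<exists>\<delta>>0. \<forall>s. 0 < s \<longrightarrow> s < \<delta> \<longrightarrow> (\<exists>h\<in>std_group r. norm (h - mat 1 - s *\<^sub>R (A ** X ** mink_adj A)) \<le> \<eta> * s)"
    using \<delta>(1) by blast
qed

text \<open>The unit directions of elements tending to the identity accumulate at some X. Given s,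
  an element \<open>A k\<close> with \<open>e k\<close> small compared with s is raised to the power
  \<open>s / e k\<close> rounded down, which comes close to
  \<open>mat 1 + s *\<^sub>R X\<close>.\<close>

lemma ex_nonzero_tangent:
  assumes acc: "\<And>\<epsilon>. \<epsilon> > 0 \<Longrightarrow> \<exists>A\<in>std_group r. A \<noteq> mat 1 \<and> norm (A - mat 1) < \<epsilon>"
  shows "\<exists>X\<in>tangent r. X \<noteq> 0"
proof -
  have "\<exists>A. A \<in> std_group r \<and> A \<noteq> mat 1 \<and> norm (A - mat 1) < inverse (real (Suc n))" for n
    using acc[of "inverse (real (Suc n))"] by auto
  then obtain A where A: "\<And>n. A n \<in> std_group r" "\<And>n. A n \<noteq> mat 1" "\<And>n. norm (A n - mat 1) < inverse (real (Suc n))"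
    by metis
  define e where "e n = norm (A n - mat 1)" for n
  define Z where "Z n = (1 / e n) *\<^sub>R (A n - mat 1)" for n
  have e0: "e n > 0" for n using A(2) by (simp add: e_def)
  have Z1: "norm (Z n) = 1" for n using e0[of n] by (simp add: Z_def e_def)
  have eZ: "A n - mat 1 = e n *\<^sub>R Z n" for n using e0[of n] by (simp add: Z_def)
  have "Z n \<in> sphere 0 1" for n by (simp add: Z1)
  then obtain X \<phi> where X: "X \<in> sphere 0 1" "strict_mono \<phi>" "(Z \<circ> \<phi>) \<longlonglongrightarrow> X"
    using compact_sphere[of "0 :: real^4^4" 1] unfolding compact_def by metis
  have small: "\<exists>n. e n < a \<and> norm (Z n - X) < b" if "a > 0" "b > 0" for a b
  proof -
    have "(\<lambda>n. inverse (real (Suc (\<phi> n)))) \<longlonglongrightarrow> 0"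
      using LIMSEQ_subseq_LIMSEQ[OF LIMSEQ_inverse_real_of_nat X(2)] by (simp add: o_def)
    then have "eventually (\<lambda>n. inverse (real (Suc (\<phi> n))) < a) sequentially"
      using that(1) by (rule order_tendstoD)
    moreover have "eventually (\<lambda>n. dist ((Z \<circ> \<phi>) n) X < b) sequentially"
      using X(3) that(2) by (rule tendstoD)
    ultimately have "eventually (\<lambda>n. inverse (real (Suc (\<phi> n))) < a \<and> dist ((Z \<circ> \<phi>) n) X < b) sequentially"
      by (rule eventually_conj)
    then obtain n where n: "inverse (real (Suc (\<phi> n))) < a" "dist ((Z \<circ> \<phi>) n) X < b"
      using eventually_happens'[OF sequentially_bot] by blast
    then show ?thesis
      using A(3)[of "\<phi> n"] by (intro exI[of _ "\<phi> n"]) (auto simp: e_def dist_norm)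
  qed
  \<comment> \<open>The Lorentz condition to first order: the direction is antisymmetric for the
    form up to an error \<open>e n\<close>, and its limit exactly so.\<close>
  have Zadj: "norm (mink_adj (Z n) + Z n) \<le> e n" for n
  proof -
    have "mink_adj (A n) ** A n = mat 1"
      using Q_inverse(1) std_group_Lorentz[OF A(1)] .
    moreover have "A n = mat 1 + e n *\<^sub>R Z n" using eZ[of n] by (simp add: algebra_simps)
    ultimately have "(mat 1 + e n *\<^sub>R mink_adj (Z n)) ** (mat 1 + e n *\<^sub>R Z n) = mat 1"
      by (simp add: mink_adj_add mink_adj_scaleR mink_adj_id)
    then have "e n *\<^sub>R (mink_adj (Z n) + Z n + e n *\<^sub>R (mink_adj (Z n) ** Z n)) = 0"
      by (simp add: matrix_add_ldistrib matrix_add_rdistrib matrix_mult_scaleR algebra_simps)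
    then have "mink_adj (Z n) + Z n + e n *\<^sub>R (mink_adj (Z n) ** Z n) = 0" using e0[of n] by simp
    then have "mink_adj (Z n) + Z n = - (e n *\<^sub>R (mink_adj (Z n) ** Z n))" by (simp add: eq_neg_iff_add_eq_0)
    then have "norm (mink_adj (Z n) + Z n) = e n * norm (mink_adj (Z n) ** Z n)" using e0[of n] by simp
    also have "\<dots> \<le> e n * 1"
      using norm_matrix_mult_le[of "mink_adj (Z n)" "Z n"] e0[of n]
      by (intro mult_left_mono) (simp_all add: norm_mink_adj Z1)
    finally show ?thesis by simp
  qed
  have "norm (mink_adj X + X) \<le> 0"
  proof (rule field_le_epsilon)
    fix d :: real assume d: "d > 0"
    obtain n where n: "e n < d / 3" "norm (Z n - X) < d / 3" using small[of "d/3" "d/3"] d by auto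
    have "mink_adj X + X = (mink_adj (Z n) + Z n) - mink_adj (Z n - X) - (Z n - X)"
      by (simp add: mink_adj_diff)
    also have "norm \<dots> \<le> norm (mink_adj (Z n) + Z n) + norm (mink_adj (Z n - X)) + norm (Z n - X)"
      by (rule order_trans[OF norm_triangle_ineq4 add_right_mono[OF norm_triangle_ineq4]])
    also have "\<dots> \<le> d / 3 + d / 3 + d / 3"
      using Zadj[of n] n by (intro add_mono) (simp_all add: norm_mink_adj)
    finally show "norm (mink_adj X + X) \<le> 0 + d" by simp
  qed
  then have Xadj: "mink_adj X = - X" by (simp add: eq_neg_iff_add_eq_0)
  have X1: "norm X = 1" using X(1) by simp
  have "X \<in> tangent r"
    unfolding tangent_def
  proof (intro CollectI conjI allI impI)
    show "mink_adj X = - X" by (rule Xadj)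
    fix \<eta> :: real assume \<eta>: "\<eta> > 0"
    define \<delta> where "\<delta> = min 1 (\<eta> / 3)"
    have "\<exists>h\<in>std_group r. norm (h - mat 1 - s *\<^sub>R X) \<le> \<eta> * s" if s: "0 < s" "s < \<delta>" for s
    proof -
      have s1: "s \<le> 1" "s \<le> \<eta> / 3" using s by (auto simp: \<delta>_def)
      obtain k where k: "e k < \<eta> * s / 3" "norm (Z k - X) < \<eta> / 3"
        using small[of "\<eta> * s / 3" "\<eta> / 3"] \<eta> s by auto
      define n where "n = nat \<lfloor>s / e k\<rfloor>"
      have q0: "s / e k \<ge> 0" using s e0[of k] by simp
      then have "real n \<le> s / e k" "s / e k \<le> real n + 1" unfolding n_def by linarith+
      then have ne: "real n * e k \<le> s" "s - real n * e k \<le> e k" using e0[of k] by (simp_all add: field_simps)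
      let ?h = "matpow (A k) n"
      have p: "norm (?h - mat 1 - real n *\<^sub>R (A k - mat 1)) \<le> (real n * e k)\<^sup>2"
        using norm_matpow_linear_part[of n "A k"] ne s1 by (simp add: e_def)
      also have "\<dots> \<le> s\<^sup>2" using ne e0[of k] by (intro power_mono) auto
      also have "\<dots> \<le> \<eta> / 3 * s" using s1 s by (simp add: power2_eq_square mult_right_mono)
      finally have 1: "norm (?h - mat 1 - real n *\<^sub>R (A k - mat 1)) \<le> \<eta> / 3 * s" .
      have 2: "norm ((real n * e k) *\<^sub>R (Z k - X)) \<le> s * (\<eta> / 3)"
        using ne k e0[of k] s by (simp only: norm_scaleR) (intro mult_mono, auto)
      have 3: "norm ((real n * e k - s) *\<^sub>R X) \<le> \<eta> * s / 3"
        using ne k X1 by simp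
      have "?h - mat 1 - s *\<^sub>R X = (?h - mat 1 - real n *\<^sub>R (A k - mat 1)) + (real n * e k) *\<^sub>R (Z k - X) + (real n * e k - s) *\<^sub>R X"
        unfolding eZ by (simp add: algebra_simps)
      also have "norm \<dots> \<le> norm (?h - mat 1 - real n *\<^sub>R (A k - mat 1)) + norm ((real n * e k) *\<^sub>R (Z k - X)) + norm ((real n * e k - s) *\<^sub>R X)"
        by (rule order_trans[OF norm_triangle_ineq add_right_mono[OF norm_triangle_ineq]])
      also have "\<dots> \<le> \<eta> * s" using 1 2 3 by (simp add: mult.commute)
      finally show ?thesis using matpow_in_std_group[OF A(1)] by blast
    qed
    moreover have "\<delta> > 0" using \<eta> by (simp add: \<delta>_def)
    ultimately show "\<exists>\<delta>>0. \<forall>s. 0 < s \<longrightarrow> s < \<delta> \<longrightarrow> (\<exists>h\<in>std_group r. norm (h - mat 1 - s *\<^sub>R X) \<le> \<eta> * s)" by blast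
  qed
  moreover have "X \<noteq> 0" using X1 by auto
  ultimately show ?thesis by blast
qed

section \<open>Subspaces of so(3,1) invariant under the group\<close>

text \<open>The first three parameters are infinitesimal rotations about the axes, the last three
  infinitesimal boosts along them.\<close>

definition lie :: "real \<Rightarrow> real \<Rightarrow> real \<Rightarrow> real \<Rightarrow> real \<Rightarrow> real \<Rightarrow> real^4^4" where
  "lie a1 a2 a3 b1 b2 b3 = vector [vector [0, - a3, a2, b1], vector [a3, 0, - a1, b2],
     vector [- a2, a1, 0, b3], vector [b1, b2, b3, 0]]"

lemma lie_add: "lie a1 a2 a3 b1 b2 b3 + lie c1 c2 c3 d1 d2 d3 = lie (a1 + c1) (a2 + c2) (a3 + c3) (b1 + d1) (b2 + d2) (b3 + d3)"
  and lie_scaleR: "c *\<^sub>R lie a1 a2 a3 b1 b2 b3 = lie (c * a1) (c * a2) (c * a3) (c * b1) (c * b2) (c * b3)"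
  by (simp_all add: lie_def vec_eq_iff forall_4)

lemma ex_lie:
  assumes "mink_adj X = - X"
  shows "\<exists>a1 a2 a3 b1 b2 b3. X = lie a1 a2 a3 b1 b2 b3"
proof -
  have *: "mink_sign i * mink_sign j * X$j$i = - X$i$j" for i j
    using arg_cong[OF assms, of "\<lambda>Y. Y$i$j"] by (simp add: mink_adj_def)
  have "X = lie (X$3$2) (X$1$3) (X$2$1) (X$1$4) (X$2$4) (X$3$4)"
    using *[of 1 1] *[of 2 2] *[of 3 3] *[of 4 4] *[of 1 2] *[of 1 3] *[of 2 3] *[of 1 4] *[of 2 4] *[of 3 4]
    by (simp add: lie_def vec_eq_iff forall_4 mink_sign_def)
  then show ?thesis by blast
qed

lemma conj_lie_quarters:
  "quarter12 ** lie a1 a2 a3 b1 b2 b3 ** mink_adj quarter12 = lie (- a2) a1 a3 (- b2) b1 b3"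
  "quarter23 ** lie a1 a2 a3 b1 b2 b3 ** mink_adj quarter23 = lie a1 (- a3) a2 b1 (- b3) b2"
  "quarter31 ** lie a1 a2 a3 b1 b2 b3 ** mink_adj quarter31 = lie a3 a2 (- a1) b3 b2 (- b1)"
  by (simp_all add: quarter12_def quarter23_def quarter31_def lie_def vec_eq_iff forall_4
      matrix_matrix_mult_def sum_4 mink_adj_def mink_sign_def)

lemma conj_lie_boost:
  "boost r ** lie 0 a 0 0 b 0 ** mink_adj (boost r) = lie 0 (cosh r * a) (- sinh r * b) 0 (cosh r * b) (sinh r * a)"
  by (simp add: boost_def lie_def vec_eq_iff forall_4 matrix_matrix_mult_def sum_4 mink_adj_def
      mink_sign_def)

text \<open>Half turns isolate the part of X along one axis, a rotation p and a boost q, and quarter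
  turns move it to other axes. Conjugation by the boost produces the pair (-q, p) on the third axis,
  that is p + iq multiplied by i. As p + iq is nonzero, real combinations of the two pairs give the
  pure rotation and the pure boost.\<close>

lemma tangent_generators:
  assumes r: "r > 0" and X: "X \<in> tangent r" "X \<noteq> 0"
  shows "lie 0 0 1 0 0 0 \<in> tangent r" "lie 1 0 0 0 0 0 \<in> tangent r" "lie 0 0 0 1 0 0 \<in> tangent r"
proof -
  obtain a1 a2 a3 b1 b2 b3 where Xl: "X = lie a1 a2 a3 b1 b2 b3" using ex_lie tangent_adj[OF X(1)] by blast
  have c12: "lie (- a2) a1 a3 (- b2) b1 b3 \<in> tangent r" if "lie a1 a2 a3 b1 b2 b3 \<in> tangent r" for a1 a2 a3 b1 b2 b3
    using tangent_conj[OF that std_group_quarter12] by (simp only: conj_lie_quarters)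
  have c23: "lie a1 (- a3) a2 b1 (- b3) b2 \<in> tangent r" if "lie a1 a2 a3 b1 b2 b3 \<in> tangent r" for a1 a2 a3 b1 b2 b3
    using tangent_conj[OF that std_group_quarter23] by (simp only: conj_lie_quarters)
  have c31: "lie a3 a2 (- a1) b3 b2 (- b1) \<in> tangent r" if "lie a1 a2 a3 b1 b2 b3 \<in> tangent r" for a1 a2 a3 b1 b2 b3
    using tangent_conj[OF that std_group_quarter31] by (simp only: conj_lie_quarters)
  have Xt: "lie a1 a2 a3 b1 b2 b3 \<in> tangent r" using X(1) Xl by simp
  have add: "lie (a1 + c1) (a2 + c2) (a3 + c3) (b1 + d1) (b2 + d2) (b3 + d3) \<in> tangent r"
    if "lie a1 a2 a3 b1 b2 b3 \<in> tangent r" "lie c1 c2 c3 d1 d2 d3 \<in> tangent r" for a1 a2 a3 b1 b2 b3 c1 c2 c3 d1 d2 d3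
    using tangent_add[OF that] by (simp only: lie_add)
  have scale: "lie (c * a1) (c * a2) (c * a3) (c * b1) (c * b2) (c * b3) \<in> tangent r"
    if "lie a1 a2 a3 b1 b2 b3 \<in> tangent r" for c a1 a2 a3 b1 b2 b3
    using tangent_scaleR[OF that, of c] by (simp only: lie_scaleR)
  have 1: "lie (2 * a1) 0 0 (2 * b1) 0 0 \<in> tangent r" using add[OF Xt c23[OF c23[OF Xt]]] by simp
  have 2: "lie 0 (2 * a2) 0 0 (2 * b2) 0 \<in> tangent r" using add[OF Xt c31[OF c31[OF Xt]]] by simp
  have 3: "lie 0 0 (2 * a3) 0 0 (2 * b3) \<in> tangent r" using add[OF Xt c12[OF c12[OF Xt]]] by simp
  have "(a1, b1) \<noteq> (0, 0) \<or> (a2, b2) \<noteq> (0, 0) \<or> (a3, b3) \<noteq> (0, 0)"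
  proof (rule ccontr)
    assume "\<not> ?thesis"
    then have "X = lie 0 0 0 0 0 0" unfolding Xl by simp
    also have "\<dots> = 0" by (simp add: lie_def vec_eq_iff forall_4)
    finally show False using X(2) by simp
  qed
  then obtain p q where pq: "lie 0 p 0 0 q 0 \<in> tangent r" "(p, q) \<noteq> (0, 0)"
  proof (elim disjE)
    assume "(a1, b1) \<noteq> (0, 0)"
    then show ?thesis using c12[OF 1] by (intro that[of "2 * a1" "2 * b1"]) auto
  next
    assume "(a2, b2) \<noteq> (0, 0)"
    then show ?thesis using 2 by (intro that[of "2 * a2" "2 * b2"]) auto
  next
    assume "(a3, b3) \<noteq> (0, 0)"
    then show ?thesis using c23[OF 3] by (intro that[of "- (2 * a3)" "- (2 * b3)"]) auto
  qed
  have P: "lie 0 0 p 0 0 q \<in> tangent r" using c23[OF pq(1)] by simp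
  have "lie 0 (cosh r * p) (- sinh r * q) 0 (cosh r * q) (sinh r * p) \<in> tangent r"
    using tangent_conj[OF pq(1) std_group_boost] by (simp only: conj_lie_boost)
  from add[OF this scale[OF pq(1), of "- cosh r"]]
  have "lie 0 0 (- sinh r * q) 0 0 (sinh r * p) \<in> tangent r" by simp
  from scale[OF this, of "1 / sinh r"] r
  have J: "lie 0 0 (- q) 0 0 p \<in> tangent r" by simp
  define n where "n = p * p + q * q"
  have n: "n \<noteq> 0" using pq(2) by (auto simp: n_def sum_squares_eq_zero_iff)
  have "lie 0 0 n 0 0 0 \<in> tangent r"
    using add[OF scale[OF P, of p] scale[OF J, of "- q"]] by (simp add: n_def algebra_simps)
  from scale[OF this, of "1 / n"] n
  show E3: "lie 0 0 1 0 0 0 \<in> tangent r" by simp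
  have "lie 0 0 0 0 0 n \<in> tangent r"
    using add[OF scale[OF P, of q] scale[OF J, of p]] by (simp add: n_def algebra_simps)
  from scale[OF this, of "1 / n"] n
  have B3: "lie 0 0 0 0 0 1 \<in> tangent r" by simp
  show "lie 1 0 0 0 0 0 \<in> tangent r" using c31[OF E3] by simp
  show "lie 0 0 0 1 0 0 \<in> tangent r" using c31[OF B3] by simp
qed

section \<open>One-parameter groups in the closure\<close>

text \<open>E t is the k-th power of E u with u = t/k, and a group element within
  \<open>2 * \<eta> * u\<close> of E u has its k-th power within \<open>2 * \<eta> * t * K\<close>
  of E t. The factor K bounds the growth of the powers for every k.\<close>

lemma one_parameter_in_closure_pos:
  assumes add: "\<And>s t. E (s + t) = E s ** E t" and E0: "E 0 = mat 1"
    and D: "(E has_vector_derivative X) (at 0)" and X: "X \<in> tangent r" and t: "t > 0"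
  shows "E t \<in> closure (std_group r)"
  unfolding closure_approachable
proof (intro allI impI)
  fix \<epsilon> :: real assume \<epsilon>: "\<epsilon> > 0"
  define \<beta> where "\<beta> = norm X + 1"
  define K where "K = exp (t * \<beta>)"
  define \<eta> where "\<eta> = min 1 (\<epsilon> / (4 * t * K))"
  have K: "K > 0" by (simp add: K_def)
  have \<eta>: "\<eta> > 0" "\<eta> \<le> 1" "\<eta> \<le> \<epsilon> / (4 * t * K)" using \<epsilon> t K by (auto simp: \<eta>_def)
  obtain \<delta>1 where \<delta>1: "\<delta>1 > 0" "\<And>y. norm (y - 0) < \<delta>1 \<Longrightarrow> norm (E y - E 0 - (y - 0) *\<^sub>R X) \<le> \<eta> * norm (y - 0)"
    using D \<eta>(1) unfolding has_vector_derivative_def has_derivative_at_alt by blast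
  obtain \<delta>2 where \<delta>2: "\<delta>2 > 0" "\<And>s. 0 < s \<Longrightarrow> s < \<delta>2 \<Longrightarrow> \<exists>h\<in>std_group r. norm (h - mat 1 - s *\<^sub>R X) \<le> \<eta> * s"
    using tangentD[OF X \<eta>(1)] by blast
  obtain k :: nat where k: "t / min \<delta>1 \<delta>2 < real k" using reals_Archimedean2 by blast
  have d: "min \<delta>1 \<delta>2 > 0" using \<delta>1 \<delta>2 by simp
  then have "0 < t / min \<delta>1 \<delta>2" using t by simp
  then have k0: "real k > 0" using k by linarith
  define u where "u = t / real k"
  have "t < real k * min \<delta>1 \<delta>2" using k d by (simp only: pos_divide_less_eq)
  then have u: "u > 0" "u < min \<delta>1 \<delta>2"
    using t k0 by (simp_all add: u_def pos_divide_less_eq mult.commute del: min_less_iff_conj)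
  have ku: "real k * u = t" using k0 by (simp add: u_def)
  obtain h where h: "h \<in> std_group r" "norm (h - mat 1 - u *\<^sub>R X) \<le> \<eta> * u" using \<delta>2(2)[of u] u by auto
  have Eu: "norm (E u - mat 1 - u *\<^sub>R X) \<le> \<eta> * u" using \<delta>1(2)[of u] u by (simp add: E0)
  have near: "norm (f - mat 1) \<le> u * \<beta>" if "norm (f - mat 1 - u *\<^sub>R X) \<le> \<eta> * u" for f
  proof -
    have "norm (f - mat 1) \<le> norm (f - mat 1 - u *\<^sub>R X) + norm (u *\<^sub>R X)"
      by (metis diff_add_cancel norm_triangle_ineq)
    moreover have "\<eta> * u \<le> 1 * u" using \<eta> u by (intro mult_right_mono) auto
    moreover have "norm (u *\<^sub>R X) = u * norm X" using u by simp
    moreover have "u * \<beta> = u * norm X + 1 * u" by (simp add: \<beta>_def algebra_simps)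
    ultimately show ?thesis using that by linarith
  qed
  have "norm (h - E u) = norm ((h - mat 1 - u *\<^sub>R X) - (E u - mat 1 - u *\<^sub>R X))" by simp
  also have "\<dots> \<le> \<eta> * u + \<eta> * u" using order_trans[OF norm_triangle_ineq4 add_mono[OF h(2) Eu]] .
  finally have hE: "norm (h - E u) \<le> 2 * \<eta> * u" by simp
  have pow: "matpow (E u) n = E (real n * u)" for n
  proof (induction n)
    case (Suc n)
    have "real (Suc n) * u = real n * u + u" by (simp add: algebra_simps)
    then show ?case by (simp only: add matpow.simps Suc)
  qed (simp add: E0)
  have b0: "u * \<beta> \<ge> 0" using u by (simp add: \<beta>_def)
  have "(1 + u * \<beta>) ^ k \<le> exp (u * \<beta>) ^ k" using b0 by (intro power_mono exp_ge_add_one_self) auto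
  also have "\<dots> = K" unfolding K_def exp_of_nat_mult[symmetric] ku[symmetric] by (simp add: mult_ac)
  finally have bk: "(1 + u * \<beta>) ^ k \<le> K" .
  have "norm (matpow h k - E t) = norm (matpow h k - matpow (E u) k)" by (simp add: pow ku)
  also have "\<dots> \<le> real k * (1 + u * \<beta>) ^ k * norm (h - E u)"
    using near[OF h(2)] near[OF Eu] b0 by (rule norm_matpow_diff)
  also have "\<dots> \<le> real k * K * (2 * \<eta> * u)"
    using bk hE K b0 by (intro mult_mono) auto
  also have "\<dots> = 2 * \<eta> * t * K" using ku by (simp add: mult_ac)
  also have "\<dots> \<le> 2 * (\<epsilon> / (4 * t * K)) * t * K" using \<eta>(3) t K by (intro mult_right_mono mult_left_mono) auto
  also have "\<dots> = \<epsilon> / 2" using t K by simp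
  also have "\<dots> < \<epsilon>" using \<epsilon> by simp
  finally have "dist (matpow h k) (E t) < \<epsilon>" by (simp add: dist_norm)
  then show "\<exists>y\<in>std_group r. dist y (E t) < \<epsilon>" using matpow_in_std_group[OF h(1)] by blast
qed

lemma one_parameter_in_closure:
  assumes add: "\<And>s t. E (s + t) = E s ** E t" and E0: "E 0 = mat 1"
    and D: "(E has_vector_derivative X) (at 0)" and X: "X \<in> tangent r"
  shows "E t \<in> closure (std_group r)"
proof -
  consider "t > 0" | "t = 0" | "t < 0" by linarith
  then show ?thesis
  proof cases
    case 1
    then show ?thesis using one_parameter_in_closure_pos[OF add E0 D X] by blast
  next
    case 2
    then show ?thesis using std_group_id closure_subset E0 by (metis subsetD)
  next
    case 3
    have "((E \<circ> uminus) has_vector_derivative ((-1) *\<^sub>R X)) (at 0)"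
      by (rule vector_diff_chain_at) (use D in \<open>auto intro!: derivative_eq_intros\<close>)
    then have D': "((\<lambda>u. E (- u)) has_vector_derivative - X) (at 0)" by (simp add: o_def)
    have "E (- (- t)) \<in> closure (std_group r)"
    proof (rule one_parameter_in_closure_pos[where E = "\<lambda>u. E (- u)"])
      show "E (- (s + t)) = E (- s) ** E (- t)" for s t
        using add[of "- s" "- t"] by simp
    qed (use E0 D' tangent_uminus[OF X] 3 in auto)
    then show ?thesis by simp
  qed
qed

lemma closure_std_group_mult:
  assumes A: "A \<in> closure (std_group r)" and B: "B \<in> closure (std_group r)"
  shows "A ** B \<in> closure (std_group r)"
proof -
  obtain a b where a: "\<And>n. a n \<in> std_group r" "a \<longlonglongrightarrow> A" and b: "\<And>n. b n \<in> std_group r" "b \<longlonglongrightarrow> B"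
    using A B unfolding closure_sequential by blast
  have comp: "((\<lambda>n. X n $ i $ j) \<longlonglongrightarrow> Y $ i $ j)" if "X \<longlonglongrightarrow> Y" for X and Y :: "real^4^4" and i j
    using that by (intro tendsto_vec_nth)
  have "(\<lambda>n. (a n ** b n) $ i $ j) \<longlonglongrightarrow> (A ** B) $ i $ j" for i j
    unfolding matrix_matrix_mult_def vec_lambda_beta by (intro tendsto_intros comp a b)
  then have "(\<lambda>n. a n ** b n) \<longlonglongrightarrow> A ** B" by (intro vec_tendstoI)
  then show ?thesis
    unfolding closure_sequential using std_group_mult[OF a(1) b(1)] by (intro exI[of _ "\<lambda>n. a n ** b n"]) simp
qed

definition rotation12 :: "real \<Rightarrow> real^4^4" where
  "rotation12 t = vector [vector [cos t, - sin t, 0, 0], vector [sin t, cos t, 0, 0], vector [0, 0, 1, 0], vector [0, 0, 0, 1]]"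

definition rotation23 :: "real \<Rightarrow> real^4^4" where
  "rotation23 t = vector [vector [1, 0, 0, 0], vector [0, cos t, - sin t, 0], vector [0, sin t, cos t, 0], vector [0, 0, 0, 1]]"

lemma rotation12_vec: "rotation12 t *v x = vector [cos t * x$1 - sin t * x$2, sin t * x$1 + cos t * x$2, x$3, x$4]"
  and rotation23_vec: "rotation23 t *v x = vector [x$1, cos t * x$2 - sin t * x$3, sin t * x$2 + cos t * x$3, x$4]"
  by (simp_all add: rotation12_def rotation23_def vec_eq_iff forall_4 matrix_vector_mult_def sum_4)

lemma one_parameter_add:
  "rotation12 (s + t) = rotation12 s ** rotation12 t"
  "rotation23 (s + t) = rotation23 s ** rotation23 t"
  "boost (s + t) = boost s ** boost t"
  by (simp_all add: rotation12_def rotation23_def boost_def vec_eq_iff forall_4 matrix_matrix_mult_def sum_4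
      sin_add cos_add sinh_add cosh_add algebra_simps)

lemma one_parameter_zero: "rotation12 0 = mat 1" "rotation23 0 = mat 1" "boost 0 = mat 1"
  by (simp_all add: rotation12_def rotation23_def boost_def vec_eq_iff forall_4 mat_def)

lemma one_parameter_adj:
  "mink_adj (rotation12 t) = rotation12 (- t)" "mink_adj (rotation23 t) = rotation23 (- t)" "mink_adj (boost t) = boost (- t)"
  by (simp_all add: rotation12_def rotation23_def boost_def vec_eq_iff forall_4 mink_adj_def mink_sign_def)

lemma SLorentz_rotations: "rotation12 t \<in> SLorentz_group" "rotation23 t \<in> SLorentz_group"
proof -
  have L: "rotation12 t \<in> Lorentz_group" "rotation23 t \<in> Lorentz_group" for t
  proof -
    have "lorentz (rotation12 t)" "lorentz (rotation23 t)"
      unfolding lorentz_iff_adj_mult one_parameter_adj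
      by (simp_all add: one_parameter_add[symmetric] one_parameter_zero)
    then show "rotation12 t \<in> Lorentz_group" "rotation23 t \<in> Lorentz_group"
      by (simp_all add: Lorentz_group_def) (simp_all add: rotation12_def rotation23_def)
  qed
  show "rotation12 t \<in> SLorentz_group" "rotation23 t \<in> SLorentz_group"
    using det_eq_1_of_square[OF L(1) L(1), of t "t/2"] det_eq_1_of_square[OF L(2) L(2), of t "t/2"]
      one_parameter_add(1,2)[of "t/2" "t/2"] by simp_all
qed

lemma one_parameter_derivative:
  "(rotation12 has_vector_derivative lie 0 0 1 0 0 0) (at 0)"
  "(rotation23 has_vector_derivative lie 1 0 0 0 0 0) (at 0)"
  "(boost has_vector_derivative lie 0 0 0 1 0 0) (at 0)"
proof -
  define D :: "real \<Rightarrow> real \<Rightarrow> real \<Rightarrow> real \<Rightarrow> real^4^4" where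
    "D a b c d = vector [vector [a, 0, 0, 0], vector [0, b, 0, 0], vector [0, 0, c, 0], vector [0, 0, 0, d]]" for a b c d
  have "rotation12 t = mat 1 + sin t *\<^sub>R lie 0 0 1 0 0 0 + (cos t - 1) *\<^sub>R D 1 1 0 0"
    "rotation23 t = mat 1 + sin t *\<^sub>R lie 1 0 0 0 0 0 + (cos t - 1) *\<^sub>R D 0 1 1 0"
    "boost t = mat 1 + sinh t *\<^sub>R lie 0 0 0 1 0 0 + (cosh t - 1) *\<^sub>R D 1 0 0 1" for t
    by (simp_all add: D_def lie_def rotation12_def rotation23_def boost_def vec_eq_iff forall_4 mat_def)
  then have E: "rotation12 = (\<lambda>t. mat 1 + sin t *\<^sub>R lie 0 0 1 0 0 0 + (cos t - 1) *\<^sub>R D 1 1 0 0)"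
    "rotation23 = (\<lambda>t. mat 1 + sin t *\<^sub>R lie 1 0 0 0 0 0 + (cos t - 1) *\<^sub>R D 0 1 1 0)"
    "boost = (\<lambda>t. mat 1 + sinh t *\<^sub>R lie 0 0 0 1 0 0 + (cosh t - 1) *\<^sub>R D 1 0 0 1)"
    by auto
  have "((\<lambda>t. mat 1 + sin t *\<^sub>R X + (cos t - 1) *\<^sub>R Y) has_vector_derivative X) (at 0)"
    "((\<lambda>t. mat 1 + sinh t *\<^sub>R X + (cosh t - 1) *\<^sub>R Y) has_vector_derivative X) (at 0)" for X Y :: "real^4^4"
    by (auto intro!: derivative_eq_intros simp: has_vector_derivative_def)
  then show "(rotation12 has_vector_derivative lie 0 0 1 0 0 0) (at 0)"
    "(rotation23 has_vector_derivative lie 1 0 0 0 0 0) (at 0)"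
    "(boost has_vector_derivative lie 0 0 0 1 0 0) (at 0)"
    unfolding E by blast+
qed

section \<open>Factoring Lorentz matrices into rotations and boosts\<close>

lemma ex_rotation_angle:
  fixes a b :: real
  shows "\<exists>t. cos t * a - sin t * b = sqrt (a\<^sup>2 + b\<^sup>2) \<and> sin t * a + cos t * b = 0"
proof (cases "a = 0 \<and> b = 0")
  case False
  define \<rho> where "\<rho> = sqrt (a\<^sup>2 + b\<^sup>2)"
  have "a\<^sup>2 + b\<^sup>2 > 0" using False by (simp add: sum_power2_gt_zero_iff)
  then have \<rho>: "\<rho> > 0" "\<rho>\<^sup>2 = a\<^sup>2 + b\<^sup>2" by (simp_all add: \<rho>_def)
  have "(a / \<rho>)\<^sup>2 + (- b / \<rho>)\<^sup>2 = (a\<^sup>2 + b\<^sup>2) / \<rho>\<^sup>2"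
    by (simp add: power_divide add_divide_distrib)
  also have "\<dots> = 1" using \<rho>(1) unfolding \<rho>(2)[symmetric] by simp
  finally have "(a / \<rho>)\<^sup>2 + (- b / \<rho>)\<^sup>2 = 1" .
  then obtain t where t: "a / \<rho> = cos t" "- b / \<rho> = sin t" using sincos_total_2pi by metis
  have "cos t * a - sin t * b = \<rho>\<^sup>2 / \<rho>"
    unfolding t[symmetric] \<rho>(2) by (simp add: power2_eq_square add_divide_distrib)
  moreover have "sin t * a + cos t * b = 0" unfolding t[symmetric] by simp
  moreover have "\<rho>\<^sup>2 / \<rho> = \<rho>" using \<rho>(1) by (simp add: power2_eq_square)
  ultimately show ?thesis unfolding \<rho>_def[symmetric] by (intro exI[of _ t]) simp
qed auto

text \<open>Left multiplications straighten M column by column: rotations and a boost restore the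
  time axis, rotations then the first and the second axis, and the determinant fixes the sign on the
  third. P stays abstract so that it can record membership in a closure.\<close>

lemma SLorentz_decomposition:
  assumes M: "M \<in> SLorentz_group"
    and P_mult: "\<And>A B. A \<in> P \<Longrightarrow> B \<in> P \<Longrightarrow> A ** B \<in> P" and P_SL: "P \<subseteq> SLorentz_group"
    and P_rot: "\<And>t. rotation12 t \<in> P" "\<And>t. rotation23 t \<in> P" "\<And>t. boost t \<in> P"
  shows "\<exists>K\<in>P. K ** M = mat 1"
proof -
  have reduce: "\<exists>K\<in>P. K *v axis 4 1 = axis 4 1 \<and> (K *v x)$2 = 0 \<and> (K *v x)$3 = 0 \<and> (K *v x)$1 \<ge> 0 \<and> (K *v x)$4 = x$4" for x :: "real^4"
  proof -
    obtain s where s: "sin s * x$2 + cos s * x$3 = 0" using ex_rotation_angle by blast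
    define y where "y = cos s * x$2 - sin s * x$3"
    obtain t where t: "cos t * x$1 - sin t * y = sqrt ((x$1)\<^sup>2 + y\<^sup>2)" "sin t * x$1 + cos t * y = 0"
      using ex_rotation_angle by blast
    have "(rotation12 t ** rotation23 s) *v x = vector [sqrt ((x$1)\<^sup>2 + y\<^sup>2), 0, 0, x$4]"
      using s t by (simp add: matrix_vector_mul_assoc[symmetric] rotation12_vec rotation23_vec y_def)
    moreover have "(rotation12 t ** rotation23 s) *v axis 4 1 = axis 4 1"
      by (simp add: matrix_vector_mul_assoc[symmetric] rotation12_vec rotation23_vec vec_eq_iff forall_4 axis_def)
    moreover have "rotation12 t ** rotation23 s \<in> P" by (intro P_mult P_rot)
    ultimately show ?thesis by (intro bexI[of _ "rotation12 t ** rotation23 s"]) simp_all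
  qed
  have SL: "lorentz A" if "A \<in> SLorentz_group" for A using that by (simp add: SLorentz_group_def Lorentz_group_def)
  have L: "mink (A *v x) (A *v y) = mink x y" if "A \<in> SLorentz_group" for A x y using SL[OF that] by (simp add: lorentz_def)
  have H: "A *v axis 4 1 \<in> hyperboloid" if "A \<in> SLorentz_group" for A
    using that by (intro Lorentz_group_hyperboloid axis_4_hyperboloid) (simp add: SLorentz_group_def)
  have PM: "K ** A \<in> SLorentz_group" if "K \<in> P" "A \<in> SLorentz_group" for K A
    using that P_SL by (intro SLorentz_group_mult) auto
  obtain K1 where K1: "K1 \<in> P" "(K1 *v (M *v axis 4 1))$2 = 0" "(K1 *v (M *v axis 4 1))$3 = 0"
    using reduce[of "M *v axis 4 1"] by blast
  define u where "u = (K1 ** M) *v axis 4 1"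
  have u: "u \<in> hyperboloid" "u$2 = 0" "u$3 = 0"
    using H[OF PM[OF K1(1) M]] K1 by (simp_all add: u_def matrix_vector_mul_assoc)
  define \<tau> where "\<tau> = arsinh (u$1)"
  have sh: "sinh \<tau> = u$1" by (simp add: \<tau>_def)
  have "(u$4)\<^sup>2 = (cosh \<tau>)\<^sup>2"
    using u unfolding cosh_square_eq sh by (simp add: hyperboloid_def mink_def power2_eq_square)
  then have ch: "cosh \<tau> = u$4"
    using u(1) by (simp add: hyperboloid_def power2_eq_iff_nonneg)
  define M1 where "M1 = boost (- \<tau>) ** (K1 ** M)"
  have M1: "M1 \<in> SLorentz_group" unfolding M1_def by (intro PM P_rot K1(1) M)
  have "u$4 * u$4 - u$1 * u$1 = 1" using u by (simp add: hyperboloid_def mink_def)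
  then have e4: "M1 *v axis 4 1 = axis 4 1"
    using u unfolding M1_def matrix_vector_mul_assoc[symmetric, of "boost (- \<tau>)"] u_def[symmetric]
    by (simp add: boost_vec sh ch vec_eq_iff forall_4 axis_def)
  obtain K2 where K2: "K2 \<in> P" "K2 *v axis 4 1 = axis 4 1" "(K2 *v (M1 *v axis 1 1))$2 = 0" "(K2 *v (M1 *v axis 1 1))$3 = 0"
      "(K2 *v (M1 *v axis 1 1))$1 \<ge> 0"
    using reduce[of "M1 *v axis 1 1"] by blast
  define M2 where "M2 = K2 ** M1"
  have M2: "M2 \<in> SLorentz_group" unfolding M2_def by (intro PM K2(1) M1)
  have M2e4: "M2 *v axis 4 1 = axis 4 1" by (simp add: M2_def matrix_vector_mul_assoc[symmetric] e4 K2)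
  have time: "(A *v axis i 1)$4 = 0" if "A \<in> SLorentz_group" "A *v axis 4 1 = axis 4 1" "i \<noteq> 4" for A i
    using L[OF that(1), of "axis i 1" "axis 4 1"] that(2,3) by (simp add: mink_axis_4) (simp add: axis_def)
  have M2e1: "M2 *v axis 1 1 = axis 1 1"
  proof -
    define w where "w = M2 *v axis 1 1"
    have w: "w$2 = 0" "w$3 = 0" "w$1 \<ge> 0" using K2 by (simp_all add: w_def M2_def matrix_vector_mul_assoc[symmetric])
    have w4: "w$4 = 0" unfolding w_def using time[OF M2 M2e4, of 1] by simp
    have "mink w w = 1" unfolding w_def L[OF M2] by (simp add: mink_def axis_def)
    then have "w$1 * w$1 = 1" using w w4 by (simp add: mink_def)
    then have "w$1 = 1" using w(3) square_eq_1_iff by fastforce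
    then show ?thesis unfolding w_def[symmetric] using w w4 by (simp add: vec_eq_iff forall_4 axis_def)
  qed
  define z where "z = M2 *v axis 2 1"
  obtain s where s: "cos s * z$2 - sin s * z$3 = sqrt ((z$2)\<^sup>2 + (z$3)\<^sup>2)" "sin s * z$2 + cos s * z$3 = 0"
    using ex_rotation_angle by blast
  define M3 where "M3 = rotation23 s ** M2"
  have M3: "M3 \<in> SLorentz_group" unfolding M3_def by (intro PM P_rot M2)
  have e14: "M3 *v axis 4 1 = axis 4 1" "M3 *v axis 1 1 = axis 1 1"
    unfolding M3_def matrix_vector_mul_assoc[symmetric] M2e4 M2e1
    by (simp_all add: rotation23_vec vec_eq_iff forall_4 axis_def)
  have z4: "z$4 = 0" unfolding z_def using time[OF M2 M2e4, of 2] by simp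
  have first: "(A *v axis i 1)$1 = 0" if "A \<in> SLorentz_group" "A *v axis 1 1 = axis 1 1" "i \<noteq> 1" for A i
  proof -
    have "mink (A *v axis i 1) (axis 1 1) = mink (axis i 1) (axis 1 (1::real))"
      using L[OF that(1), of "axis i 1" "axis 1 1"] that(2) by simp
    then show ?thesis using that(3) by (simp add: mink_def axis_def)
  qed
  have z1: "z$1 = 0" unfolding z_def using first[OF M2 M2e1, of 2] by simp
  have "mink z z = 1" unfolding z_def L[OF M2] by (simp add: mink_def axis_def)
  then have "(z$2)\<^sup>2 + (z$3)\<^sup>2 = 1" using z1 z4 by (simp add: mink_def power2_eq_square)
  then have e2: "M3 *v axis 2 1 = axis 2 1"
    using s z1 z4 unfolding M3_def matrix_vector_mul_assoc[symmetric] z_def[symmetric]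
    by (simp add: rotation23_vec vec_eq_iff forall_4 axis_def)
  define y where "y = M3 *v axis 3 1"
  have y1: "y$1 = 0" and y4: "y$4 = 0"
    unfolding y_def using first[OF M3 e14(2), of 3] time[OF M3 e14(1), of 3] by simp_all
  have y2: "y$2 = 0"
    using L[OF M3, of "axis 3 1" "axis 2 1"] unfolding e2 y_def[symmetric] by (simp add: mink_def axis_def)
  have col: "M3$i$j = (M3 *v axis j 1)$i" for i j by (simp add: matrix_axis_nth)
  have "det M3 = (\<Prod>i\<in>UNIV. M3$i$i)"
  proof (rule det_diagonal)
    fix i j :: 4 assume "i \<noteq> j"
    then show "M3$i$j = 0"
      unfolding col using exhaust_4[of i] exhaust_4[of j] e14 e2 y1 y2 y4
      by (auto simp: y_def[symmetric]) (simp_all add: axis_def)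
  qed
  also have "\<dots> = (\<Prod>i\<in>(UNIV :: 4 set). if i = 3 then y$3 else 1)"
  proof (rule prod.cong)
    fix i :: 4
    show "M3$i$i = (if i = 3 then y$3 else 1)"
      unfolding col using exhaust_4[of i] e14 e2 by (auto simp: y_def[symmetric])
  qed simp
  also have "\<dots> = y$3" by (simp add: prod.delta)
  finally have y3: "y$3 = 1" using M3 by (simp add: SLorentz_group_def)
  have e3: "M3 *v axis 3 1 = axis 3 1"
    unfolding y_def[symmetric] using y1 y2 y3 y4 by (simp add: vec_eq_iff forall_4 axis_def)
  have "M3 *v axis j 1 = axis j 1" for j using exhaust_4[of j] e14 e2 e3 by auto
  then have "M3 = mat 1" by (simp add: vec_eq_iff col axis_def mat_def)
  then have "(rotation23 s ** (K2 ** (boost (- \<tau>) ** K1))) ** M = mat 1"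
    unfolding M3_def M2_def M1_def by (simp add: matrix_mul_assoc)
  moreover have "rotation23 s ** (K2 ** (boost (- \<tau>) ** K1)) \<in> P" by (intro P_mult P_rot K1(1) K2(1))
  ultimately show ?thesis by blast
qed

lemma std_group_dense:
  assumes r: "r > 0" and acc: "\<And>\<epsilon>. \<epsilon> > 0 \<Longrightarrow> \<exists>A\<in>std_group r. A \<noteq> mat 1 \<and> norm (A - mat 1) < \<epsilon>"
    and M: "M \<in> SLorentz_group"
  shows "M \<in> closure (std_group r)"
proof -
  obtain X where X: "X \<in> tangent r" "X \<noteq> 0" using ex_nonzero_tangent acc by blast
  note gens = tangent_generators[OF r X]
  have cl: "rotation12 t \<in> closure (std_group r)" "rotation23 t \<in> closure (std_group r)" "boost t \<in> closure (std_group r)" for t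
    using one_parameter_in_closure[OF one_parameter_add(1) one_parameter_zero(1) one_parameter_derivative(1) gens(1)]
      one_parameter_in_closure[OF one_parameter_add(2) one_parameter_zero(2) one_parameter_derivative(2) gens(2)]
      one_parameter_in_closure[OF one_parameter_add(3) one_parameter_zero(3) one_parameter_derivative(3) gens(3)]
    by blast+
  \<comment> \<open>The condition is on the inverse, since the decomposition produces K with
    \<open>K ** M = mat 1\<close>, so that M is the inverse of K.\<close>
  define P where "P = {K \<in> SLorentz_group. mink_adj K \<in> closure (std_group r)}"
  obtain K where K: "K \<in> P" "K ** M = mat 1"
  proof -
    have "\<exists>K\<in>P. K ** M = mat 1"
    proof (rule SLorentz_decomposition[OF M])
      fix A B assume "A \<in> P" "B \<in> P"
      then show "A ** B \<in> P"
        by (simp add: P_def SLorentz_group_mult mink_adj_mult closure_std_group_mult)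
    qed (auto simp: P_def SLorentz_rotations SLorentz_boost one_parameter_adj cl)
    then show ?thesis using that by blast
  qed
  have "mink_adj K ** (K ** M) = M"
    using Q_inverse(1)[of K] K(1) by (simp add: matrix_mul_assoc P_def SLorentz_group_def)
  then have "M = mink_adj K" by (simp add: K(2))
  then show ?thesis using K(1) by (simp add: P_def)
qed

section \<open>The trichotomy\<close>

lemma norm_conj_le:
  "norm (Q ** A ** mink_adj Q) \<le> (norm Q)\<^sup>2 * norm A"
proof -
  have "norm (Q ** A ** mink_adj Q) \<le> norm (Q ** A) * norm Q"
    using norm_matrix_mult_le[of "Q ** A" "mink_adj Q"] by (simp add: norm_mink_adj)
  also have "\<dots> \<le> norm Q * norm A * norm Q" by (intro mult_right_mono norm_matrix_mult_le) simp
  finally show ?thesis by (simp add: power2_eq_square mult_ac)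
qed

lemma conj_act_near:
  assumes Q: "Q \<in> Lorentz_group" and U: "openin Isom_plus_topology U"
    and M: "M \<in> SLorentz_group" "conj_act Q M \<in> U"
  shows "\<exists>\<delta>>0. \<forall>A\<in>SLorentz_group. norm (A - M) < \<delta> \<longrightarrow> conj_act Q A \<in> U"
proof -
  let ?c = "\<lambda>A. Q ** A ** mink_adj Q"
  obtain \<delta> where \<delta>: "\<delta> > 0" "\<And>B. B \<in> SLorentz_group \<Longrightarrow> norm (B - ?c M) < \<delta> \<Longrightarrow> hyp_act B \<in> U"
    using openin_Isom_plus_topology_near[OF U conj_SLorentz[OF Q M(1)]] M(2) unfolding conj_act_def by blast
  define K where "K = (norm Q)\<^sup>2 + 1"
  have K: "K > 0" by (simp add: K_def add_nonneg_pos)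
  have "conj_act Q A \<in> U" if A: "A \<in> SLorentz_group" "norm (A - M) < \<delta> / K" for A
    unfolding conj_act_def
  proof (rule \<delta>(2)[OF conj_SLorentz[OF Q A(1)]])
    have "?c A - ?c M = ?c (A - M)" by (simp add: matrix_diff_ldistrib matrix_diff_rdistrib)
    then have "norm (?c A - ?c M) \<le> (norm Q)\<^sup>2 * norm (A - M)" using norm_conj_le by metis
    also have "\<dots> \<le> K * norm (A - M)" by (intro mult_right_mono) (simp_all add: K_def)
    also have "\<dots> < \<delta>" using A(2) K by (simp add: field_simps)
    finally show "norm (?c A - ?c M) < \<delta>" .
  qed
  then show ?thesis using \<delta>(1) K by (intro exI[of _ "\<delta> / K"]) auto
qed

text \<open>An open set isolating the identity would contain the action of every group element close
  to \<open>mat 1\<close>; as the action is faithful, such elements would equal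
  \<open>mat 1\<close>.\<close>

lemma not_discrete_if_accumulates:
  assumes Q: "Q \<in> Lorentz_group"
    and acc: "\<And>\<epsilon>. \<epsilon> > 0 \<Longrightarrow> \<exists>A\<in>std_group r. A \<noteq> mat 1 \<and> norm (A - mat 1) < \<epsilon>"
  shows "\<not> discrete_in_Isom_plus (conj_act Q ` std_group r)"
proof
  let ?G = "conj_act Q ` std_group r"
  assume "discrete_in_Isom_plus ?G"
  then have "openin (subtopology Isom_plus_topology ?G) {conj_act Q (mat 1)}"
    using std_group_id by (simp add: discrete_in_Isom_plus_def)
  then obtain U where U: "openin Isom_plus_topology U" "{conj_act Q (mat 1)} = U \<inter> ?G"
    by (auto simp: openin_subtopology)
  then have "conj_act Q (mat 1) \<in> U" by blast
  then obtain \<delta> where \<delta>: "\<delta> > 0" "\<And>A. A \<in> SLorentz_group \<Longrightarrow> norm (A - mat 1) < \<delta> \<Longrightarrow> conj_act Q A \<in> U"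
    using conj_act_near[OF Q U(1) SLorentz_group_id] by blast
  obtain A where A: "A \<in> std_group r" "A \<noteq> mat 1" "norm (A - mat 1) < \<delta>" using acc[OF \<delta>(1)] by blast
  then have "conj_act Q A \<in> U \<inter> ?G" using \<delta>(2) std_group_SLorentz by blast
  then have "conj_act Q A = conj_act Q (mat 1)" using U(2) by blast
  then have "hyp_act (Q ** A ** mink_adj Q) = hyp_act (Q ** mat 1 ** mink_adj Q)" by (simp only: conj_act_def)
  moreover have "Q ** A ** mink_adj Q \<in> Lorentz_group" "Q ** mat 1 ** mink_adj Q \<in> Lorentz_group"
    using conj_SLorentz[OF Q] std_group_SLorentz[OF A(1)] SLorentz_group_id SLorentz_group_Lorentz by blast+
  ultimately have "Q ** A ** mink_adj Q = Q ** mat 1 ** mink_adj Q"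
    using inj_on_hyp_act unfolding inj_on_def by blast
  then have "mink_adj Q ** (Q ** A ** mink_adj Q) ** Q = mink_adj Q ** (Q ** mat 1 ** mink_adj Q) ** Q"
    by (rule arg_cong)
  then have "(mink_adj Q ** Q) ** A ** (mink_adj Q ** Q) = (mink_adj Q ** Q) ** mat 1 ** (mink_adj Q ** Q)"
    by (simp only: matrix_mul_assoc)
  then show False using A(2) by (simp add: Q_inverse[OF Q])
qed

lemma dense_if_accumulates:
  assumes Q: "Q \<in> Lorentz_group" and r: "r > 0"
    and acc: "\<And>\<epsilon>. \<epsilon> > 0 \<Longrightarrow> \<exists>A\<in>std_group r. A \<noteq> mat 1 \<and> norm (A - mat 1) < \<epsilon>"
  shows "dense_in_Isom_plus (conj_act Q ` std_group r)"
  unfolding dense_in_Isom_plus_def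
proof
  let ?G = "conj_act Q ` std_group r"
  show "Abstract_Topology.closure_of Isom_plus_topology ?G \<subseteq> carrier Isom_plus"
    using closure_of_subset_topspace[of Isom_plus_topology ?G] by (simp add: topspace_Isom_plus_topology)
  show "carrier Isom_plus \<subseteq> Abstract_Topology.closure_of Isom_plus_topology ?G"
  proof
    fix f assume f: "f \<in> carrier Isom_plus"
    then obtain M where M: "M \<in> SLorentz_group" "f = hyp_act M" by (auto simp: carrier_Isom_plus)
    define N where "N = mink_adj Q ** M ** mink_adj (mink_adj Q)"
    have N: "N \<in> SLorentz_group"
      unfolding N_def by (rule conj_SLorentz[OF Lorentz_group_adj[OF Q] M(1)])
    have "Q ** N ** mink_adj Q = (Q ** mink_adj Q) ** M ** (Q ** mink_adj Q)"
      unfolding N_def mink_adj_adj by (simp only: matrix_mul_assoc)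
    then have fN: "f = conj_act Q N" by (simp add: conj_act_def M(2) Q_inverse[OF Q])
    show "f \<in> Abstract_Topology.closure_of Isom_plus_topology ?G"
      unfolding in_closure_of
    proof (intro conjI allI impI)
      show "f \<in> topspace Isom_plus_topology" using f by (simp add: topspace_Isom_plus_topology)
      fix U assume U: "f \<in> U \<and> openin Isom_plus_topology U"
      then obtain \<delta> where \<delta>: "\<delta> > 0" "\<And>A. A \<in> SLorentz_group \<Longrightarrow> norm (A - N) < \<delta> \<Longrightarrow> conj_act Q A \<in> U"
        using conj_act_near[OF Q conjunct2[OF U] N conjunct1[OF U[unfolded fN]]] by metis
      have "N \<in> closure (std_group r)" using r acc N by (rule std_group_dense)
      then obtain A where A: "A \<in> std_group r" "dist A N < \<delta>" using \<delta>(1) unfolding closure_approachable by blast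
      then have "conj_act Q A \<in> ?G" "conj_act Q A \<in> U"
        using A \<delta>(2)[of A] std_group_SLorentz[OF A(1)] by (simp_all add: dist_norm)
      then show "\<exists>g. g \<in> ?G \<and> g \<in> U" by blast
    qed
  qed
qed

lemma cos_r_seq_bounds:
  assumes "n \<ge> 5"
  shows "0 < cos (2 * pi / real n)"
proof (rule cos_gt_zero)
  show "0 < 2 * pi / real n" using assms by simp
  have "2 * pi / real n \<le> 2 * pi / 5" using assms by (intro divide_left_mono) auto
  also have "\<dots> < pi / 2" using pi_gt_zero by simp
  finally show "2 * pi / real n < pi / 2" .
qed

text \<open>The circular and hyperbolic half-angle formulas match. The value of \<open>sinh\<close>
  decides the shape of the chamber at infinity, the value of \<open>cosh\<close> is the Coxeter
  condition on the mirrors 1 and 4.\<close>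

lemma cosh_r_seq:
  assumes "n \<ge> 5"
  shows "r_seq n > 0" "cosh (r_seq n) = 1 + 2 * cos (2 * pi / real n)"
    "(sinh (r_seq n / 2))\<^sup>2 = cos (2 * pi / real n)" "cosh (r_seq n / 2) / sqrt 2 = cos (pi / real n)"
proof -
  let ?c = "cos (2 * pi / real n)"
  have c: "?c > 0" using cos_r_seq_bounds[OF assms] .
  show 1: "cosh (r_seq n) = 1 + 2 * ?c" using c by (simp add: r_seq_def)
  have "r_seq n \<ge> 0" using c by (simp add: r_seq_def arcosh_nonneg_real)
  moreover have "r_seq n \<noteq> 0" using 1 c by auto
  ultimately show "r_seq n > 0" by simp
  have d: "cosh (r_seq n) = 1 + 2 * (sinh (r_seq n / 2))\<^sup>2"
    using cosh_double[of "r_seq n / 2"] cosh_square_eq[of "r_seq n / 2"] by simp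
  then show s: "(sinh (r_seq n / 2))\<^sup>2 = ?c" using 1 by simp
  have "(cosh (r_seq n / 2))\<^sup>2 = 1 + ?c" by (simp add: cosh_square_eq s)
  also have "\<dots> = 2 * (cos (pi / real n))\<^sup>2" using cos_double_cos[of "pi / real n"] by simp
  finally have sq: "(cosh (r_seq n / 2) / sqrt 2)\<^sup>2 = (cos (pi / real n))\<^sup>2" by (simp add: power_divide)
  have c0: "cos (pi / real n) \<ge> 0"
  proof (rule cos_ge_zero)
    have "0 \<le> pi / real n" by simp
    then show "- (pi / 2) \<le> pi / real n" using pi_gt_zero by linarith
    show "pi / real n \<le> pi / 2" using assms by (intro divide_left_mono) auto
  qed
  show "cosh (r_seq n / 2) / sqrt 2 = cos (pi / real n)"
    by (rule power2_eq_imp_eq[OF sq _ c0]) simp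
qed

lemma hyp_chamberI:
  assumes "Q \<in> Lorentz_group" "r > 0" "cosh (r/2) / sqrt 2 \<ge> 1 \<or> (\<exists>m\<ge>2. cosh (r/2) / sqrt 2 = cos (pi / real m))"
  shows "hyp_chamber r Q"
proof -
  interpret coxeter_system mink "wall_normal r" using assms(3) by (rule coxeter_system_wall_normal)
  show ?thesis using assms(1,2) by unfold_locales
qed

lemma hyp_chamber_r_seq:
  assumes "Q \<in> Lorentz_group" "n \<ge> 5"
  shows "hyp_chamber (r_seq n) Q"
  using assms(2) cosh_r_seq(1,4)[OF assms(2)]
  by (intro hyp_chamberI[OF assms(1)] disjI2 exI[of _ n]) auto

lemma hyp_chamber_r_infty:
  assumes "Q \<in> Lorentz_group" "r \<ge> r_infty"
  shows "hyp_chamber r Q"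
proof (rule hyp_chamberI[OF assms(1)])
  have inf: "cosh r_infty = 3" "r_infty \<ge> 0" by (simp_all add: r_infty_def arcosh_nonneg_real)
  then have c: "cosh r \<ge> 3" using assms(2) by (metis cosh_real_nonneg_le_iff order_trans)
  then have "r \<noteq> 0" by auto
  then show "r > 0" using inf(2) assms(2) by simp
  have "cosh r = 2 * (cosh (r/2))\<^sup>2 - 1"
    using cosh_double[of "r/2"] cosh_square_eq[of "r/2"] by simp
  then have "1\<^sup>2 \<le> (cosh (r/2) / sqrt 2)\<^sup>2" using c by (simp add: power_divide)
  then have "1 \<le> cosh (r/2) / sqrt 2" by (rule power2_le_imp_le) simp
  then show "cosh (r/2) / sqrt 2 \<ge> 1 \<or> (\<exists>m\<ge>2. cosh (r/2) / sqrt 2 = cos (pi / real m))" by blast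
qed

lemma r_seq_tendsto: "r_seq \<longlonglongrightarrow> r_infty"
proof -
  have "(\<lambda>n. 2 * pi / real n) \<longlonglongrightarrow> 0" by (rule lim_const_over_n)
  then have "(\<lambda>n. 1 + 2 * cos (2 * pi / real n)) \<longlonglongrightarrow> 1 + 2 * cos 0" by (intro tendsto_intros)
  then have "(\<lambda>n. arcosh (1 + 2 * cos (2 * pi / real n))) \<longlonglongrightarrow> arcosh (1 + 2 * cos 0)"
    by (rule tendsto_arcosh) simp
  then show ?thesis by (simp add: r_seq_def[abs_def] r_infty_def)
qed

theorem theorem2:
  fixes x0 :: hyp3 and v1 v2 v3 :: "real^4"
  assumes "orthonormal_frame x0 v1 v2 v3"
  shows "r_seq \<longlonglongrightarrow> r_infty \<and>
    (\<forall>r>0. discrete_in_Isom_plus (G_group x0 v1 v2 v3 r) \<longleftrightarrow>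
       r \<in> {r_seq n | n. n \<ge> 5} \<union> {r_infty..}) \<and>
    (\<forall>r>0. r \<notin> {r_seq n | n. n \<ge> 5} \<union> {r_infty..} \<longrightarrow>
       dense_in_Isom_plus (G_group x0 v1 v2 v3 r)) \<and>
    cocompact (G_group x0 v1 v2 v3 (r_seq 5)) \<and>
    \<not> cocompact (G_group x0 v1 v2 v3 (r_seq 6)) \<and>
    finite_covolume (G_group x0 v1 v2 v3 (r_seq 6)) \<and>
    (\<forall>n\<ge>7. infinite_covolume (G_group x0 v1 v2 v3 (r_seq n)))"
proof -
  define Q where "Q = frame_matrix x0 v1 v2 v3"
  have Q: "Q \<in> Lorentz_group" unfolding Q_def using assms by (rule frame_matrix_Lorentz)
  have G: "G_group x0 v1 v2 v3 r = conj_act Q ` std_group r" for r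
    unfolding Q_def using assms by (rule G_group_eq)
  let ?R = "{r_seq n | n. n \<ge> 5} \<union> {r_infty..}"
  have chamber: "hyp_chamber r Q" if "r \<in> ?R" for r
    using that hyp_chamber_r_seq[OF Q] hyp_chamber_r_infty[OF Q] by auto
  have acc: "\<exists>A\<in>std_group r. A \<noteq> mat 1 \<and> norm (A - mat 1) < \<epsilon>" if "r > 0" "r \<notin> ?R" "\<epsilon> > 0" for r \<epsilon>
    using that by (intro std_group_accumulates) auto
  have discrete: "discrete_in_Isom_plus (conj_act Q ` std_group r) \<longleftrightarrow> r \<in> ?R" if "r > 0" for r
  proof
    assume "discrete_in_Isom_plus (conj_act Q ` std_group r)"
    then show "r \<in> ?R" using not_discrete_if_accumulates[OF Q acc[OF that]] by blast
  next
    assume "r \<in> ?R"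
    from hyp_chamber.G_discrete[OF chamber[OF this]] show "discrete_in_Isom_plus (conj_act Q ` std_group r)"
      unfolding hyp_chamber.G_def[OF chamber[OF \<open>r \<in> ?R\<close>]] .
  qed
  have dense: "dense_in_Isom_plus (conj_act Q ` std_group r)" if "r > 0" "r \<notin> ?R" for r
    by (rule dense_if_accumulates[OF Q that(1) acc[OF that]])
  have ch: "hyp_chamber (r_seq n) Q" if "n \<ge> 5" for n using hyp_chamber_r_seq[OF Q that] .
  \<comment> \<open>The critical value 1/2 is the cosine of \<pi>/3 = 2\<pi>/6: n = 5 lies below it,
    n = 6 on it and n \<ge> 7 above it.\<close>
  have "cos (2 * pi / 5) < cos (pi / 3)" using pi_gt_zero by (intro cos_monotone_0_pi) auto
  then have 5: "cocompact (conj_act Q ` std_group (r_seq 5))"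
    using hyp_chamber.cocompact_if[OF ch[of 5]] cosh_r_seq(3)[of 5] hyp_chamber.G_def[OF ch[of 5]]
    by (simp add: cos_60)
  have "(sinh (r_seq 6 / 2))\<^sup>2 = 1/2"
    using cosh_r_seq(3)[of 6] by (simp add: cos_60)
  then have 6: "\<not> cocompact (conj_act Q ` std_group (r_seq 6))" "finite_covolume (conj_act Q ` std_group (r_seq 6))"
    using hyp_chamber.not_cocompact_if[OF ch[of 6]] hyp_chamber.finite_covolume_if[OF ch[of 6]]
      hyp_chamber.G_def[OF ch[of 6]] by simp_all
  have 7: "infinite_covolume (conj_act Q ` std_group (r_seq n))" if n: "n \<ge> 7" for n
  proof -
    have "cos (pi / 3) < cos (2 * pi / real n)"
      using n pi_gt_zero by (intro cos_monotone_0_pi) (auto simp: field_simps)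
    then show ?thesis
      using hyp_chamber.infinite_covolume_if[OF ch[of n]] cosh_r_seq(3)[of n] hyp_chamber.G_def[OF ch[of n]] n
      by (simp add: cos_60)
  qed
  show ?thesis
    unfolding G using r_seq_tendsto discrete dense 5 6 7 by blast
qed

end
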